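(* Let $\alpha>-1$ and $t\in\mathbb{R}$ be fixed. The ratio $D_n(t)/D_n(0)$ has the following expansion as $n\to\infty$: $$\frac{D_n(t)}{D_n(0)}=\exp\bigg[-\frac{nt}{2}+\frac{t(t+8\alpha)}{16}+\frac{t(1-4\alpha^2)}{8n}+\frac{t(1-4\alpha^2)(t-4\alpha)}{32n^2}+\frac{t(1-4\alpha^2)(t^2-6\alpha t+12\alpha^2+3)}{96n^3}+O\left(\frac1{n^4}\right)\bigg].$$ Moreover, the Hankel determinant $D_n(t)$ has the large $n$ asymptotic expansion $$\begin{aligned}D_n(t)={}&\frac{\pi^{n+\alpha+\frac12}\,n^{\alpha^2-\frac14}\,G^2\big(\frac12\big)}{2^{n^2+(2\alpha-1)(n+\alpha)}\,G^2(\alpha+1)}\exp\bigg[-\frac{nt}{2}+\frac{t(t+8\alpha)}{16}+\frac{(1-4\alpha^2)(t-2\alpha)}{8n}\\&+\frac{(1-4\alpha^2)(6t^2-24\alpha t+28\alpha^2-3)}{192n^2}+\frac{(1-4\alpha^2)\big(t^3-6\alpha t^2+3(1+4\alpha^2)t+3\alpha(1-4\alpha^2)\big)}{96n^3}+O\left(\frac1{n^4}\right)\bigg],\end{aligned}$$ where $G(\cdot)$ is the Barnes $G$-function.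
   Context: For $\alpha>-1$ and $t\in\mathbb{R}$ let $w(x,t)=(1-x^2)^{\alpha}e^{-tx^2}$, $x\in[-1,1]$, let $\mu_j(t)=\int_{-1}^1x^jw(x,t)\,dx$ be its moments and $D_n(t)=\det(\mu_{j+k}(t))_{j,k=0}^{n-1}$ the associated Hankel determinant. The Barnes $G$-function satisfies $G(z+1)=\Gamma(z)G(z)$, $G(1)=1$; $G^2(x)$ means $(G(x))^2$. *)

theory Defs
  imports "HOL-Analysis.Analysis" "Jordan_Normal_Form.Determinant"
begin

definition weight :: "real \<Rightarrow> real \<Rightarrow> real \<Rightarrow> real" where
  "weight \<alpha> t x = (1 - x\<^sup>2) powr \<alpha> * exp (- t * x\<^sup>2)"

definition moment :: "real \<Rightarrow> real \<Rightarrow> nat \<Rightarrow> real" where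
  "moment \<alpha> t j = (LBINT x:{-1..1}. x ^ j * weight \<alpha> t x)"

definition hankel_det :: "real \<Rightarrow> nat \<Rightarrow> real \<Rightarrow> real" where
  "hankel_det \<alpha> n t =
     Determinant.det (Matrix.mat n n (\<lambda>(j, k). moment \<alpha> t (j + k)))"

text \<open>
  The functional equation \<open>G (z + 1) = \<Gamma> z * G z\<close> with \<open>G 1 = 1\<close> does not determine the Barnes
  function \<open>G\<close> by itself. We use its Weierstrass product, with \<open>\<gamma>\<close> the Euler-Mascheroni constant:
  \<open>G (1 + w) = (2 \<pi>) ^ (w / 2) * exp (- (w + w\<^sup>2 (1 + \<gamma>)) / 2)
     * (\<Prod>k\<ge>1. (1 + w / k) ^ k * exp (w\<^sup>2 / (2 k) - w))\<close>.
  The index of the product is shifted by one below.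
\<close>

definition barnes_G :: "'a \<Rightarrow> 'a :: {banach, real_normed_field}" where
  "barnes_G z = (let w = z - 1 in
     exp (w / 2 * of_real (ln (2 * pi)) - (w + w\<^sup>2 * (1 + euler_mascheroni)) / 2) *
     (\<Prod>k. (1 + w / of_nat (Suc k)) ^ Suc k * exp (w\<^sup>2 / (2 * of_nat (Suc k)) - w)))"

end

theory Submission
  imports Defs "HOL-Real_Asymp.Real_Asymp"
begin

text \<open>
  The Hankel determinant is the product of the squared norms of the monic orthogonal polynomials, so
  everything is expressed by their recurrence coefficients \<open>\<beta>\<^sub>n\<close>. Integration by parts gives an identity
  that expresses \<open>\<beta>\<^sub>1 + \<dots> + \<beta>\<^bsub>n-1\<^esub>\<close>, hence \<open>d/dt ln D\<^sub>n\<close>, by \<open>\<beta>\<^bsub>n-1\<^esub>, \<beta>\<^sub>n, \<beta>\<^bsub>n+1\<^esub>\<close>, and whose first difference is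
  a nonlinear difference equation for \<open>\<beta>\<^sub>n\<close>. Starting from \<open>0 \<le> \<beta>\<^sub>n \<le> 1\<close>, this equation bootstraps itself to
  asymptotics that are uniform for \<open>t\<close> in a compact set; the only undetermined constant, the coefficient
  of \<open>1/n\<^sup>2\<close>, is independent of \<open>t\<close> by the Toda equation \<open>\<beta>\<^sub>n' = \<beta>\<^sub>n (\<beta>\<^bsub>n-1\<^esub> - \<beta>\<^bsub>n+1\<^esub>)\<close>. Integrating
  \<open>d/dt ln D\<^sub>n\<close> from \<open>0\<close> to \<open>t\<close> yields the first claim. At \<open>t = 0\<close> the coefficients are rational in \<open>n\<close>: the
  second difference of the error of \<open>ln D\<^sub>n(0)\<close> is \<open>O(1/n\<^sup>6)\<close>, and the two constants of summation are limits
  of elementary products, evaluated by those of \<open>\<Gamma>\<close> and \<open>G\<close>.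
\<close>

section \<open>Orthogonal polynomials of an even moment functional\<close>

text \<open>The linear part of the difference equation has the homogeneous solution 1 / ((2n +
  2\<alpha>)^2 - 1), so bootstrapping alone stalls at order 1/n^2. The Toda equation gets past this
  because the increments of the coefficients are of smaller order, O(n^(-5/2)); hence so is the
  t-derivative, and integration from the explicit case t = 0 fixes the constant. This integration
  and that of d/dt ln D_n are why all bounds are uniform on an interval [-T, T]. The formal solution
  is taken up to 1/n^4 since d/dt ln D_n multiplies it by 2n + 2\<alpha>. At t = 0 the logarithm of
  the n-th coefficient contains ln (n + 2\<alpha>). Summed directly this would lead to \<Gamma>(1 +
  2\<alpha>) and G(1 + 2\<alpha>), with logarithms of nonpositive numbers for \<alpha> \<le> -1/2,
  and would call for a duplication formula of G. Extracting a factor 2 at even indices gives ln 2 +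
  ln (i + \<alpha>) instead, so that G(1 + \<alpha>) and G(1/2) appear at once. The price is that
  limits are computed along even n only and that sums over M < j \<le> 2M remain, each tending to a
  multiple of ln 2.\<close>

definition functional :: "(nat \<Rightarrow> real) \<Rightarrow> real poly \<Rightarrow> real" where
  "functional \<mu> p = (\<Sum>i\<le>degree p. coeff p i * \<mu> i)"

lemma functional_eq_sum:
  assumes "degree p \<le> n"
  shows "functional \<mu> p = (\<Sum>i\<le>n. coeff p i * \<mu> i)"
  unfolding functional_def using assms
  by (intro sum.mono_neutral_left) (auto simp: coeff_eq_0)

lemma functional_add: "functional \<mu> (p + q) = functional \<mu> p + functional \<mu> q"
proof -
  let ?n = "max (degree p) (degree q)"
  have "degree (p + q) \<le> ?n" by (rule degree_add_le_max)
  then show ?thesis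
    by (simp add: functional_eq_sum[of _ ?n] sum.distrib algebra_simps)
qed

lemma functional_smult: "functional \<mu> (Polynomial.smult c p) = c * functional \<mu> p"
proof -
  have "degree (Polynomial.smult c p) \<le> degree p" by (rule degree_smult_le)
  then show ?thesis
    by (simp add: functional_eq_sum[of _ "degree p"] sum_distrib_left algebra_simps)
qed

lemma functional_0 [simp]: "functional \<mu> 0 = 0"
  by (simp add: functional_def)

lemma functional_minus: "functional \<mu> (- p) = - functional \<mu> p"
  using functional_smult[of \<mu> "-1" p] by simp

lemma functional_diff: "functional \<mu> (p - q) = functional \<mu> p - functional \<mu> q"
  using functional_add[of \<mu> p "- q"] by (simp add: functional_minus)

lemmas functional_linear = functional_add functional_diff functional_smult functional_minus

lemma functional_sum: "functional \<mu> (\<Sum>i\<in>A. f i) = (\<Sum>i\<in>A. functional \<mu> (f i))"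
  by (induction A rule: infinite_finite_induct) (simp_all add: functional_add)

lemma functional_monom: "functional \<mu> (monom c n) = c * \<mu> n"
proof -
  have "functional \<mu> (monom c n) = (\<Sum>i\<le>n. coeff (monom c n) i * \<mu> i)"
    by (intro functional_eq_sum degree_monom_le)
  also have "\<dots> = (\<Sum>i\<le>n. if i = n then c * \<mu> n else 0)"
    by (intro sum.cong) auto
  finally show ?thesis by simp
qed

text \<open>For an even functional the three-term recurrence has no constant term next to x, so one
  quotient of norms per step is enough. Orthogonality is derived from this recurrence
  afterwards.\<close>

fun monic_op :: "(nat \<Rightarrow> real) \<Rightarrow> nat \<Rightarrow> real poly" where
  "monic_op \<mu> 0 = 1"
| "monic_op \<mu> (Suc 0) = [:0, 1:]"
| "monic_op \<mu> (Suc (Suc n)) = [:0, 1:] * monic_op \<mu> (Suc n)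
     - Polynomial.smult (functional \<mu> ((monic_op \<mu> (Suc n))\<^sup>2) / functional \<mu> ((monic_op \<mu> n)\<^sup>2)) (monic_op \<mu> n)"

definition op_norm :: "(nat \<Rightarrow> real) \<Rightarrow> nat \<Rightarrow> real" where
  "op_norm \<mu> n = functional \<mu> ((monic_op \<mu> n)\<^sup>2)"

text \<open>The value 0 at index 0 makes \<open>X_mult_monic_op\<close> valid for n = 0, where n - 1
  truncates to 0.\<close>

definition rec_coeff :: "(nat \<Rightarrow> real) \<Rightarrow> nat \<Rightarrow> real" where
  "rec_coeff \<mu> n = (if n = 0 then 0 else op_norm \<mu> n / op_norm \<mu> (n - 1))"

lemma rec_coeff_0 [simp]: "rec_coeff \<mu> 0 = 0"
  by (simp add: rec_coeff_def)

lemma monic_op_Suc_Suc: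
  "monic_op \<mu> (Suc (Suc n)) = [:0, 1:] * monic_op \<mu> (Suc n) - Polynomial.smult (rec_coeff \<mu> (Suc n)) (monic_op \<mu> n)"
  by (simp add: rec_coeff_def op_norm_def)

lemma X_mult_monic_op:
  "[:0, 1:] * monic_op \<mu> n = monic_op \<mu> (Suc n) + Polynomial.smult (rec_coeff \<mu> n) (monic_op \<mu> (n - 1))"
  by (cases n) (auto simp: monic_op_Suc_Suc simp del: monic_op.simps(3))

lemma degree_lead_monic_op: "degree (monic_op \<mu> n) = n \<and> coeff (monic_op \<mu> n) n = 1"
proof (induction \<mu> n rule: monic_op.induct)
  case (3 \<mu> n)
  let ?P = "monic_op \<mu> (Suc n)" and ?Q = "Polynomial.smult (rec_coeff \<mu> (Suc n)) (monic_op \<mu> n)"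
  have "degree ?Q \<le> n" using degree_smult_le[of _ "monic_op \<mu> n"] 3 by simp
  moreover have "?P \<noteq> 0" using 3 by auto
  then have "degree ([:0, 1:] * ?P) = Suc (Suc n)"
    using 3 by (subst degree_mult_eq) auto
  ultimately have d: "degree (monic_op \<mu> (Suc (Suc n))) = Suc (Suc n)"
    unfolding monic_op_Suc_Suc using degree_add_eq_left[of "- ?Q" "[:0, 1:] * ?P"] by simp
  have "coeff (monic_op \<mu> n) (Suc (Suc n)) = 0" using 3 by (intro coeff_eq_0) simp
  then have "coeff (monic_op \<mu> (Suc (Suc n))) (Suc (Suc n)) = 1"
    unfolding monic_op_Suc_Suc using 3 by simp
  with d show ?case by blast
qed auto

lemma degree_monic_op [simp]: "degree (monic_op \<mu> n) = n"
  and lead_monic_op [simp]: "coeff (monic_op \<mu> n) n = 1"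
  using degree_lead_monic_op by auto

lemma monic_op_nonzero [simp]: "monic_op \<mu> n \<noteq> 0"
  using lead_monic_op[of \<mu> n] by (metis coeff_0 zero_neq_one)

lemma coeff_monic_op_parity: "odd (i + n) \<Longrightarrow> coeff (monic_op \<mu> n) i = 0"
proof (induction \<mu> n arbitrary: i rule: monic_op.induct)
  case (1 \<mu>)
  then show ?case by (cases i) auto
next
  case (2 \<mu>)
  then show ?case by (cases i; cases "i - 1") (auto simp: coeff_pCons split: nat.splits)
next
  case (3 \<mu> n)
  then show ?case
    by (cases i) (auto simp: monic_op_Suc_Suc simp del: monic_op.simps(3))
qed

text \<open>Each step of the recurrence subtracts one more coefficient. This is how partial sums of
  recurrence coefficients enter the string equation.\<close>

lemma coeff_monic_op_subleading:
  "coeff (monic_op \<mu> (n + 2)) n = - (\<Sum>j=1..Suc n. rec_coeff \<mu> j)"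
proof (induction n)
  case 0
  have "coeff (monic_op \<mu> 2) 0 = - rec_coeff \<mu> 1"
    unfolding numeral_2_eq_2 monic_op_Suc_Suc by simp
  then show ?case by (simp del: monic_op.simps add: numeral_2_eq_2)
next
  case (Suc n)
  have "coeff (monic_op \<mu> (Suc n + 2)) (Suc n) = coeff (monic_op \<mu> (n + 2)) n - rec_coeff \<mu> (n + 2)"
    using monic_op_Suc_Suc[of \<mu> "Suc n"] by simp
  then show ?case using Suc by simp
qed

text \<open>What the algebra needs of the weight: evenness, positivity and, encoded by
  \<open>functional_pos'\<close>, support in [-1, 1].\<close>

locale even_moment_functional =
  fixes \<mu> :: "nat \<Rightarrow> real"
  assumes moments_odd: "odd j \<Longrightarrow> \<mu> j = 0"
    and functional_pos: "p \<noteq> 0 \<Longrightarrow> functional \<mu> (p\<^sup>2) > 0"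
    and functional_pos': "functional \<mu> ([:1, 0, -1:] * p\<^sup>2) \<ge> 0"
begin

abbreviation "L \<equiv> functional \<mu>"
abbreviation "P \<equiv> monic_op \<mu>"
abbreviation "h \<equiv> op_norm \<mu>"
abbreviation "\<beta> \<equiv> rec_coeff \<mu>"

lemma h_pos: "h n > 0"
  unfolding op_norm_def by (rule functional_pos) simp

lemma rec_coeff_pos: "n > 0 \<Longrightarrow> \<beta> n > 0"
  by (simp add: rec_coeff_def h_pos)

lemma rec_coeff_nonneg: "\<beta> n \<ge> 0"
  using rec_coeff_pos[of n] by (cases "n = 0") auto

lemma h_Suc: "h (Suc n) = \<beta> (Suc n) * h n"
  using h_pos[of n] by (simp add: rec_coeff_def)

lemma functional_odd:
  assumes "\<And>i. even i \<Longrightarrow> coeff p i = 0"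
  shows "L p = 0"
  unfolding functional_def
proof (intro sum.neutral ballI)
  fix i
  show "coeff p i * \<mu> i = 0" using assms[of i] moments_odd[of i] by (cases "even i") auto
qed

lemma functional_monic_op_parity:
  assumes "odd (m + n)"
  shows "L (P m * P n) = 0"
proof (rule functional_odd)
  fix i :: nat assume "even i"
  show "coeff (P m * P n) i = 0"
    unfolding coeff_mult
  proof (intro sum.neutral ballI)
    fix j assume "j \<in> {..i}"
    then have "odd (j + m) \<or> odd (i - j + n)" using assms \<open>even i\<close> by auto
    then show "coeff (P m) j * coeff (P n) (i - j) = 0"
      using coeff_monic_op_parity by fastforce
  qed
qed

text \<open>The recurrence is used on both factors: it expresses \<open>P n\<close> by x times
  \<open>P (n - 1)\<close> and by \<open>P (n - 2)\<close>, and x is then moved onto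
  \<open>P k\<close>. For k = n - 2 the two surviving norms cancel by the choice of
  \<open>\<beta>\<close> as a quotient of norms; k = n - 1 is settled by parity.\<close>

lemma orthogonal_aux: "\<forall>k<n. L (P k * P n) = 0"
proof (induction n rule: less_induct)
  case (less n)
  show ?case
  proof (intro allI impI)
    fix k assume k: "k < n"
    show "L (P k * P n) = 0"
    proof (cases "n = Suc k")
      case True
      then show ?thesis by (intro functional_monic_op_parity) auto
    next
      case False
      define m where "m = n - 2"
      have n: "n = Suc (Suc m)" and km: "k \<le> m"
        using k False by (auto simp: m_def)
      have "P k * P n = ([:0, 1:] * P k) * P (Suc m) - Polynomial.smult (\<beta> (Suc m)) (P k * P m)"
        unfolding n monic_op_Suc_Suc by (simp add: algebra_simps)
      also have "([:0, 1:] * P k) = P (Suc k) + Polynomial.smult (\<beta> k) (P (k - 1))"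
        by (rule X_mult_monic_op)
      finally have eq: "P k * P n = (P (Suc k) + Polynomial.smult (\<beta> k) (P (k - 1))) * P (Suc m)
          - Polynomial.smult (\<beta> (Suc m)) (P k * P m)" .
      have *: "L (P k * P n) = L (P (Suc k) * P (Suc m)) + \<beta> k * L (P (k - 1) * P (Suc m))
          - \<beta> (Suc m) * L (P k * P m)"
        unfolding eq by (simp add: functional_linear algebra_simps)
      have "L (P (k - 1) * P (Suc m)) = 0" using less.IH[of "Suc m"] n km by simp
      moreover have "L (P (Suc k) * P (Suc m)) = \<beta> (Suc m) * L (P k * P m)"
      proof (cases "k = m")
        case True
        then show ?thesis using h_Suc[of m] by (simp add: op_norm_def power2_eq_square)
      next
        case False
        then show ?thesis using less.IH[of "Suc m"] less.IH[of m] n km by simp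
      qed
      ultimately show ?thesis using * by simp
    qed
  qed
qed

lemma orthogonal: "m \<noteq> n \<Longrightarrow> L (P m * P n) = 0"
  using orthogonal_aux[of m] orthogonal_aux[of n]
  by (metis linorder_neqE_nat mult.commute)

text \<open>Subtracting multiples of the \<open>P d\<close> lowers the degree of q step by step, and
  only the component along \<open>P n\<close> survives orthogonality.\<close>

lemma functional_monic_op_mult:
  assumes "degree q \<le> n"
  shows "L (P n * q) = coeff q n * h n"
  using assms
proof (induction "degree q" arbitrary: q n rule: less_induct)
  case less
  show ?case
  proof (cases "q = 0")
    case False
    define d where "d = degree q"
    define r where "r = q - Polynomial.smult (coeff q d) (P d)"
    have cr: "coeff r i = coeff q i - coeff q d * coeff (P d) i" for i
      by (simp add: r_def)
    have rd: "r = 0 \<or> degree r < d"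
    proof (rule ccontr)
      assume c: "\<not> (r = 0 \<or> degree r < d)"
      have "degree r \<le> d" unfolding r_def d_def
        by (intro degree_diff_le order.trans[OF degree_smult_le]) auto
      then have "degree r = d" using c by auto
      then have "coeff r d \<noteq> 0" using c by auto
      then show False by (simp add: cr)
    qed
    have "L (P n * r) = coeff r n * h n"
    proof (cases "r = 0")
      case False
      then show ?thesis using less(1)[of r n] less(2) rd by (simp add: d_def)
    qed simp
    moreover have "coeff r n = coeff q n - coeff q d * (if n = d then 1 else 0)"
      using less(2) by (auto simp: cr d_def coeff_eq_0)
    moreover have "q = r + Polynomial.smult (coeff q d) (P d)" by (simp add: r_def)
    then have "L (P n * q) = L (P n * r) + coeff q d * L (P n * P d)"
      by (metis functional_add functional_smult distrib_left mult_smult_right)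
    moreover have "L (P n * P d) = (if n = d then h n else 0)"
      using orthogonal by (auto simp: op_norm_def power2_eq_square)
    ultimately show ?thesis by (auto simp: algebra_simps)
  qed simp
qed

lemma h_eq: "L (P n * P n) = h n"
  by (simp add: op_norm_def power2_eq_square)

lemma functional_X2_monic_op: "L ([:0, 0, 1:] * (P n)\<^sup>2) = (\<beta> n + \<beta> (Suc n)) * h n"
proof -
  have "[:0, 0, 1:] * (P n)\<^sup>2 = ([:0, 1:] * P n) * ([:0, 1:] * P n)"
    by (simp add: power2_eq_square)
  also have "L \<dots> = h (Suc n) + \<beta> n * \<beta> n * (if n = 0 then 0 else h (n - 1))"
  proof (cases n)
    case 0
    then show ?thesis by (simp add: op_norm_def power2_eq_square)
  next
    case (Suc m)
    then show ?thesis unfolding X_mult_monic_op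
      by (simp add: functional_linear ring_distribs orthogonal h_eq del: monic_op.simps)
  qed
  also have "\<dots> = (\<beta> n + \<beta> (Suc n)) * h n"
    by (cases n) (simp_all add: h_Suc algebra_simps)
  finally show ?thesis .
qed

text \<open>Support in [-1, 1] gives L(x^2 P_m^2) \<le> h_m, so even the sum of two consecutive
  coefficients is at most 1. This crude bound starts the bootstrap.\<close>

lemma rec_coeff_le_1: "\<beta> n \<le> 1"
proof (cases n)
  case (Suc m)
  have "L ([:1, 0, -1:] * (P m)\<^sup>2) = L ((P m)\<^sup>2 - [:0, 0, 1:] * (P m)\<^sup>2)"
    by (rule arg_cong[where f = L]) simp
  also have "\<dots> = h m - (\<beta> m + \<beta> n) * h m"
    using functional_X2_monic_op[of m] Suc by (simp only: functional_diff op_norm_def)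
  finally have "0 \<le> (1 - (\<beta> m + \<beta> n)) * h m"
    using functional_pos'[of "P m"] by (simp add: algebra_simps)
  then have "\<beta> m + \<beta> n \<le> 1" using h_pos[of m] by (simp add: zero_le_mult_iff)
  then show ?thesis using rec_coeff_nonneg[of m] by simp
qed simp

text \<open>With A the unit lower triangular matrix of the coefficients of the \<open>P j\<close>,
  the product A H A^T is their Gram matrix, which is diagonal.\<close>

lemma hankel_det_eq_prod_norms:
  "Determinant.det (Matrix.mat n n (\<lambda>(j, k). \<mu> (j + k))) = (\<Prod>k<n. h k)"
proof -
  define H where "H = Matrix.mat n n (\<lambda>(j, k). \<mu> (j + k))"
  define A where "A = Matrix.mat n n (\<lambda>(j, k). coeff (P j) k)"
  have carr: "H \<in> carrier_mat n n" "A \<in> carrier_mat n n" by (auto simp: H_def A_def)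
  define B where "B = A * H * transpose_mat A"
  have entry: "B $$ (j, k) = L (P j * P k)" if "j < n" "k < n" for j k
  proof -
    have ext: "(\<Sum>i = 0..<n. coeff (P m) i * f i) = (\<Sum>i\<le>m. coeff (P m) i * f i)" if "m < n"
      for m and f :: "nat \<Rightarrow> real"
      using that by (intro sum.mono_neutral_right) (auto simp: coeff_eq_0)
    have "B $$ (j, k) = (\<Sum>i = 0..<n. (\<Sum>l = 0..<n. coeff (P j) l * \<mu> (l + i)) * coeff (P k) i)"
      using that unfolding B_def H_def A_def
      by (simp add: times_mat_def scalar_prod_def)
    also have "\<dots> = (\<Sum>i = 0..<n. coeff (P k) i * (\<Sum>l = 0..<n. coeff (P j) l * \<mu> (l + i)))"
      by (intro sum.cong refl mult.commute)
    also have "\<dots> = (\<Sum>i = 0..<n. coeff (P k) i * (\<Sum>l\<le>j. coeff (P j) l * \<mu> (l + i)))"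
      by (simp only: ext[OF that(1)])
    also have "\<dots> = (\<Sum>i\<le>k. coeff (P k) i * (\<Sum>l\<le>j. coeff (P j) l * \<mu> (l + i)))"
      using that by (subst ext) auto
    also have "\<dots> = L ((\<Sum>l\<le>j. monom (coeff (P j) l) l) * (\<Sum>i\<le>k. monom (coeff (P k) i) i))"
      by (simp add: sum_product functional_sum mult_monom functional_monom sum_distrib_left
          sum.swap[of _ "{..j}"] algebra_simps)
    also have "\<dots> = L (P j * P k)"
      using poly_as_sum_of_monoms[of "P j"] poly_as_sum_of_monoms[of "P k"] by simp
    finally show ?thesis .
  qed
  have "Determinant.det A = prod_list (diag_mat A)"
    using carr by (intro det_lower_triangular[where n = n]) (auto simp: A_def coeff_eq_0)
  also have "\<dots> = (\<Prod>k<n. 1)"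
    unfolding prod_list_diag_prod by (auto simp: A_def intro!: prod.cong)
  finally have "Determinant.det A = 1" by simp
  then have "Determinant.det B = Determinant.det H"
    unfolding B_def using carr by (simp add: det_mult det_transpose)
  moreover have "Determinant.det B = prod_list (diag_mat B)"
    using carr by (intro det_lower_triangular[where n = n]) (auto simp: entry B_def[symmetric] orthogonal, auto simp: B_def)
  moreover have "\<dots> = (\<Prod>k<n. h k)"
    unfolding prod_list_diag_prod using carr
    by (auto simp: entry h_eq B_def[symmetric] intro!: prod.cong) (auto simp: B_def)
  ultimately show ?thesis by (simp add: H_def)
qed

end

section \<open>The moments\<close>

lemma weight_nonneg [simp]: "weight \<alpha> t x \<ge> 0"
  by (simp add: weight_def)

lemma weight_borel [measurable]: "weight \<alpha> t \<in> borel_measurable borel"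
  unfolding weight_def[abs_def] by measurable

text \<open>The substitution u = (1 + x) / 2 turns the weight at t = 0 into the integrand of the
  Beta function, integrable since \<alpha> + 1 > 0.\<close>

lemma
  assumes "\<alpha> > -1"
  shows set_integrable_weight_0: "set_integrable lborel {-1..1} (weight \<alpha> 0)"
    and moment_0_0: "moment \<alpha> 0 0 = 2 powr (2 * \<alpha> + 1) * Beta (\<alpha> + 1) (\<alpha> + 1)"
proof -
  let ?f = "\<lambda>u::real. indicator {0..1} u * (u powr \<alpha> * (1 - u) powr \<alpha>)"
  have eq: "?f (1/2 + 1/2 * x) = indicator {-1..1} x * weight \<alpha> 0 x / 4 powr \<alpha>" for x
  proof (cases "x \<in> {-1..1}")
    case True
    then have "?f (1/2 + 1/2 * x) = ((1/2 + 1/2 * x) * (1/2 - 1/2 * x)) powr \<alpha>"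
      by (subst powr_mult) auto
    also have "(1/2 + 1/2 * x) * (1/2 - 1/2 * x) = (1 - x\<^sup>2) / 4"
      by (simp add: power2_eq_square algebra_simps)
    finally show ?thesis using True
      by (simp add: weight_def powr_divide power_le_one abs_square_le_1 abs_le_iff)
  qed (auto simp: indicator_def)
  have int: "set_integrable lborel {0..1} (\<lambda>u. u powr \<alpha> * (1 - u) powr \<alpha>)"
    using integrable_Beta[of "\<alpha> + 1" "\<alpha> + 1"] assms by simp
  then have i1: "integrable lborel ?f" by (simp add: set_integrable_def)
  from lborel_integrable_real_affine[OF i1, of "1/2" "1/2"]
  have "integrable lborel (\<lambda>x. indicator {-1..1} x * weight \<alpha> 0 x / 4 powr \<alpha>)"
    by (simp only: eq)
  then have "integrable lborel (\<lambda>x. 4 powr \<alpha> * (indicator {-1..1} x * weight \<alpha> 0 x / 4 powr \<alpha>))"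
    by (rule integrable_mult_right)
  then show si: "set_integrable lborel {-1..1} (weight \<alpha> 0)"
    by (simp add: set_integrable_def)
  have "Beta (\<alpha> + 1) (\<alpha> + 1) = integral {0..1} (\<lambda>u. u powr \<alpha> * (1 - u) powr \<alpha>)"
    using has_integral_Beta_real[of "\<alpha> + 1" "\<alpha> + 1"] assms by (simp add: integral_unique)
  also have "\<dots> = (LBINT u. ?f u)"
    using set_borel_integral_eq_integral(2)[OF int] by (simp add: set_lebesgue_integral_def)
  also have "\<dots> = (1/2) * (LBINT x. indicator {-1..1} x * weight \<alpha> 0 x / 4 powr \<alpha>)"
    using lborel_integral_real_affine[of "1/2" ?f "1/2"] by (simp only: eq) simp
  also have "\<dots> = moment \<alpha> 0 0 / (2 * 4 powr \<alpha>)"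
    by (simp add: moment_def set_lebesgue_integral_def)
  also have "2 * 4 powr \<alpha> = (2::real) powr (2 * \<alpha> + 1)"
    using powr_powr[of 2 2 \<alpha>] by (simp add: powr_add)
  finally show "moment \<alpha> 0 0 = 2 powr (2 * \<alpha> + 1) * Beta (\<alpha> + 1) (\<alpha> + 1)" by simp
qed

text \<open>For \<alpha> < 0 the weight is unbounded near the end points, so the dominating function
  is a constant times the weight at t = 0.\<close>

lemma set_integrable_mult_weight:
  fixes g :: "real \<Rightarrow> real"
  assumes "\<alpha> > -1" and g: "continuous_on UNIV g"
  shows "set_integrable lborel {-1..1} (\<lambda>x. g x * weight \<alpha> t x)"
proof -
  have [measurable]: "g \<in> borel_measurable borel"
    using g by (rule borel_measurable_continuous_onI)
  let ?k = "\<lambda>x. g x * exp (- t * x\<^sup>2)"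
  have "continuous_on {-1..1} ?k"
    by (intro continuous_intros continuous_on_subset[OF g]) auto
  then have "compact (?k ` {-1..1})" by (intro compact_continuous_image) auto
  then have "bounded (?k ` {-1..1})" by (rule compact_imp_bounded)
  then obtain C where C: "\<forall>x\<in>{-1..1}. \<bar>?k x\<bar> \<le> C"
    unfolding bounded_iff by auto
  show ?thesis
  proof (rule set_integrable_bound)
    show "set_integrable lborel {-1..1} (\<lambda>x. C * weight \<alpha> 0 x)"
      using set_integrable_weight_0[OF assms(1)] by simp
    show "set_borel_measurable lborel {-1..1} (\<lambda>x. g x * weight \<alpha> t x)"
      unfolding set_borel_measurable_def by measurable
    show "AE x in lborel. x \<in> {-1..1} \<longrightarrow> norm (g x * weight \<alpha> t x) \<le> norm (C * weight \<alpha> 0 x)"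
    proof (intro AE_I2 impI)
      fix x :: real assume x: "x \<in> {-1..1}"
      have "norm (g x * weight \<alpha> t x) = \<bar>?k x\<bar> * weight \<alpha> 0 x"
        by (simp add: weight_def abs_mult)
      also have "\<dots> \<le> C * weight \<alpha> 0 x"
        using C x by (intro mult_right_mono) auto
      finally show "norm (g x * weight \<alpha> t x) \<le> norm (C * weight \<alpha> 0 x)"
        by simp
    qed
  qed
qed

lemma set_integrable_poly_weight:
  "\<alpha> > -1 \<Longrightarrow> set_integrable lborel {-1..1} (\<lambda>x. poly p x * weight \<alpha> t x)"
  by (rule set_integrable_mult_weight) (simp_all add: continuous_on_poly continuous_on_id)

lemma functional_moment:
  assumes "\<alpha> > -1"
  shows "functional (moment \<alpha> t) p = (LBINT x:{-1..1}. poly p x * weight \<alpha> t x)"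
proof -
  have "set_integrable lborel {-1..1} (\<lambda>x. coeff p i * (x ^ i * weight \<alpha> t x))" for i
    by (rule set_integrable_mult_right)
      (use set_integrable_mult_weight[OF assms, of "\<lambda>x. x ^ i" t] in \<open>simp add: continuous_on_power\<close>)
  note int = this[unfolded set_integrable_def]
  have "(LBINT x:{-1..1}. poly p x * weight \<alpha> t x)
      = (LBINT x:{-1..1}. (\<Sum>i\<le>degree p. coeff p i * (x ^ i * weight \<alpha> t x)))"
    by (simp add: poly_altdef sum_distrib_right mult.assoc)
  also have "\<dots> = (\<Sum>i\<le>degree p. (LBINT x:{-1..1}. coeff p i * (x ^ i * weight \<alpha> t x)))"
    unfolding set_lebesgue_integral_def scaleR_sum_right
    by (rule Bochner_Integration.integral_sum) (rule int)
  also have "\<dots> = functional (moment \<alpha> t) p"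
    by (simp add: functional_def moment_def)
  finally show ?thesis by (rule sym)
qed

lemma functional_moment_nonneg:
  assumes "\<alpha> > -1" and "\<And>x. x \<in> {-1..1} \<Longrightarrow> poly p x \<ge> 0"
  shows "functional (moment \<alpha> t) p \<ge> 0"
  unfolding functional_moment[OF assms(1)] set_lebesgue_integral_def
  using assms(2) by (intro Bochner_Integration.integral_nonneg) (auto simp: indicator_def)

lemma functional_moment_pos:
  assumes "\<alpha> > -1" "p \<noteq> 0"
  shows "functional (moment \<alpha> t) (p\<^sup>2) > 0"
proof (rule ccontr)
  let ?F = "\<lambda>x. indicator {-1..1} x *\<^sub>R (poly (p\<^sup>2) x * weight \<alpha> t x)"
  assume "\<not> ?thesis"
  then have "functional (moment \<alpha> t) (p\<^sup>2) = 0"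
    using functional_moment_nonneg[OF assms(1), of "p\<^sup>2" t] by force
  then have "integral\<^sup>L lborel ?F = 0"
    by (simp add: functional_moment[OF assms(1)] set_lebesgue_integral_def)
  moreover have "integrable lborel ?F"
    using set_integrable_poly_weight[OF assms(1), of "p\<^sup>2"] by (simp add: set_integrable_def)
  ultimately have ae: "AE x in lborel. ?F x = 0"
    by (subst (asm) integral_nonneg_eq_0_iff_AE) auto
  have fin: "finite ({x. poly p x = 0} \<union> {-1, 1})"
    using poly_roots_finite[OF assms(2)] by simp
  have "AE x in lborel. x \<notin> {x. poly p x = 0} \<union> {-1, 1}"
    by (intro AE_not_in finite_imp_null_set_lborel fin)
  with ae have "AE x in lborel. x \<notin> {-1..1::real}"
  proof eventually_elim
    case (elim x)
    show ?case
    proof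
      assume x: "x \<in> {-1..1}"
      then have "weight \<alpha> t x = 0" using elim by auto
      then have "1 - x\<^sup>2 = 0" by (simp add: weight_def)
      then have "x = 1 \<or> x = -1" using power2_eq_1_iff[of x] by simp
      then show False using elim by auto
    qed
  qed
  then have "{-1..1::real} \<in> null_sets lborel" by (subst AE_iff_null_sets) auto
  then show False by (auto simp: null_sets_def)
qed

lemma moment_odd:
  assumes "odd j"
  shows "moment \<alpha> t j = 0"
proof -
  let ?F = "\<lambda>x. indicator {-1..1} x *\<^sub>R (x ^ j * weight \<alpha> t x)"
  have "?F (0 + (-1) * x) = - ?F x" for x
    using assms by (auto simp: indicator_def weight_def)
  then have "(LBINT x. ?F x) = - (LBINT x. ?F x)"
    using lborel_integral_real_affine[of "-1" ?F 0] by simp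
  then show ?thesis by (simp add: moment_def set_lebesgue_integral_def)
qed

lemma even_moment_functional_moment:
  assumes "\<alpha> > -1"
  shows "even_moment_functional (moment \<alpha> t)"
proof
  show "functional (moment \<alpha> t) ([:1, 0, -1:] * p\<^sup>2) \<ge> 0" for p
  proof (rule functional_moment_nonneg[OF assms])
    fix x :: real assume "x \<in> {-1..1}"
    then have "x * x \<le> 1" by (simp add: abs_square_le_1 abs_le_iff flip: power2_eq_square)
    then have "0 \<le> (1 - x * x) * (poly p x)\<^sup>2" by simp
    then show "0 \<le> poly ([:1, 0, -1:] * p\<^sup>2) x" by (simp add: algebra_simps)
  qed
qed (use assms moment_odd functional_moment_pos in auto)

text \<open>Integrates the derivative of (1 - x^2)^(\<alpha> + 1) exp (-t x^2) q(x) over [-1, 1].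
  The boundary terms vanish because the extra factor 1 - x^2 makes the exponent positive.\<close>

lemma Pearson_functional:
  assumes "\<alpha> > -1"
  shows "functional (moment \<alpha> t) ([:1, 0, -1:] * pderiv q)
    = functional (moment \<alpha> t) ([:0, 2 + 2 * \<alpha> + 2 * t, 0, - 2 * t:] * q)"
proof -
  let ?F = "\<lambda>x. (1 - x\<^sup>2) powr (\<alpha> + 1) * (exp (- t * x\<^sup>2) * poly q x)"
  let ?r = "[:1, 0, -1:] * pderiv q - [:0, 2 + 2 * \<alpha> + 2 * t, 0, - 2 * t:] * q"
  have "((\<lambda>x. poly ?r x * weight \<alpha> t x) has_integral (?F 1 - ?F (-1))) {-1..1}"
  proof (rule fundamental_theorem_of_calculus_interior)
    show "continuous_on {-1..1} ?F"
      using assms by (intro continuous_intros continuous_on_powr')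
        (auto simp: abs_square_le_1 abs_le_iff power2_eq_1_iff)
    fix x :: real assume x: "x \<in> {-1<..<1}"
    then have pos: "1 - x\<^sup>2 > 0" by (simp add: abs_square_less_1 abs_less_iff)
    have "((\<lambda>x. (1 - x\<^sup>2) powr (\<alpha> + 1)) has_real_derivative
        (\<alpha> + 1) * (1 - x\<^sup>2) powr (\<alpha> + 1 - 1) * (- 2 * x)) (at x)"
      by (rule DERIV_chain2[where f = "\<lambda>z. z powr (\<alpha> + 1)" and g = "\<lambda>x. 1 - x\<^sup>2"],
          rule has_real_derivative_powr[OF pos]) (auto intro!: derivative_eq_intros)
    then have "(?F has_real_derivative
        (\<alpha> + 1) * (1 - x\<^sup>2) powr \<alpha> * (- 2 * x) * (exp (- t * x\<^sup>2) * poly q x)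
        + (exp (- t * x\<^sup>2) * (- t * (2 * x)) * poly q x + poly (pderiv q) x * exp (- t * x\<^sup>2))
          * (1 - x\<^sup>2) powr (\<alpha> + 1)) (at x)"
      by (rule DERIV_mult[THEN DERIV_cong]) (auto intro!: derivative_eq_intros poly_DERIV)
    also have "(1 - x\<^sup>2) powr (\<alpha> + 1) = (1 - x\<^sup>2) powr \<alpha> * (1 - x\<^sup>2)"
      using pos by (simp add: powr_add)
    finally have "(?F has_real_derivative poly ?r x * weight \<alpha> t x) (at x)"
      by (rule DERIV_cong) (simp add: weight_def power2_eq_square algebra_simps)
    then show "(?F has_vector_derivative poly ?r x * weight \<alpha> t x) (at x)"
      by (simp add: has_real_derivative_iff_has_vector_derivative)
  qed simp
  then have "integral {-1..1} (\<lambda>x. poly ?r x * weight \<alpha> t x) = 0"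
    by (simp add: integral_unique)
  then have "functional (moment \<alpha> t) ?r = 0"
    unfolding functional_moment[OF assms]
    by (subst set_borel_integral_eq_integral(2)[OF set_integrable_poly_weight[OF assms]])
  then show ?thesis unfolding functional_diff by linarith
qed

text \<open>A direct estimate: the second-order Taylor remainder of exp (-h x^2) on [-1, 1] is at
  most a constant times h^2, so the difference quotient is off by a constant times |h|.\<close>

lemma has_real_derivative_moment:
  assumes "\<alpha> > -1"
  shows "((\<lambda>t. moment \<alpha> t j) has_real_derivative - moment \<alpha> t (j + 2)) (at t)"
proof -
  let ?I = "\<lambda>g. LBINT x:{-1..1}. g x * weight \<alpha> t x"
  have int: "set_integrable lborel {-1..1} (\<lambda>x. g x * weight \<alpha> t x)" if "continuous_on UNIV g" for g
    using assms that by (rule set_integrable_mult_weight)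
  have bound: "norm ((moment \<alpha> (t + h) j - moment \<alpha> t j) / h - (- moment \<alpha> t (j + 2)))
      \<le> exp 1 * moment \<alpha> t 0 * \<bar>h\<bar>" if h: "h \<noteq> 0" "\<bar>h\<bar> < 1" for h
  proof -
    let ?g = "\<lambda>x. x ^ j * (exp (- h * x\<^sup>2) - 1 + h * x\<^sup>2)"
    have "moment \<alpha> (t + h) j = ?I (\<lambda>x. x ^ j * exp (- h * x\<^sup>2))"
      unfolding moment_def weight_def
      by (intro set_lebesgue_integral_cong) (auto simp: exp_add[symmetric] algebra_simps)
    moreover have "?I ?g = ?I (\<lambda>x. x ^ j * exp (- h * x\<^sup>2)) - ?I (\<lambda>x. x ^ j) + h * ?I (\<lambda>x. x ^ (j + 2))"
    proof -
      have "?I ?g = (LBINT x:{-1..1}. x ^ j * exp (- h * x\<^sup>2) * weight \<alpha> t x - x ^ j * weight \<alpha> t x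
          + h * (x ^ (j + 2) * weight \<alpha> t x))"
        by (intro set_lebesgue_integral_cong) (auto simp: algebra_simps power2_eq_square)
      also have "\<dots> = ?I (\<lambda>x. x ^ j * exp (- h * x\<^sup>2)) - ?I (\<lambda>x. x ^ j) + h * ?I (\<lambda>x. x ^ (j + 2))"
        by (subst set_integral_add set_integral_diff;
            (intro set_integral_diff set_integrable_mult_right int continuous_intros)?)+ simp
      finally show ?thesis .
    qed
    ultimately have eq: "moment \<alpha> (t + h) j - moment \<alpha> t j + h * moment \<alpha> t (j + 2) = ?I ?g"
      by (simp add: moment_def)
    have gb: "\<bar>?g x\<bar> \<le> exp 1 * h\<^sup>2" if x: "x \<in> {-1..1}" for x
    proof -
      have "\<bar>x\<bar> \<le> 1" using x by auto
      then have x2: "0 \<le> x\<^sup>2" "x\<^sup>2 \<le> 1" by (simp_all add: abs_square_le_1)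
      obtain s where s: "\<bar>s\<bar> \<le> \<bar>- h * x\<^sup>2\<bar>"
        "exp (- h * x\<^sup>2) = (\<Sum>m<2. (- h * x\<^sup>2) ^ m / fact m) + exp s / fact 2 * (- h * x\<^sup>2)\<^sup>2"
        using Maclaurin_exp_le[of "- h * x\<^sup>2" 2] by blast
      have "exp (- h * x\<^sup>2) - 1 + h * x\<^sup>2 = exp s / 2 * (h\<^sup>2 * (x\<^sup>2)\<^sup>2)"
        using s(2) by (simp add: numeral_2_eq_2 power_mult_distrib)
      moreover have "\<bar>- h * x\<^sup>2\<bar> \<le> 1 * 1" unfolding abs_mult using h x2 by (intro mult_mono) auto
      then have "exp s \<le> exp 1" using s(1) by simp
      moreover have "h\<^sup>2 * (x\<^sup>2)\<^sup>2 \<le> h\<^sup>2 * 1"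
        by (intro mult_left_mono power_le_one[OF x2]) simp
      ultimately have "exp (- h * x\<^sup>2) - 1 + h * x\<^sup>2 \<le> exp 1 / 2 * (h\<^sup>2 * 1)"
          "exp (- h * x\<^sup>2) - 1 + h * x\<^sup>2 \<ge> 0"
        by (metis mult_mono divide_right_mono divide_nonneg_nonneg exp_ge_zero zero_le_numeral zero_le_mult_iff zero_le_power2)+
      then have "\<bar>exp (- h * x\<^sup>2) - 1 + h * x\<^sup>2\<bar> \<le> exp 1 / 2 * (h\<^sup>2 * 1)" by linarith
      also have "\<dots> \<le> exp 1 * h\<^sup>2" by simp
      finally have b: "\<bar>exp (- h * x\<^sup>2) - 1 + h * x\<^sup>2\<bar> \<le> exp 1 * h\<^sup>2" .
      have "\<bar>x ^ j\<bar> \<le> 1" using x unfolding power_abs by (intro power_le_one) auto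
      then have "\<bar>?g x\<bar> \<le> 1 * (exp 1 * h\<^sup>2)"
        unfolding abs_mult using b by (intro mult_mono) auto
      then show ?thesis by simp
    qed
    have "\<bar>?I ?g\<bar> \<le> (LBINT x:{-1..1}. exp 1 * h\<^sup>2 * weight \<alpha> t x)"
    proof -
      have i: "set_integrable lborel {-1..1} (\<lambda>x. ?g x * weight \<alpha> t x)"
        by (intro int continuous_intros)
      have "\<bar>?I ?g\<bar> \<le> (LBINT x:{-1..1}. \<bar>?g x * weight \<alpha> t x\<bar>)"
        using set_integral_norm_bound[OF i] by simp
      also have "\<dots> \<le> (LBINT x:{-1..1}. exp 1 * h\<^sup>2 * weight \<alpha> t x)"
      proof (rule set_integral_mono)
        show "set_integrable lborel {-1..1} (\<lambda>x. \<bar>?g x * weight \<alpha> t x\<bar>)"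
          using set_integrable_abs[OF i] .
        show "set_integrable lborel {-1..1} (\<lambda>x. exp 1 * h\<^sup>2 * weight \<alpha> t x)"
          by (intro int continuous_intros)
        fix x :: real assume x: "x \<in> {-1..1}"
        have "\<bar>?g x * weight \<alpha> t x\<bar> = \<bar>?g x\<bar> * weight \<alpha> t x"
          by (subst abs_mult) simp
        also have "\<dots> \<le> exp 1 * h\<^sup>2 * weight \<alpha> t x"
          by (rule mult_right_mono[OF gb[OF x] weight_nonneg])
        finally show "\<bar>?g x * weight \<alpha> t x\<bar> \<le> exp 1 * h\<^sup>2 * weight \<alpha> t x" .
      qed
      finally show ?thesis .
    qed
    also have "\<dots> = exp 1 * h\<^sup>2 * moment \<alpha> t 0"
      by (simp add: moment_def mult.assoc)
    finally have I: "\<bar>?I ?g\<bar> \<le> exp 1 * h\<^sup>2 * moment \<alpha> t 0" .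
    have "(moment \<alpha> (t + h) j - moment \<alpha> t j) / h - (- moment \<alpha> t (j + 2)) = ?I ?g / h"
      unfolding eq[symmetric] using h by (simp add: add_divide_distrib diff_divide_distrib)
    also have "norm \<dots> \<le> exp 1 * h\<^sup>2 * moment \<alpha> t 0 / \<bar>h\<bar>"
      using I by (simp add: divide_right_mono)
    also have "\<dots> = exp 1 * moment \<alpha> t 0 * \<bar>h\<bar>"
    proof -
      have "h\<^sup>2 = \<bar>h\<bar> * \<bar>h\<bar>" by (simp add: power2_eq_square)
      then show ?thesis using h by (simp del: abs_mult_self_eq)
    qed
    finally show ?thesis .
  qed
  have "((\<lambda>h. (moment \<alpha> (t + h) j - moment \<alpha> t j) / h - (- moment \<alpha> t (j + 2))) \<longlongrightarrow> 0) (at 0)"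
  proof (rule Lim_null_comparison)
    have "\<forall>\<^sub>F h in at 0. h \<noteq> 0 \<and> \<bar>h\<bar> < (1::real)"
      by (auto simp: eventually_at intro!: exI[of _ 1])
    then show "\<forall>\<^sub>F h in at 0. norm ((moment \<alpha> (t + h) j - moment \<alpha> t j) / h - (- moment \<alpha> t (j + 2)))
        \<le> exp 1 * moment \<alpha> t 0 * \<bar>h\<bar>"
      by eventually_elim (use bound in auto)
    show "((\<lambda>h::real. exp 1 * moment \<alpha> t 0 * \<bar>h\<bar>) \<longlongrightarrow> 0) (at 0)"
      by (auto intro!: tendsto_eq_intros)
  qed
  then have "((\<lambda>h. (moment \<alpha> (t + h) j - moment \<alpha> t j) / h) \<longlongrightarrow> - moment \<alpha> t (j + 2)) (at 0)"
    by (rule LIM_zero_cancel)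
  then show ?thesis by (simp add: DERIV_def)
qed

section \<open>String and Toda equations\<close>

lemma functional_pCons:
  "functional \<mu> (pCons a p) = a * \<mu> 0 + functional (\<lambda>i. \<mu> (Suc i)) p"
proof -
  have "degree (pCons a p) \<le> Suc (degree p)" by (rule degree_pCons_le)
  then have "functional \<mu> (pCons a p) = (\<Sum>i\<le>Suc (degree p). coeff (pCons a p) i * \<mu> i)"
    by (rule functional_eq_sum)
  also have "\<dots> = a * \<mu> 0 + functional (\<lambda>i. \<mu> (Suc i)) p"
    by (simp add: sum.atMost_Suc_shift functional_def del: sum.atMost_Suc)
  finally show ?thesis .
qed

lemma functional_mult:
  assumes "degree p \<le> n" "degree q \<le> m"
  shows "functional \<mu> (p * q) = (\<Sum>i\<le>n. \<Sum>j\<le>m. coeff p i * coeff q j * \<mu> (i + j))"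
proof -
  have "functional \<mu> (p * q)
      = functional \<mu> ((\<Sum>i\<le>n. monom (coeff p i) i) * (\<Sum>j\<le>m. monom (coeff q j) j))"
    using assms by (simp add: poly_as_sum_of_monoms')
  also have "\<dots> = (\<Sum>i\<le>n. \<Sum>j\<le>m. coeff p i * coeff q j * \<mu> (i + j))"
    by (simp add: sum_product functional_sum mult_monom functional_monom)
  finally show ?thesis .
qed

text \<open>
  Evaluate the Pearson identity on \<open>q = P n * P (n - 1)\<close> in two ways: with orthogonality and the
  recurrence, and with the two leading coefficients of \<open>P n\<close>.
\<close>

lemma (in even_moment_functional) string_equation:
  fixes \<alpha> t :: real
  assumes Pearson: "\<And>q. L ([:1, 0, -1:] * pderiv q) = L ([:0, 2 + 2 * \<alpha> + 2 * t, 0, - 2 * t:] * q)"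
    and n: "n = Suc m"
  shows "real n - 2 * (\<Sum>j=1..m. \<beta> j)
    = \<beta> n * (2 * real n + 1 + 2 * \<alpha> + 2 * t * (1 - \<beta> m - \<beta> n - \<beta> (Suc n)))"
proof -
  define S where "S = (\<Sum>j=1..m. \<beta> j)"
  let ?w = "[:1, 0, -1:] :: real poly" and ?X = "[:0, 1:] :: real poly"
  have cw: "coeff (?w * s) k = coeff s k - (if k < 2 then 0 else coeff s (k - 2))" for s k
  proof -
    have "?w * s = s - pCons 0 (pCons 0 s)" by simp
    then show ?thesis by (cases k; cases "k - 1") (auto simp: coeff_pCons numeral_2_eq_2)
  qed
  have split: "?w * pderiv (P n * P m) = P n * (?w * pderiv (P m)) + P m * (?w * pderiv (P n))"
    by (simp only: pderiv_mult) (simp add: algebra_simps)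
  \<comment> \<open>The coefficient of x^n in this product is - m, so orthogonality leaves the
    single term - m h_n.\<close>
  have "degree (?w * pderiv (P m)) \<le> n"
    by (rule degree_le, intro allI impI, subst cw) (auto simp: coeff_pderiv n coeff_eq_0)
  then have A: "L (P n * (?w * pderiv (P m))) = - real m * h n"
    by (subst functional_monic_op_mult, simp, subst cw)
      (auto simp: coeff_pderiv n coeff_eq_0 numeral_2_eq_2)
  \<comment> \<open>The added multiple of \<open>P (Suc n)\<close> cancels the leading term and is
    invisible to the functional against \<open>P m\<close>. The coefficient of x^n vanishes by
    parity, so the degree drops to m and only the coefficient of x^m counts.\<close>
  define r where "r = ?w * pderiv (P n) + Polynomial.smult (real n) (P (Suc n))"
  have "coeff r k = 0" if k: "k > m" for k
  proof -
    consider "k = Suc m" | "k = Suc (Suc m)" | "k > Suc (Suc m)" using k by linarith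
    then show ?thesis
    proof cases
      case 1
      then have "coeff (P (Suc n)) k = 0" "coeff (P n) (k - 1) = 0"
        using n by (auto intro: coeff_monic_op_parity simp del: monic_op.simps)
      moreover have "coeff (P n) k = 1" "coeff (P n) (Suc k) = 0"
        using 1 n by (auto simp: coeff_eq_0 simp del: monic_op.simps)
      ultimately show ?thesis
        unfolding r_def coeff_add cw using 1 n
        by (auto simp: coeff_pderiv simp del: monic_op.simps)
    next
      case 2
      then show ?thesis
        unfolding r_def coeff_add cw by (auto simp: coeff_pderiv n coeff_eq_0)
    next
      case 3
      then have "Suc (k - 2) > n" using n by linarith
      with 3 show ?thesis
        unfolding r_def coeff_add cw by (auto simp: coeff_pderiv n coeff_eq_0)
    qed
  qed
  then have "degree r \<le> m" by (intro degree_le) auto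
  then have "L (P m * r) = coeff r m * h m" by (rule functional_monic_op_mult)
  also have "coeff r m = real n - 2 * S - real n * \<beta> n"
  proof -
    have f1: "coeff (P (Suc n)) m = - (S + \<beta> n)"
      using coeff_monic_op_subleading[of \<mu> m] n by (simp add: S_def)
    have f2: "(if m < 2 then 0 else coeff (pderiv (P n)) (m - 2)) = - (real m - 1) * S"
    proof (cases m)
      case (Suc k)
      have "coeff (P (k + 2)) k = - S"
        using coeff_monic_op_subleading[of \<mu> k] Suc by (simp add: S_def)
      then show ?thesis
        using Suc n by (cases k) (auto simp: coeff_pderiv algebra_simps simp del: monic_op.simps)
    qed (simp add: S_def)
    have f3: "coeff (pderiv (P n)) m = real n"
      by (simp add: coeff_pderiv n del: monic_op.simps)
    show ?thesis
      unfolding r_def coeff_add coeff_smult cw f1 f2 f3 using n by (simp add: algebra_simps)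
  qed
  also have "L (P m * r) = L (P m * (?w * pderiv (P n)))"
    unfolding r_def by (simp add: distrib_left functional_linear orthogonal n del: monic_op.simps)
  finally have B: "L (P m * (?w * pderiv (P n))) = (real n - 2 * S - real n * \<beta> n) * h m" .

  have X1: "?X * P n = P (Suc n) + Polynomial.smult (\<beta> n) (P m)"
    using X_mult_monic_op[of \<mu> n] n by simp
  have X2: "?X * (?X * P m) = P (Suc n) + Polynomial.smult (\<beta> n) (P m)
      + Polynomial.smult (\<beta> m) (P m + Polynomial.smult (\<beta> (m - 1)) (P (m - 1 - 1)))"
  proof (cases m)
    case 0
    then show ?thesis using X1 n by simp
  next
    case (Suc k)
    have X3: "?X * (?X * P m) = ?X * P n + Polynomial.smult (\<beta> m) (?X * P k)"
      using X_mult_monic_op[of \<mu> m] Suc n by (simp add: distrib_left del: monic_op.simps)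
    show ?thesis unfolding X3 X1 X_mult_monic_op[of \<mu> k] using Suc by (simp del: monic_op.simps)
  qed
  have C: "L ((?X * P n) * P m) = \<beta> n * h m"
    unfolding X1 by (simp add: distrib_right functional_linear orthogonal h_eq n del: monic_op.simps)
  \<comment> \<open>For m = 0 the index m - 1 - 1 truncates to m and orthogonality fails; that term
    then drops out because \<open>\<beta> 0 = 0\<close>.\<close>
  have "m - 1 - 1 \<noteq> m \<or> m = 0" by auto
  then have D: "L ((?X * P n) * (?X * (?X * P m))) = h (Suc n) + \<beta> n * (\<beta> n + \<beta> m) * h m"
    unfolding X1 X2 distrib_left distrib_right mult_smult_left mult_smult_right functional_linear
    by (auto simp: orthogonal h_eq n algebra_simps simp del: monic_op.simps)
  have "[:0, 2 + 2 * \<alpha> + 2 * t, 0, - 2 * t:] * (P n * P m)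
      = Polynomial.smult (2 + 2 * \<alpha> + 2 * t) ((?X * P n) * P m)
        - Polynomial.smult (2 * t) ((?X * P n) * (?X * (?X * P m)))"
    by (simp add: algebra_simps)
  then have "L (?w * pderiv (P n * P m)) = (2 + 2 * \<alpha> + 2 * t) * (\<beta> n * h m)
      - 2 * t * (h (Suc n) + \<beta> n * (\<beta> n + \<beta> m) * h m)"
    unfolding Pearson by (simp only: functional_linear C D)
  then have "- real m * h n + (real n - 2 * S - real n * \<beta> n) * h m
      = (2 + 2 * \<alpha> + 2 * t) * (\<beta> n * h m) - 2 * t * (h (Suc n) + \<beta> n * (\<beta> n + \<beta> m) * h m)"
    unfolding split by (simp only: functional_linear A B)
  moreover have "h n = \<beta> n * h m" "h (Suc n) = \<beta> (Suc n) * (\<beta> n * h m)"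
    using h_Suc[of m] h_Suc[of n] n by simp_all
  ultimately have "h m * (real n - 2 * S) = h m *
      (\<beta> n * (2 * real n + 1 + 2 * \<alpha> + 2 * t * (1 - \<beta> m - \<beta> n - \<beta> (Suc n))))"
    using n by (simp add: algebra_simps)
  then show ?thesis using h_pos[of m] by (simp add: S_def)
qed

text \<open>The leading coefficient of \<open>P n\<close> is constant, so the t-derivative of
  \<open>P n\<close> has degree below n and is orthogonal to \<open>P n\<close>. Only the derivative
  of the moments remains, and it inserts a factor - x^2.\<close>

lemma has_real_derivative_op_norm:
  fixes M :: "real \<Rightarrow> nat \<Rightarrow> real"
  assumes M: "\<And>j. ((\<lambda>t. M t j) has_real_derivative - M t (j + 2)) (at t)"
    and even: "even_moment_functional (M t)"
    and c: "\<And>i. ((\<lambda>t. coeff (monic_op (M t) n) i) has_real_derivative c i) (at t)"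
  shows "((\<lambda>t. op_norm (M t) n) has_real_derivative
    - (rec_coeff (M t) n + rec_coeff (M t) (Suc n)) * op_norm (M t) n) (at t)"
proof -
  interpret even_moment_functional "M t" by (rule even)
  let ?c = "\<lambda>t i. coeff (monic_op (M t) n) i"
  have norm: "op_norm (M t) n = (\<Sum>i\<le>n. \<Sum>j\<le>n. ?c t i * ?c t j * M t (i + j))" for t
    unfolding op_norm_def power2_eq_square by (rule functional_mult) simp_all
  have "c n = 0"
    using c[of n] DERIV_unique[of "\<lambda>_. 1" _ t 0] by simp
  define Q where "Q = (\<Sum>i\<le>n. monom (c i) i)"
  have cQ: "coeff Q i = (if i \<le> n then c i else 0)" for i
    unfolding Q_def by (simp add: coeff_sum if_distrib cong: if_cong)
  have dQ: "degree Q \<le> n" by (rule degree_le) (auto simp: cQ)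
  have "L (P n * Q) = 0"
    using functional_monic_op_mult[OF dQ] \<open>c n = 0\<close> by (simp add: cQ)
  then have Q: "(\<Sum>i\<le>n. \<Sum>j\<le>n. ?c t i * c j * M t (i + j)) = 0"
    by (subst (asm) functional_mult[of _ n _ n]) (simp_all add: dQ cQ)
  have "((\<lambda>t. \<Sum>i\<le>n. \<Sum>j\<le>n. ?c t i * ?c t j * M t (i + j)) has_real_derivative
      (\<Sum>i\<le>n. \<Sum>j\<le>n. (c i * ?c t j + c j * ?c t i) * M t (i + j)
        + - M t (i + j + 2) * (?c t i * ?c t j))) (at t)"
    by (intro DERIV_sum DERIV_mult c M)
  also have "(\<Sum>i\<le>n. \<Sum>j\<le>n. (c i * ?c t j + c j * ?c t i) * M t (i + j)
        + - M t (i + j + 2) * (?c t i * ?c t j))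
      = 2 * (\<Sum>i\<le>n. \<Sum>j\<le>n. ?c t i * c j * M t (i + j))
        - (\<Sum>i\<le>n. \<Sum>j\<le>n. ?c t i * ?c t j * M t (Suc (Suc (i + j))))"
  proof -
    have "(\<Sum>i\<le>n. \<Sum>j\<le>n. c i * ?c t j * M t (i + j)) = (\<Sum>i\<le>n. \<Sum>j\<le>n. ?c t i * c j * M t (i + j))"
      by (subst sum.swap) (simp add: algebra_simps)
    then show ?thesis
      by (simp add: distrib_right sum.distrib sum_subtractf sum_negf algebra_simps)
  qed
  also have "(\<Sum>i\<le>n. \<Sum>j\<le>n. ?c t i * ?c t j * M t (Suc (Suc (i + j))))
      = functional (\<lambda>i. M t (Suc (Suc i))) (P n * P n)"
    by (rule functional_mult[symmetric]) simp_all
  also have "\<dots> = L ([:0, 0, 1:] * (P n)\<^sup>2)"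
    by (simp add: functional_pCons power2_eq_square)
  finally show ?thesis
    unfolding norm[symmetric] Q functional_X2_monic_op by (rule DERIV_cong) (simp add: algebra_simps)
qed

text \<open>Induction along the recurrence: differentiable coefficients give differentiable norms by
  \<open>has_real_derivative_op_norm\<close>, hence a differentiable \<open>rec_coeff\<close>, hence
  the next polynomial.\<close>

lemma differentiable_coeff_monic_op:
  fixes M :: "real \<Rightarrow> nat \<Rightarrow> real"
  assumes M: "\<And>j t. ((\<lambda>t. M t j) has_real_derivative - M t (j + 2)) (at t)"
    and even: "\<And>t. even_moment_functional (M t)"
  shows "\<exists>c. \<forall>i. ((\<lambda>t. coeff (monic_op (M t) n) i) has_real_derivative c i) (at t)"
proof (induction n arbitrary: t rule: less_induct)
  case (less n)
  consider "n = 0" | "n = 1" | k where "n = Suc (Suc k)"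
    by (metis One_nat_def not0_implies_Suc)
  then show ?case
  proof cases
    case 3
    obtain a where a: "\<And>i. ((\<lambda>t. coeff (monic_op (M t) k) i) has_real_derivative a i) (at t)"
      using less.IH[of k] 3 by auto
    obtain b where b: "\<And>i. ((\<lambda>t. coeff (monic_op (M t) (Suc k)) i) has_real_derivative b i) (at t)"
      using less.IH[of "Suc k"] 3 by auto
    note ha = has_real_derivative_op_norm[OF M even a]
    note hb = has_real_derivative_op_norm[OF M even b]
    have "op_norm (M t) k \<noteq> 0" using even_moment_functional.h_pos[OF even, of t k] by simp
    from DERIV_divide[OF hb ha this] obtain d where
      d: "((\<lambda>t. rec_coeff (M t) (Suc k)) has_real_derivative d) (at t)"
      by (auto simp: rec_coeff_def)
    have *: "((\<lambda>t. coeff (monic_op (M t) n) i) has_real_derivative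
        (case i of 0 \<Rightarrow> 0 | Suc j \<Rightarrow> b j) - (d * coeff (monic_op (M t) k) i + a i * rec_coeff (M t) (Suc k))) (at t)"
      for i
    proof -
      have "((\<lambda>t. case i of 0 \<Rightarrow> 0 | Suc j \<Rightarrow> coeff (monic_op (M t) (Suc k)) j) has_real_derivative
          (case i of 0 \<Rightarrow> 0 | Suc j \<Rightarrow> b j)) (at t)"
        using b by (cases i) simp_all
      from DERIV_diff[OF this DERIV_mult[OF d a]] show ?thesis
        unfolding 3 monic_op_Suc_Suc by (simp add: coeff_pCons split: nat.splits)
    qed
    show ?thesis by (intro exI allI) (rule *)
  qed (auto intro!: exI[of _ "\<lambda>_. 0"])
qed

text \<open>The factor of 2 t in the string equation, its only nonlinear part.\<close>

definition rec_cubic :: "real \<Rightarrow> real \<Rightarrow> nat \<Rightarrow> real" where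
  "rec_cubic \<alpha> t n = rec_coeff (moment \<alpha> t) n * (1 - rec_coeff (moment \<alpha> t) (n - 1)
    - rec_coeff (moment \<alpha> t) n - rec_coeff (moment \<alpha> t) (Suc n))"

section \<open>Specialisation to the moments of the weight\<close>

context
  fixes \<alpha> :: real
  assumes \<alpha>: "\<alpha> > -1"
begin

abbreviation "\<beta> t n \<equiv> rec_coeff (moment \<alpha> t) n"

lemma rec_coeff_moment_bounds: "\<beta> t n \<ge> 0" "\<beta> t n \<le> 1"
  and rec_coeff_moment_pos: "n > 0 \<Longrightarrow> \<beta> t n > 0"
  and op_norm_moment_pos: "op_norm (moment \<alpha> t) n > 0"
proof -
  note E = even_moment_functional_moment[OF \<alpha>, of t]
  show "\<beta> t n \<ge> 0" "\<beta> t n \<le> 1" "n > 0 \<Longrightarrow> \<beta> t n > 0" "op_norm (moment \<alpha> t) n > 0"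
    using even_moment_functional.rec_coeff_nonneg[OF E] even_moment_functional.rec_coeff_le_1[OF E]
      even_moment_functional.rec_coeff_pos[OF E] even_moment_functional.h_pos[OF E] by auto
qed

lemma op_norm_moment_Suc: "op_norm (moment \<alpha> t) (Suc n) = \<beta> t (Suc n) * op_norm (moment \<alpha> t) n"
  using even_moment_functional.h_Suc[OF even_moment_functional_moment[OF \<alpha>]] .

lemma hankel_det_eq_prod: "hankel_det \<alpha> n t = (\<Prod>k<n. op_norm (moment \<alpha> t) k)"
  unfolding hankel_det_def
  by (rule even_moment_functional.hankel_det_eq_prod_norms[OF even_moment_functional_moment[OF \<alpha>]])

lemma hankel_det_pos: "hankel_det \<alpha> n t > 0"
  unfolding hankel_det_eq_prod by (intro prod_pos ballI op_norm_moment_pos)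

lemma string_equation_moment:
  "real (Suc m) - 2 * (\<Sum>j=1..m. \<beta> t j) = \<beta> t (Suc m) * (2 * real (Suc m) + 1 + 2 * \<alpha>
    + 2 * t * (1 - \<beta> t m - \<beta> t (Suc m) - \<beta> t (Suc (Suc m))))"
  by (rule even_moment_functional.string_equation[OF even_moment_functional_moment[OF \<alpha>]
      Pearson_functional[OF \<alpha>] refl])

lemma rec_coeff_difference_equation:
  assumes "n \<ge> 1"
  shows "(2 * real n + 2 * \<alpha> + 3) * \<beta> t (Suc n) - (2 * real n + 2 * \<alpha> - 1) * \<beta> t n
    = 1 - 2 * t * (rec_cubic \<alpha> t (Suc n) - rec_cubic \<alpha> t n)"
proof -
  obtain m where n: "n = Suc m" using assms by (cases n) auto
  show ?thesis
    using string_equation_moment[of m t] string_equation_moment[of n t]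
    by (simp add: n rec_cubic_def algebra_simps)
qed

text \<open>Kept free of division because the second factor vanishes for n = 1 and \<alpha> = -1/2;
  \<open>rec_coeff_0_1\<close> supplies the value at n = 1 separately.\<close>

lemma rec_coeff_0_eq:
  assumes "n \<ge> 1"
  shows "\<beta> 0 n * ((2 * real n + 2 * \<alpha> + 1) * (2 * real n + 2 * \<alpha> - 1)) = real n * (real n + 2 * \<alpha>)"
  using assms
proof (induction n rule: dec_induct)
  case base
  have "\<beta> 0 1 * (3 + 2 * \<alpha>) = 1"
    using string_equation_moment[of 0 0] by (simp add: algebra_simps)
  then have "(\<beta> 0 1 * (3 + 2 * \<alpha>)) * (1 + 2 * \<alpha>) = 1 + 2 * \<alpha>" by simp
  then show ?case by (simp add: algebra_simps)
next
  case (step n)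
  have "(2 * real n + 2 * \<alpha> + 3) * \<beta> 0 (Suc n) = 1 + (2 * real n + 2 * \<alpha> - 1) * \<beta> 0 n"
    using rec_coeff_difference_equation[of n 0] step by simp
  then have "((2 * real n + 2 * \<alpha> + 3) * \<beta> 0 (Suc n)) * (2 * real n + 2 * \<alpha> + 1)
      = (1 + (2 * real n + 2 * \<alpha> - 1) * \<beta> 0 n) * (2 * real n + 2 * \<alpha> + 1)"
    by (simp only:)
  also have "\<dots> = (2 * real n + 2 * \<alpha> + 1) + \<beta> 0 n * ((2 * real n + 2 * \<alpha> + 1) * (2 * real n + 2 * \<alpha> - 1))"
    by (simp add: algebra_simps)
  finally show ?case unfolding step.IH by (simp add: algebra_simps)
qed

lemma rec_coeff_0_1: "\<beta> 0 1 = 1 / (2 * \<alpha> + 3)"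
proof -
  have "\<beta> 0 1 * (3 + 2 * \<alpha>) = 1"
    using string_equation_moment[of 0 0] by (simp add: algebra_simps)
  then show ?thesis using \<alpha> by (simp add: field_simps)
qed

lemma has_real_derivative_op_norm_moment:
  "((\<lambda>t. op_norm (moment \<alpha> t) n) has_real_derivative
    - (\<beta> t n + \<beta> t (Suc n)) * op_norm (moment \<alpha> t) n) (at t)"
proof -
  note M = has_real_derivative_moment[OF \<alpha>]
  obtain c where "\<And>i. ((\<lambda>t. coeff (monic_op (moment \<alpha> t) n) i) has_real_derivative c i) (at t)"
    using differentiable_coeff_monic_op[of "moment \<alpha>", OF M even_moment_functional_moment[OF \<alpha>]]
    by blast
  from has_real_derivative_op_norm[of "moment \<alpha>", OF M even_moment_functional_moment[OF \<alpha>] this]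
  show ?thesis .
qed

text \<open>Quotient rule for h_n / h_(n-1): \<open>\<beta> t n\<close> occurs in both logarithmic
  derivatives and cancels.\<close>

lemma has_real_derivative_rec_coeff_moment:
  assumes "n \<ge> 1"
  shows "((\<lambda>t. \<beta> t n) has_real_derivative \<beta> t n * (\<beta> t (n - 1) - \<beta> t (Suc n))) (at t)"
proof -
  obtain m where n: "n = Suc m" using assms by (cases n) auto
  have nz: "op_norm (moment \<alpha> t) m \<noteq> 0" using op_norm_moment_pos[of t m] by simp
  show ?thesis
    using DERIV_divide[OF has_real_derivative_op_norm_moment[of "Suc m" t]
        has_real_derivative_op_norm_moment[of m t] nz] nz
    unfolding n by (auto simp: rec_coeff_def field_simps elim!: DERIV_cong)
qed

text \<open>Differentiating the norms gives a sum over all smaller indices. The string equation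
  replaces it by terms local in n, so an expansion of the coefficients for large n can be inserted
  without a constant of summation.\<close>

lemma has_real_derivative_ln_hankel_det:
  assumes "n \<ge> 1"
  shows "((\<lambda>t. ln (hankel_det \<alpha> n t)) has_real_derivative
    - real n + (2 * real n + 2 * \<alpha>) * \<beta> t n + 2 * t * rec_cubic \<alpha> t n) (at t)"
proof -
  obtain m where n: "n = Suc m" using assms by (cases n) auto
  have "((\<lambda>t. \<Sum>k<n. ln (op_norm (moment \<alpha> t) k)) has_real_derivative
      (\<Sum>k<n. inverse (op_norm (moment \<alpha> t) k) * (- (\<beta> t k + \<beta> t (Suc k)) * op_norm (moment \<alpha> t) k))) (at t)"
    using op_norm_moment_pos
    by (intro DERIV_sum DERIV_chain2[where f = ln] DERIV_ln has_real_derivative_op_norm_moment) auto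
  also have "(\<lambda>t. \<Sum>k<n. ln (op_norm (moment \<alpha> t) k)) = (\<lambda>t. ln (hankel_det \<alpha> n t))"
    unfolding hankel_det_eq_prod
    by (intro ext ln_prod[symmetric]) (auto simp: less_imp_neq[OF op_norm_moment_pos, symmetric])
  also have "(\<Sum>k<n. inverse (op_norm (moment \<alpha> t) k) * (- (\<beta> t k + \<beta> t (Suc k)) * op_norm (moment \<alpha> t) k))
      = (\<Sum>k<n. - (\<beta> t k + \<beta> t (Suc k)))"
    using op_norm_moment_pos[of t] by (intro sum.cong) (auto simp: less_imp_neq[symmetric])
  also have "\<dots> = - 2 * (\<Sum>j=1..m. \<beta> t j) - \<beta> t n"
    unfolding n by (induction m) (simp_all add: algebra_simps)
  also have "\<dots> = - real n + (2 * real n + 2 * \<alpha>) * \<beta> t n + 2 * t * rec_cubic \<alpha> t n"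
    using string_equation_moment[of m t] by (simp add: n rec_cubic_def algebra_simps)
  finally show ?thesis .
qed

end

section \<open>Asymptotic bounds that are uniform in a parameter\<close>

text \<open>p is the order of decay, as in O(n^(-p)); negative p permits growth, and real p permits
  the half-integer orders of the bootstrap.\<close>

definition unif_bigo :: "real \<Rightarrow> (nat \<Rightarrow> real \<Rightarrow> real) \<Rightarrow> real \<Rightarrow> bool" where
  "unif_bigo T f p \<longleftrightarrow>
    (\<exists>C. \<forall>\<^sub>F n in sequentially. \<forall>t\<in>{-T..T}. \<bar>f n t\<bar> \<le> C * real n powr (- p))"

lemma unif_bigoI:
  "(\<forall>\<^sub>F n in sequentially. \<forall>t\<in>{-T..T}. \<bar>f n t\<bar> \<le> C * real n powr (- p)) \<Longrightarrow> unif_bigo T f p"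
  unfolding unif_bigo_def by blast

lemma unif_bigoE:
  assumes "unif_bigo T f p"
  obtains C where "C \<ge> 0"
    "\<forall>\<^sub>F n in sequentially. \<forall>t\<in>{-T..T}. \<bar>f n t\<bar> \<le> C * real n powr (- p)"
proof -
  from assms obtain C where
    C: "\<forall>\<^sub>F n in sequentially. \<forall>t\<in>{-T..T}. \<bar>f n t\<bar> \<le> C * real n powr (- p)"
    unfolding unif_bigo_def by blast
  show ?thesis
  proof (rule that[of "\<bar>C\<bar>"])
    show "\<forall>\<^sub>F n in sequentially. \<forall>t\<in>{-T..T}. \<bar>f n t\<bar> \<le> \<bar>C\<bar> * real n powr (- p)"
      using C
    proof eventually_elim
      case (elim n)
      show ?case
      proof
        fix t assume "t \<in> {-T..T}"
        then have "\<bar>f n t\<bar> \<le> C * real n powr (- p)" using elim by blast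
        also have "\<dots> \<le> \<bar>C\<bar> * real n powr (- p)" by (intro mult_right_mono) auto
        finally show "\<bar>f n t\<bar> \<le> \<bar>C\<bar> * real n powr (- p)" .
      qed
    qed
  qed simp
qed

lemma unif_bigo_cong:
  assumes "unif_bigo T f p" "\<forall>\<^sub>F n in sequentially. \<forall>t\<in>{-T..T}. f n t = g n t"
  shows "unif_bigo T g p"
proof -
  from assms(1) obtain C where
    C: "\<forall>\<^sub>F n in sequentially. \<forall>t\<in>{-T..T}. \<bar>f n t\<bar> \<le> C * real n powr (- p)"
    unfolding unif_bigo_def by blast
  show ?thesis
    by (rule unif_bigoI[of _ _ C]) (use C assms(2) in eventually_elim, auto)
qed

lemma unif_bigo_mono:
  assumes "unif_bigo T f p" "q \<le> p"
  shows "unif_bigo T f q"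
proof -
  from assms(1) obtain C where C: "C \<ge> 0"
    "\<forall>\<^sub>F n in sequentially. \<forall>t\<in>{-T..T}. \<bar>f n t\<bar> \<le> C * real n powr (- p)"
    by (rule unif_bigoE)
  show ?thesis
  proof (rule unif_bigoI[of _ _ C])
    show "\<forall>\<^sub>F n in sequentially. \<forall>t\<in>{-T..T}. \<bar>f n t\<bar> \<le> C * real n powr (- q)"
      using C(2) eventually_ge_at_top[of 1]
    proof eventually_elim
      case (elim n)
      have "C * real n powr (- p) \<le> C * real n powr (- q)"
        using elim C(1) assms(2) by (intro mult_left_mono powr_mono) auto
      then show ?case using elim(1) by force
    qed
  qed
qed

lemma unif_bigo_add:
  assumes "unif_bigo T f p" "unif_bigo T g p"
  shows "unif_bigo T (\<lambda>n t. f n t + g n t) p"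
proof -
  from assms obtain C D where
    C: "\<forall>\<^sub>F n in sequentially. \<forall>t\<in>{-T..T}. \<bar>f n t\<bar> \<le> C * real n powr (- p)"
    and D: "\<forall>\<^sub>F n in sequentially. \<forall>t\<in>{-T..T}. \<bar>g n t\<bar> \<le> D * real n powr (- p)"
    unfolding unif_bigo_def by blast
  show ?thesis
    by (rule unif_bigoI[of _ _ "C + D"])
      (use C D in eventually_elim, auto simp: distrib_right intro!: order.trans[OF abs_triangle_ineq] add_mono)
qed

lemma unif_bigo_mult:
  assumes "unif_bigo T f p" "unif_bigo T g q" "r \<le> p + q"
  shows "unif_bigo T (\<lambda>n t. f n t * g n t) r"
proof -
  from assms(1) obtain C where C: "C \<ge> 0"
    "\<forall>\<^sub>F n in sequentially. \<forall>t\<in>{-T..T}. \<bar>f n t\<bar> \<le> C * real n powr (- p)"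
    by (rule unif_bigoE)
  from assms(2) obtain D where D: "D \<ge> 0"
    "\<forall>\<^sub>F n in sequentially. \<forall>t\<in>{-T..T}. \<bar>g n t\<bar> \<le> D * real n powr (- q)"
    by (rule unif_bigoE)
  have "unif_bigo T (\<lambda>n t. f n t * g n t) (p + q)"
  proof (rule unif_bigoI[of _ _ "C * D"])
    show "\<forall>\<^sub>F n in sequentially. \<forall>t\<in>{-T..T}. \<bar>f n t * g n t\<bar> \<le> C * D * real n powr (- (p + q))"
      using C(2) D(2)
    proof eventually_elim
      case (elim n)
      show ?case
      proof
        fix t assume t: "t \<in> {-T..T}"
        have "\<bar>f n t * g n t\<bar> \<le> (C * real n powr (- p)) * (D * real n powr (- q))"
          unfolding abs_mult using elim t C(1) D(1) by (intro mult_mono) auto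
        also have "\<dots> = C * D * real n powr (- (p + q))" by (simp add: powr_diff powr_minus divide_inverse powr_add)
        finally show "\<bar>f n t * g n t\<bar> \<le> C * D * real n powr (- (p + q))" .
      qed
    qed
  qed
  then show ?thesis using assms(3) by (rule unif_bigo_mono)
qed

lemma unif_bigo_lift:
  assumes "f \<in> O(\<lambda>n. real n powr (- p))"
  shows "unif_bigo T (\<lambda>n t. f n) p"
proof -
  from assms obtain C where "\<forall>\<^sub>F n in sequentially. norm (f n) \<le> C * norm (real n powr (- p))"
    by (auto elim: landau_o.bigE)
  then show ?thesis
    by (intro unif_bigoI[of _ _ C]) (auto elim!: eventually_mono)
qed

lemma unif_bigo_bounded:
  assumes "\<And>t. t \<in> {-T..T} \<Longrightarrow> \<bar>g t\<bar> \<le> C" "p \<le> 0"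
  shows "unif_bigo T (\<lambda>n. g) p"
proof (rule unif_bigo_mono[OF unif_bigoI[of _ _ C] assms(2)])
  show "\<forall>\<^sub>F n in sequentially. \<forall>t\<in>{-T..T}. \<bar>g t\<bar> \<le> C * real n powr (- 0)"
    using eventually_gt_at_top[of 0] by eventually_elim (use assms in auto)
qed

lemma unif_bigo_const: "p \<le> 0 \<Longrightarrow> unif_bigo T (\<lambda>n t. c) p"
  by (rule unif_bigo_bounded[where C = "\<bar>c\<bar>"]) auto

lemma unif_bigo_t: "p \<le> 0 \<Longrightarrow> unif_bigo T (\<lambda>n t. t) p"
  by (rule unif_bigo_bounded[where C = T]) auto

lemma unif_bigo_cmult: "unif_bigo T f p \<Longrightarrow> unif_bigo T (\<lambda>n t. c * f n t) p"
  using unif_bigo_mult[OF unif_bigo_const[of 0 T c], of f p p] by simp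

lemma unif_bigo_tmult: "unif_bigo T f p \<Longrightarrow> unif_bigo T (\<lambda>n t. t * f n t) p"
  using unif_bigo_mult[OF unif_bigo_t[of 0 T], of f p p] by simp

lemma unif_bigo_minus: "unif_bigo T f p \<Longrightarrow> unif_bigo T (\<lambda>n t. - f n t) p"
  by (simp add: unif_bigo_def)

lemma unif_bigo_diff:
  "unif_bigo T f p \<Longrightarrow> unif_bigo T g p \<Longrightarrow> unif_bigo T (\<lambda>n t. f n t - g n t) p"
  using unif_bigo_add[of T f p "\<lambda>n t. - g n t"] by (simp add: unif_bigo_minus)

lemma unif_bigo_reindex:
  assumes f: "unif_bigo T f p" and s: "filterlim s sequentially sequentially"
    and O: "(\<lambda>n. real (s n) powr (- p)) \<in> O(\<lambda>n. real n powr (- p))"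
  shows "unif_bigo T (\<lambda>n. f (s n)) p"
proof -
  from f obtain C where C: "C \<ge> 0"
    "\<forall>\<^sub>F n in sequentially. \<forall>t\<in>{-T..T}. \<bar>f n t\<bar> \<le> C * real n powr (- p)"
    by (rule unif_bigoE)
  from O obtain D where D:
    "\<forall>\<^sub>F n in sequentially. norm (real (s n) powr (- p)) \<le> D * norm (real n powr (- p))"
    by (auto elim: landau_o.bigE)
  have "\<forall>\<^sub>F n in sequentially. \<forall>t\<in>{-T..T}. \<bar>f (s n) t\<bar> \<le> C * real (s n) powr (- p)"
    using eventually_compose_filterlim[OF C(2) s] .
  then have "\<forall>\<^sub>F n in sequentially. \<forall>t\<in>{-T..T}. \<bar>f (s n) t\<bar> \<le> C * D * real n powr (- p)"
    using D
  proof eventually_elim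
    case (elim n)
    have "C * real (s n) powr (- p) \<le> C * (D * real n powr (- p))"
      using elim(2) C(1) by (intro mult_left_mono) auto
    then show ?case using elim(1) by (force simp: mult.assoc)
  qed
  then show ?thesis by (rule unif_bigoI)
qed

lemma unif_bigo_Suc:
  assumes "unif_bigo T f p"
  shows "unif_bigo T (\<lambda>n. f (Suc n)) p"
proof (rule unif_bigo_reindex[OF assms filterlim_Suc])
  show "(\<lambda>n. real (Suc n) powr - p) \<in> O(\<lambda>n. real n powr - p)" by real_asymp
qed

lemma unif_bigo_pred:
  assumes "unif_bigo T f p"
  shows "unif_bigo T (\<lambda>n. f (n - 1)) p"
proof (rule unif_bigo_reindex[OF assms])
  show "filterlim (\<lambda>n. n - 1) sequentially sequentially"
    by (rule filterlim_minus_const_nat_at_top)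
  have "(\<lambda>n. (real n - 1) powr - p) \<in> O(\<lambda>n. real n powr - p)" by real_asymp
  also have "?this \<longleftrightarrow> (\<lambda>n. real (n - 1) powr - p) \<in> O(\<lambda>n. real n powr - p)"
    by (intro landau_o.big.in_cong eventually_mono[OF eventually_ge_at_top[of 1]])
      (simp add: of_nat_diff)
  finally show "(\<lambda>n. real (n - 1) powr - p) \<in> O(\<lambda>n. real n powr - p)" .
qed

lemma telescoping_bound:
  fixes u G :: "nat \<Rightarrow> real"
  assumes "\<And>n. n \<ge> N \<Longrightarrow> \<bar>u (Suc n) - u n\<bar> \<le> G (Suc n) - G n" and "N \<le> n" "n \<le> m"
  shows "\<bar>u m - u n\<bar> \<le> G m - G n"
  using assms(3)
proof (induction m rule: dec_induct)
  case (step m)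
  then show ?case using assms(1)[of m] assms(2) by linarith
qed simp

text \<open>Sums the increments upward from a fixed index; n^(-p) is compared with increments of
  n^q, which telescope. The a priori rate r only serves to bound u at the starting index uniformly
  in t.\<close>

lemma unif_bigo_growth:
  assumes u: "unif_bigo T u r" and D: "unif_bigo T (\<lambda>n t. u (Suc n) t - u n t) p"
    and g: "(\<lambda>n. real n powr (- p)) \<in> O(\<lambda>n. real (Suc n) powr q - real n powr q)" and "q \<ge> 0"
  shows "unif_bigo T u (- q)"
proof -
  from u obtain A where A: "A \<ge> 0"
    "\<forall>\<^sub>F n in sequentially. \<forall>t\<in>{-T..T}. \<bar>u n t\<bar> \<le> A * real n powr (- r)"
    by (rule unif_bigoE)
  from D obtain C where C: "C \<ge> 0"
    "\<forall>\<^sub>F n in sequentially. \<forall>t\<in>{-T..T}. \<bar>u (Suc n) t - u n t\<bar> \<le> C * real n powr (- p)"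
    by (rule unif_bigoE)
  from g obtain K where K: "K > 0" "\<forall>\<^sub>F n in sequentially. norm (real n powr (- p))
      \<le> K * norm (real (Suc n) powr q - real n powr q)"
    by (auto elim: landau_o.bigE)
  obtain N where N: "N \<ge> 1" "\<And>n t. n \<ge> N \<Longrightarrow> t \<in> {-T..T} \<Longrightarrow> \<bar>u n t\<bar> \<le> A * real n powr (- r)"
    "\<And>n t. n \<ge> N \<Longrightarrow> t \<in> {-T..T} \<Longrightarrow> \<bar>u (Suc n) t - u n t\<bar> \<le> C * real n powr (- p)"
    "\<And>n. n \<ge> N \<Longrightarrow> norm (real n powr (- p)) \<le> K * norm (real (Suc n) powr q - real n powr q)"
    using eventually_conj[OF eventually_conj[OF A(2) C(2)] eventually_conj[OF K(2) eventually_ge_at_top[of 1]]]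
    unfolding eventually_sequentially by (metis order_refl)
  show ?thesis
  proof (rule unif_bigoI[of _ _ "A * real N powr (- r) + C * K"], rule eventually_sequentiallyI[of N], rule ballI)
    fix n t assume n: "N \<le> n" and t: "t \<in> {-T..T}"
    have mono: "real k powr q \<le> real (Suc k) powr q" if "k \<ge> N" for k
      using that N(1) \<open>q \<ge> 0\<close> by (intro powr_mono2) auto
    have "\<bar>u n t - u N t\<bar> \<le> C * K * real n powr q - C * K * real N powr q"
    proof (rule telescoping_bound[of N])
      fix k assume k: "k \<ge> N"
      have "\<bar>u (Suc k) t - u k t\<bar> \<le> C * real k powr (- p)" using N(3) k t .
      also have "\<dots> \<le> C * (K * (real (Suc k) powr q - real k powr q))"
        using N(4)[OF k] mono[OF k] by (intro mult_left_mono C(1)) simp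
      finally show "\<bar>u (Suc k) t - u k t\<bar> \<le> C * K * real (Suc k) powr q - C * K * real k powr q"
        by (simp add: algebra_simps)
    qed (use n in auto)
    moreover have "0 \<le> C * K * real N powr q" using C(1) K(1) by simp
    moreover have "\<bar>u N t\<bar> \<le> A * real N powr (- r)" using N(2) t by blast
    ultimately have "\<bar>u n t\<bar> \<le> A * real N powr (- r) * 1 + C * K * real n powr q" by linarith
    also have "\<dots> \<le> A * real N powr (- r) * real n powr q + C * K * real n powr q"
      using A(1) n N(1) \<open>q \<ge> 0\<close> C(1) K(1) by (intro add_mono mult_left_mono ge_one_powr_ge_zero) auto
    finally show "\<bar>u n t\<bar> \<le> (A * real N powr (- r) + C * K) * real n powr (- (- q))"
      by (simp add: algebra_simps)
  qed
qed

text \<open>Sums the increments from n to infinity. The limit is required only pointwise in t;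
  uniformity comes from the increments.\<close>

lemma unif_bigo_tail:
  assumes D: "unif_bigo T (\<lambda>n t. u (Suc n) t - u n t) (q + 1)" and "q > 0"
    and lim: "\<And>t. t \<in> {-T..T} \<Longrightarrow> (\<lambda>n. u n t) \<longlonglongrightarrow> 0"
  shows "unif_bigo T u q"
proof -
  from D obtain C where C: "C \<ge> 0"
    "\<forall>\<^sub>F n in sequentially. \<forall>t\<in>{-T..T}. \<bar>u (Suc n) t - u n t\<bar> \<le> C * real n powr (- (q + 1))"
    by (rule unif_bigoE)
  have "(\<lambda>n. real n powr (- (q + 1))) \<in> O(\<lambda>n. real n powr (- q) - real (Suc n) powr (- q))"
    using \<open>q > 0\<close> by real_asymp
  then obtain K where K: "K > 0" "\<forall>\<^sub>F n in sequentially. norm (real n powr (- (q + 1)))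
      \<le> K * norm (real n powr (- q) - real (Suc n) powr (- q))"
    by (auto elim: landau_o.bigE)
  obtain N where N: "N \<ge> 1"
    "\<And>n t. n \<ge> N \<Longrightarrow> t \<in> {-T..T} \<Longrightarrow> \<bar>u (Suc n) t - u n t\<bar> \<le> C * real n powr (- (q + 1))"
    "\<And>n. n \<ge> N \<Longrightarrow> norm (real n powr (- (q + 1))) \<le> K * norm (real n powr (- q) - real (Suc n) powr (- q))"
    using eventually_conj[OF C(2) eventually_conj[OF K(2) eventually_ge_at_top[of 1]]]
    unfolding eventually_sequentially by (metis order_refl)
  show ?thesis
  proof (rule unif_bigoI[of _ _ "C * K"], rule eventually_sequentiallyI[of N], rule ballI)
    fix n t assume n: "N \<le> n" and t: "t \<in> {-T..T}"
    have mono: "real (Suc k) powr (- q) \<le> real k powr (- q)" if "k \<ge> N" for k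
      using that N(1) \<open>q > 0\<close> by (intro powr_mono2') auto
    have b: "\<bar>u m t - u n t\<bar> \<le> - (C * K * real m powr (- q)) - - (C * K * real n powr (- q))" if "m \<ge> n" for m
    proof (rule telescoping_bound[of N])
      fix k assume k: "k \<ge> N"
      have "\<bar>u (Suc k) t - u k t\<bar> \<le> C * real k powr (- (q + 1))" using N(2) k t .
      also have "\<dots> \<le> C * (K * (real k powr (- q) - real (Suc k) powr (- q)))"
        using N(3)[OF k] mono[OF k] by (intro mult_left_mono C(1)) simp
      finally show "\<bar>u (Suc k) t - u k t\<bar> \<le> - (C * K * real (Suc k) powr (- q)) - - (C * K * real k powr (- q))"
        by (simp add: algebra_simps)
    qed (use n that in auto)
    have "(\<lambda>m. \<bar>u m t - u n t\<bar>) \<longlonglongrightarrow> \<bar>0 - u n t\<bar>"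
      by (intro tendsto_intros lim t)
    moreover have "\<forall>\<^sub>F m in sequentially. \<bar>u m t - u n t\<bar> \<le> C * K * real n powr (- q)"
      using eventually_ge_at_top[of n]
    proof eventually_elim
      case (elim m)
      have "0 \<le> C * K * real m powr (- q)" using C(1) K(1) by simp
      then show ?case using b[OF elim] by linarith
    qed
    ultimately have "\<bar>0 - u n t\<bar> \<le> C * K * real n powr (- q)"
      by (intro tendsto_upperbound) auto
    then show "\<bar>u n t\<bar> \<le> C * K * real n powr (- q)" by simp
  qed
qed


lemma unif_bigo_tendsto:
  assumes "unif_bigo T u r" "r > 0" "t \<in> {-T..T}"
  shows "(\<lambda>n. u n t) \<longlonglongrightarrow> 0"
proof -
  from assms(1) obtain C where
    C: "\<forall>\<^sub>F n in sequentially. \<forall>t\<in>{-T..T}. \<bar>u n t\<bar> \<le> C * real n powr (- r)"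
    unfolding unif_bigo_def by blast
  show ?thesis
  proof (rule Lim_null_comparison)
    show "\<forall>\<^sub>F n in sequentially. norm (u n t) \<le> C * real n powr (- r)"
      using C by eventually_elim (use assms(3) in auto)
    show "(\<lambda>n. C * real n powr (- r)) \<longlonglongrightarrow> 0"
      using \<open>r > 0\<close> by real_asymp
  qed
qed

lemma unif_bigo_integrate:
  assumes D: "\<forall>\<^sub>F n in sequentially. \<forall>t. (f n has_real_derivative f' n t) (at t)"
    and f': "unif_bigo T f' p" and f0: "unif_bigo T (\<lambda>n t. f n 0) p"
  shows "unif_bigo T f p"
proof -
  from f' obtain C where C: "C \<ge> 0"
    "\<forall>\<^sub>F n in sequentially. \<forall>t\<in>{-T..T}. \<bar>f' n t\<bar> \<le> C * real n powr (- p)"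
    by (rule unif_bigoE)
  have "unif_bigo T (\<lambda>n t. f n t - f n 0) p"
  proof (rule unif_bigoI[of _ _ "C * T"])
    show "\<forall>\<^sub>F n in sequentially. \<forall>t\<in>{-T..T}. \<bar>f n t - f n 0\<bar> \<le> C * T * real n powr (- p)"
      using C(2) D
    proof eventually_elim
      case (elim n)
      show ?case
      proof
        fix t assume t: "t \<in> {-T..T}"
        have "norm (f n t - f n 0) \<le> C * real n powr (- p) * norm (t - 0)"
        proof (rule field_differentiable_bound)
          show "convex {-T..T}" by simp
          fix s assume "s \<in> {-T..T}"
          show "(f n has_real_derivative f' n s) (at s within {-T..T})"
            using elim(2) has_field_derivative_at_within by blast
          show "norm (f' n s) \<le> C * real n powr (- p)"
            using elim(1) \<open>s \<in> {-T..T}\<close> by simp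
        qed (use t in auto)
        also have "\<dots> \<le> C * real n powr (- p) * T"
          using t C(1) by (intro mult_left_mono) auto
        finally show "\<bar>f n t - f n 0\<bar> \<le> C * T * real n powr (- p)" by (simp add: algebra_simps)
      qed
    qed
  qed
  from unif_bigo_add[OF this f0] show ?thesis by simp
qed

section \<open>Asymptotics of the recurrence coefficients\<close>

text \<open>
  \<open>1/4 + rec_dev\<close> is the formal solution of the difference equation for the recurrence
  coefficients, truncated after \<open>1/n^4\<close>. The coefficient of \<open>1/n^2\<close> is free in that equation; it is
  read off the case \<open>t = 0\<close>.
\<close>

definition rec_dev :: "real \<Rightarrow> nat \<Rightarrow> real \<Rightarrow> real" where
  "rec_dev \<alpha> n t = (1 - 4 * \<alpha>\<^sup>2) / 16 * (1 / real n ^ 2 + (t - 2 * \<alpha>) * (1 / real n ^ 3)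
     + (1 + 3 * (t - 2 * \<alpha>)\<^sup>2) / 4 * (1 / real n ^ 4))"

definition cubic_approx :: "real \<Rightarrow> nat \<Rightarrow> real \<Rightarrow> real" where
  "cubic_approx \<alpha> n t = (1/4 + rec_dev \<alpha> n t)
     * (1 - (1/4 + rec_dev \<alpha> (n - 1) t) - (1/4 + rec_dev \<alpha> n t) - (1/4 + rec_dev \<alpha> (Suc n) t))"

text \<open>The defect with which the truncated formal solution satisfies
  \<open>rec_coeff_difference_equation\<close>: left side minus right side.\<close>

definition rec_residual :: "real \<Rightarrow> nat \<Rightarrow> real \<Rightarrow> real" where
  "rec_residual \<alpha> n t = (2 * real n + 2 * \<alpha> + 3) * (1/4 + rec_dev \<alpha> (Suc n) t)
     - (2 * real n + 2 * \<alpha> - 1) * (1/4 + rec_dev \<alpha> n t) - 1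
     + 2 * t * (cubic_approx \<alpha> (Suc n) t - cubic_approx \<alpha> n t)"

context
  fixes \<alpha> T :: real
  assumes \<alpha>: "\<alpha> > -1"
begin

abbreviation "UO \<equiv> unif_bigo T"

lemma unif_bigo_power:
  "UO (\<lambda>n t. 1 / real n ^ 2) 2" "UO (\<lambda>n t. 1 / real n ^ 3) 3" "UO (\<lambda>n t. 1 / real n ^ 4) 4"
  by (rule unif_bigo_lift, real_asymp)+

lemma unif_bigo_affine: "UO (\<lambda>n t. 2 * real n + c) (-1)"
  by (rule unif_bigo_lift) real_asymp

lemma unif_bigo_shift: "UO (\<lambda>n t. t - c) 0"
  by (intro unif_bigo_diff unif_bigo_t unif_bigo_const) auto

lemma unif_bigo_shift2: "UO (\<lambda>n t. (1 + 3 * (t - c)\<^sup>2) / 4) 0"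
  unfolding power2_eq_square divide_inverse
  by (intro unif_bigo_mult[where p = 0 and q = 0] unif_bigo_add unif_bigo_shift unif_bigo_const) auto

section \<open>Expansion of the formal solution and of its defect\<close>

lemma rec_dev_expansion:
  "UO (\<lambda>n t. rec_dev \<alpha> n t - (1 - 4 * \<alpha>\<^sup>2) / 16 * (1 / real n ^ 2 + (t - 2 * \<alpha>) * (1 / real n ^ 3))) 4"
proof -
  have "UO (\<lambda>n t. (1 - 4 * \<alpha>\<^sup>2) / 16 * ((1 + 3 * (t - 2 * \<alpha>)\<^sup>2) / 4 * (1 / real n ^ 4))) 4"
    by (intro unif_bigo_cmult unif_bigo_mult[OF unif_bigo_shift2 unif_bigo_power(3)]) simp
  then show ?thesis by (rule unif_bigo_cong) (auto simp: rec_dev_def algebra_simps)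
qed

lemma rec_dev_expansion3: "UO (\<lambda>n t. rec_dev \<alpha> n t - (1 - 4 * \<alpha>\<^sup>2) / 16 * (1 / real n ^ 2)) 3"
proof -
  have "UO (\<lambda>n t. (1 - 4 * \<alpha>\<^sup>2) / 16 * ((t - 2 * \<alpha>) * (1 / real n ^ 3))) 3"
    by (intro unif_bigo_cmult unif_bigo_mult[OF unif_bigo_shift unif_bigo_power(2)]) simp
  moreover have "(3::real) \<le> 4" by simp
  note unif_bigo_mono[OF rec_dev_expansion this]
  ultimately have "UO (\<lambda>n t. (1 - 4 * \<alpha>\<^sup>2) / 16 * ((t - 2 * \<alpha>) * (1 / real n ^ 3)) + (rec_dev \<alpha> n t
      - (1 - 4 * \<alpha>\<^sup>2) / 16 * (1 / real n ^ 2 + (t - 2 * \<alpha>) * (1 / real n ^ 3)))) 3"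
    by (rule unif_bigo_add)
  then show ?thesis by (rule unif_bigo_cong) (auto simp: algebra_simps)
qed

lemma rec_dev_bigo: "UO (rec_dev \<alpha>) 2"
proof -
  have "UO (\<lambda>n t. (1 - 4 * \<alpha>\<^sup>2) / 16 * (1 / real n ^ 2)) 2"
    by (intro unif_bigo_cmult unif_bigo_power)
  from unif_bigo_add[OF this unif_bigo_mono[OF rec_dev_expansion3, of 2]]
  show ?thesis by simp
qed

definition dev_quad where
  "dev_quad n t = rec_dev \<alpha> n t * (rec_dev \<alpha> (n - 1) t + rec_dev \<alpha> n t + rec_dev \<alpha> (Suc n) t)"

text \<open>At the value 1/4 the first-order contributions of index n cancel, so to first order only
  the two neighbours enter.\<close>

lemma cubic_approx_eq:
  "cubic_approx \<alpha> n t = 1/16 - (rec_dev \<alpha> (n - 1) t + rec_dev \<alpha> (Suc n) t) / 4 - dev_quad n t"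
  unfolding cubic_approx_def dev_quad_def by (simp add: algebra_simps)

lemma dev_sum3_expansion:
  "UO (\<lambda>n t. rec_dev \<alpha> (n - 1) t + rec_dev \<alpha> n t + rec_dev \<alpha> (Suc n) t
     - 3 * ((1 - 4 * \<alpha>\<^sup>2) / 16 * (1 / real n ^ 2))) 3"
proof -
  let ?\<kappa> = "(1 - 4 * \<alpha>\<^sup>2) / 16"
  have "(\<lambda>n. 1 / real (Suc n) ^ 2 + 1 / (real n - 1) ^ 2 - 2 / real n ^ 2) \<in> O(\<lambda>n. real n powr (-3))"
    by real_asymp
  then have "UO (\<lambda>n t. ?\<kappa> * (1 / real (Suc n) ^ 2 + 1 / (real n - 1) ^ 2 - 2 / real n ^ 2)) 3"
    by (intro unif_bigo_cmult unif_bigo_lift)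
  from unif_bigo_add[OF this unif_bigo_add[OF rec_dev_expansion3 unif_bigo_add[OF
      unif_bigo_Suc[OF rec_dev_expansion3] unif_bigo_pred[OF rec_dev_expansion3]]]]
  show ?thesis
    by (rule unif_bigo_cong)
      (use eventually_ge_at_top[of 1] in \<open>eventually_elim, auto simp: of_nat_diff algebra_simps diff_divide_distrib\<close>)
qed

lemma dev_quad_expansion:
  "UO (\<lambda>n t. dev_quad n t - 3 * ((1 - 4 * \<alpha>\<^sup>2) / 16)\<^sup>2 * (1 / real n ^ 4)) 5"
proof -
  let ?\<kappa> = "(1 - 4 * \<alpha>\<^sup>2) / 16"
  have "UO (\<lambda>n t. (rec_dev \<alpha> n t - ?\<kappa> * (1 / real n ^ 2))
      * (rec_dev \<alpha> (n - 1) t + rec_dev \<alpha> n t + rec_dev \<alpha> (Suc n) t)) 5"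
    by (rule unif_bigo_mult[where q = 2, OF rec_dev_expansion3])
      (intro unif_bigo_add unif_bigo_pred unif_bigo_Suc rec_dev_bigo, simp)
  moreover have "UO (\<lambda>n t. (?\<kappa> * (1 / real n ^ 2)) *
      (rec_dev \<alpha> (n - 1) t + rec_dev \<alpha> n t + rec_dev \<alpha> (Suc n) t - 3 * (?\<kappa> * (1 / real n ^ 2)))) 5"
    by (rule unif_bigo_mult[OF unif_bigo_cmult[OF unif_bigo_power(1)] dev_sum3_expansion]) simp
  ultimately have "UO (\<lambda>n t. (rec_dev \<alpha> n t - ?\<kappa> * (1 / real n ^ 2))
      * (rec_dev \<alpha> (n - 1) t + rec_dev \<alpha> n t + rec_dev \<alpha> (Suc n) t) + (?\<kappa> * (1 / real n ^ 2)) *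
      (rec_dev \<alpha> (n - 1) t + rec_dev \<alpha> n t + rec_dev \<alpha> (Suc n) t - 3 * (?\<kappa> * (1 / real n ^ 2)))) 5"
    by (rule unif_bigo_add)
  then show ?thesis
  proof (rule unif_bigo_cong, intro always_eventually allI ballI)
    fix n t
    obtain \<kappa> z where g: "?\<kappa> = \<kappa>" "1 / real n ^ 2 = z" by blast
    have z: "1 / real n ^ 4 = z * z" unfolding g(2)[symmetric] by (simp add: power_add[symmetric])
    show "(rec_dev \<alpha> n t - ?\<kappa> * (1 / real n ^ 2))
      * (rec_dev \<alpha> (n - 1) t + rec_dev \<alpha> n t + rec_dev \<alpha> (Suc n) t) + (?\<kappa> * (1 / real n ^ 2)) *
      (rec_dev \<alpha> (n - 1) t + rec_dev \<alpha> n t + rec_dev \<alpha> (Suc n) t - 3 * (?\<kappa> * (1 / real n ^ 2)))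
      = dev_quad n t - 3 * ?\<kappa>\<^sup>2 * (1 / real n ^ 4)"
      unfolding dev_quad_def g z by (simp add: algebra_simps power2_eq_square)
  qed
qed

lemma dev_quad_diff: "UO (\<lambda>n t. dev_quad (Suc n) t - dev_quad n t) 5"
proof -
  have "(\<lambda>n. 1 / real (Suc n) ^ 4 - 1 / real n ^ 4) \<in> O(\<lambda>n. real n powr (-5))"
    by real_asymp
  then have "UO (\<lambda>n t. 3 * ((1 - 4 * \<alpha>\<^sup>2) / 16)\<^sup>2 * (1 / real (Suc n) ^ 4 - 1 / real n ^ 4)) 5"
    by (intro unif_bigo_cmult unif_bigo_lift)
  from unif_bigo_add[OF this unif_bigo_diff[OF unif_bigo_Suc[OF dev_quad_expansion] dev_quad_expansion]]
  show ?thesis by (rule unif_bigo_cong) (auto simp: algebra_simps)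
qed

text \<open>The equation linearised at 1/4 is applied to each power n^(-k) separately; the quadratic
  rest behaves like a multiple of n^(-4), so its increments are O(n^(-5)).\<close>

lemma rec_residual_bigo: "UO (rec_residual \<alpha>) 5"
proof -
  let ?\<kappa> = "(1 - 4 * \<alpha>\<^sup>2) / 16"
  define A where "A k n = (2 * real n + 3) / real (Suc n) ^ k - (2 * real n - 1) / real n ^ k" for k n
  define A' where "A' k n = 1 / real (Suc n) ^ k - 1 / real n ^ k" for k n
  define B where "B k n = 1 / real n ^ k + 1 / real (Suc (Suc n)) ^ k - 1 / (real n - 1) ^ k
    - 1 / real (Suc n) ^ k" for k n
  define x where "x n = 1 / real n" for n :: nat
  have A: "UO (\<lambda>n t. A 2 n - x n ^ 4) 5" "UO (\<lambda>n t. A 3 n - (3 * x n ^ 4 - 2 * x n ^ 3)) 5"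
      "UO (\<lambda>n t. A 4 n + 4 * x n ^ 4) 5"
    unfolding A_def x_def by (rule unif_bigo_lift, real_asymp)+
  have A': "UO (\<lambda>n t. A' 2 n - (3 * x n ^ 4 - 2 * x n ^ 3)) 5" "UO (\<lambda>n t. A' 3 n + 3 * x n ^ 4) 5"
      "UO (\<lambda>n t. A' 4 n) 5"
    unfolding A'_def x_def by (rule unif_bigo_lift, real_asymp)+
  have B: "UO (\<lambda>n t. B 2 n - (6 * x n ^ 4 - 4 * x n ^ 3)) 5" "UO (\<lambda>n t. B 3 n + 6 * x n ^ 4) 5"
      "UO (\<lambda>n t. B 4 n) 5"
    unfolding B_def x_def by (rule unif_bigo_lift, real_asymp)+
  \<comment> \<open>The linearised operator on n^(-k): A and A' stem from the linear factors of the
    equation, B from the neighbours in the cubic term.\<close>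
  define e where "e k n t = A k n + 2 * \<alpha> * A' k n - t * (1/2 * B k n)" for k n t
  let ?\<tau> = "\<lambda>t::real. t - 2 * \<alpha>"
  have e: "UO (\<lambda>n t. (A 2 n - x n ^ 4) + 2 * \<alpha> * (A' 2 n - (3 * x n ^ 4 - 2 * x n ^ 3))
        - t * (1/2 * (B 2 n - (6 * x n ^ 4 - 4 * x n ^ 3)))) 5"
      "UO (\<lambda>n t. (A 3 n - (3 * x n ^ 4 - 2 * x n ^ 3)) + 2 * \<alpha> * (A' 3 n + 3 * x n ^ 4)
        - t * (1/2 * (B 3 n + 6 * x n ^ 4))) 5"
      "UO (\<lambda>n t. (A 4 n + 4 * x n ^ 4) + 2 * \<alpha> * A' 4 n - t * (1/2 * B 4 n)) 5"
    by (intro unif_bigo_diff unif_bigo_add unif_bigo_cmult unif_bigo_tmult A A' B)+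
  have "UO (\<lambda>n t. ?\<kappa> * (((A 2 n - x n ^ 4) + 2 * \<alpha> * (A' 2 n - (3 * x n ^ 4 - 2 * x n ^ 3))
        - t * (1/2 * (B 2 n - (6 * x n ^ 4 - 4 * x n ^ 3))))
      + ?\<tau> t * ((A 3 n - (3 * x n ^ 4 - 2 * x n ^ 3)) + 2 * \<alpha> * (A' 3 n + 3 * x n ^ 4)
        - t * (1/2 * (B 3 n + 6 * x n ^ 4)))
      + (1 + 3 * (?\<tau> t)\<^sup>2) / 4 * ((A 4 n + 4 * x n ^ 4) + 2 * \<alpha> * A' 4 n - t * (1/2 * B 4 n)))) 5"
    by (intro unif_bigo_cmult unif_bigo_add e unif_bigo_mult[OF unif_bigo_shift e(2)]
        unif_bigo_mult[OF unif_bigo_shift2 e(3)]) simp_all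
  \<comment> \<open>With \<tau> = t - 2 \<alpha> and x = 1/n, the subtracted expansions for k = 2,
    3, 4 are x^4 - \<tau> (3 x^4 - 2 x^3), 3 x^4 - 2 x^3 + 3 \<tau> x^4 and - 4 x^4. Weighted by 1,
    \<tau> and (1 + 3 \<tau>^2) / 4 they add up to zero; this is the origin of the coefficients of
    \<open>rec_dev\<close>.\<close>
  then have L: "UO (\<lambda>n t. ?\<kappa> * (e 2 n t + ?\<tau> t * e 3 n t + (1 + 3 * (?\<tau> t)\<^sup>2) / 4 * e 4 n t)) 5"
    by (rule unif_bigo_cong) (simp add: e_def field_simps power2_eq_square)
  have "UO (\<lambda>n t. ?\<kappa> * (e 2 n t + ?\<tau> t * e 3 n t + (1 + 3 * (?\<tau> t)\<^sup>2) / 4 * e 4 n t)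
      - 2 * (t * (dev_quad (Suc n) t - dev_quad n t))) 5"
    by (intro unif_bigo_diff L unif_bigo_cmult unif_bigo_tmult dev_quad_diff)
  then show ?thesis
  proof (rule unif_bigo_cong, intro eventually_mono[OF eventually_ge_at_top[of 1]] ballI)
    fix n :: nat and t assume n: "1 \<le> n"
    define y where "y k m = 1 / real m ^ k" for k m
    have d: "rec_dev \<alpha> m t = ?\<kappa> * (y 2 m + ?\<tau> t * y 3 m + (1 + 3 * (?\<tau> t)\<^sup>2) / 4 * y 4 m)" for m
      by (simp add: rec_dev_def y_def)
    have e': "e k n t = (2 * real n + 2 * \<alpha> + 3) * y k (Suc n) - (2 * real n + 2 * \<alpha> - 1) * y k n
        - t / 2 * (y k n + y k (Suc (Suc n)) - y k (n - 1) - y k (Suc n))" for k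
      unfolding e_def A_def A'_def B_def y_def using n
      by (simp add: of_nat_diff ring_distribs add_divide_distrib diff_divide_distrib) (simp add: algebra_simps)?
    have "rec_residual \<alpha> n t = (2 * real n + 2 * \<alpha> + 3) * rec_dev \<alpha> (Suc n) t
        - (2 * real n + 2 * \<alpha> - 1) * rec_dev \<alpha> n t
        - t / 2 * (rec_dev \<alpha> n t + rec_dev \<alpha> (Suc (Suc n)) t - rec_dev \<alpha> (n - 1) t - rec_dev \<alpha> (Suc n) t)
        - 2 * (t * (dev_quad (Suc n) t - dev_quad n t))"
      unfolding rec_residual_def cubic_approx_eq by (simp add: field_simps)
    moreover obtain \<kappa> \<gamma> s where g: "?\<kappa> = \<kappa>" "(1 + 3 * (?\<tau> t)\<^sup>2) / 4 = \<gamma>" "t / 2 = s" by blast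
    ultimately show "?\<kappa> * (e 2 n t + ?\<tau> t * e 3 n t + (1 + 3 * (?\<tau> t)\<^sup>2) / 4 * e 4 n t)
      - 2 * (t * (dev_quad (Suc n) t - dev_quad n t)) = rec_residual \<alpha> n t"
      unfolding d e' g by (simp add: algebra_simps)
  qed
qed


section \<open>Bootstrap for the error of the formal solution\<close>

abbreviation "b n t \<equiv> rec_coeff (moment \<alpha> t) n"

definition rec_err where "rec_err n t = b n t - (1/4 + rec_dev \<alpha> n t)"

definition cubic_err where "cubic_err n t = rec_cubic \<alpha> t n - cubic_approx \<alpha> n t"

text \<open>The quadratic factor is the reciprocal of the homogeneous solution of the linear part:
  multiplied by it, the linear part becomes a pure difference.\<close>

definition err_invariant where
  "err_invariant n t = ((2 * real n + 2 * \<alpha>)\<^sup>2 - 1) * rec_err n t + 2 * t * (2 * real n + 2 * \<alpha> - 1) * cubic_err n t"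

text \<open>Summation by parts: the increments of this combination no longer contain differences of \<open>cubic_err\<close>.\<close>

lemma err_invariant_diff:
  assumes "n \<ge> 1"
  shows "err_invariant (Suc n) t - err_invariant n t
    = 4 * t * cubic_err n t - (2 * real n + 2 * \<alpha> + 1) * rec_residual \<alpha> n t"
proof -
  let ?s = "2 * real n + 2 * \<alpha>"
  have *: "(?s + 3) * rec_err (Suc n) t - (?s - 1) * rec_err n t
      = - 2 * t * (cubic_err (Suc n) t - cubic_err n t) - rec_residual \<alpha> n t"
    using rec_coeff_difference_equation[OF \<alpha> assms, of t]
    unfolding rec_err_def cubic_err_def rec_residual_def by (simp add: algebra_simps)
  have "err_invariant (Suc n) t - err_invariant n t
      = (?s + 1) * ((?s + 3) * rec_err (Suc n) t - (?s - 1) * rec_err n t)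
        + 2 * t * (?s + 1) * cubic_err (Suc n) t - 2 * t * (?s - 1) * cubic_err n t"
    unfolding err_invariant_def by (simp add: algebra_simps power2_eq_square)
  then show ?thesis unfolding * by (simp add: algebra_simps)
qed

lemma rec_coeff_bigo: "UO b 0"
  using rec_coeff_moment_bounds[OF \<alpha>]
  by (intro unif_bigoI[of _ _ 1] eventually_mono[OF eventually_gt_at_top[of 0]]) auto

lemma rec_err_bigo_0: "UO rec_err 0"
  unfolding rec_err_def
  by (intro unif_bigo_diff unif_bigo_add rec_coeff_bigo unif_bigo_const unif_bigo_mono[OF rec_dev_bigo]) auto

text \<open>The cubic term is Lipschitz on bounded arguments, and 0 \<le> \<open>b n t\<close> \<le>
  1 keeps them bounded, so it inherits the order of \<open>rec_err\<close>.\<close>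

lemma cubic_err_bigo:
  assumes "UO rec_err p"
  shows "UO cubic_err p"
proof -
  have "UO (\<lambda>n t. rec_err n t * (1 - b (n - 1) t - b n t - b (Suc n) t)
      - (1/4 + rec_dev \<alpha> n t) * (rec_err (n - 1) t + rec_err n t + rec_err (Suc n) t)) p"
  proof (rule unif_bigo_diff)
    show "UO (\<lambda>n t. rec_err n t * (1 - b (n - 1) t - b n t - b (Suc n) t)) p"
      by (rule unif_bigo_mult[where q = 0, OF assms])
        (intro unif_bigo_diff unif_bigo_const unif_bigo_pred[of T b] unif_bigo_Suc[of T b] rec_coeff_bigo, auto)
    show "UO (\<lambda>n t. (1/4 + rec_dev \<alpha> n t) * (rec_err (n - 1) t + rec_err n t + rec_err (Suc n) t)) p"
    proof (rule unif_bigo_mult[where p = 0 and q = p])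
      show "UO (\<lambda>n t. 1/4 + rec_dev \<alpha> n t) 0"
        by (intro unif_bigo_add unif_bigo_const unif_bigo_mono[OF rec_dev_bigo]) auto
      show "UO (\<lambda>n t. rec_err (n - 1) t + rec_err n t + rec_err (Suc n) t) p"
        by (intro unif_bigo_add assms unif_bigo_pred[of T rec_err] unif_bigo_Suc[of T rec_err])
    qed simp
  qed
  then show ?thesis
    by (rule unif_bigo_cong)
      (auto simp: cubic_err_def rec_err_def rec_cubic_def cubic_approx_def algebra_simps)
qed

text \<open>The cap q \<le> 4 is the residual of order 5 times a factor of size n.\<close>

lemma err_invariant_diff_bigo:
  assumes "UO rec_err p" "q \<le> p" "q \<le> 4"
  shows "UO (\<lambda>n t. err_invariant (Suc n) t - err_invariant n t) q"
proof -
  have "UO (\<lambda>n t. 4 * (t * cubic_err n t) - (2 * real n + (2 * \<alpha> + 1)) * rec_residual \<alpha> n t) q"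
    using assms(2,3)
    by (intro unif_bigo_diff unif_bigo_cmult unif_bigo_tmult unif_bigo_mono[OF cubic_err_bigo[OF assms(1)]]
        unif_bigo_mult[OF unif_bigo_affine rec_residual_bigo]) auto
  then show ?thesis
    by (rule unif_bigo_cong)
      (use eventually_ge_at_top[of 1] in \<open>eventually_elim, auto simp: err_invariant_diff algebra_simps\<close>)
qed

lemma cubic_part_bigo:
  assumes "UO rec_err p" "q \<le> p - 1"
  shows "UO (\<lambda>n t. 2 * (t * ((2 * real n + (2 * \<alpha> - 1)) * cubic_err n t))) q"
  using assms
  by (intro unif_bigo_cmult unif_bigo_tmult unif_bigo_mult[OF unif_bigo_affine cubic_err_bigo[OF assms(1)]]) auto

lemma unif_bigo_quadratic: "UO (\<lambda>n t. (2 * real n + 2 * \<alpha>)\<^sup>2 - 1) (-2)"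
  by (rule unif_bigo_lift) real_asymp

lemma err_invariant_bigo:
  assumes "UO rec_err p"
  shows "UO err_invariant (p - 2)"
proof -
  have "UO (\<lambda>n t. ((2 * real n + 2 * \<alpha>)\<^sup>2 - 1) * rec_err n t
      + 2 * (t * ((2 * real n + (2 * \<alpha> - 1)) * cubic_err n t))) (p - 2)"
    by (intro unif_bigo_add cubic_part_bigo[OF assms] unif_bigo_mult[OF unif_bigo_quadratic assms]) auto
  then show ?thesis by (rule unif_bigo_cong) (auto simp: err_invariant_def algebra_simps)
qed

text \<open>Dividing by the quadratic factor gains two orders. The part with
  \<open>cubic_err\<close> carries a factor of size n, hence q \<le> p - 1: one round improves the
  order by at most one.\<close>

lemma rec_err_from_invariant:
  assumes "UO rec_err p" "UO err_invariant q" "q \<le> p - 1"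
  shows "UO rec_err (q + 2)"
proof -
  have inv: "UO (\<lambda>n t. 1 / ((2 * real n + 2 * \<alpha>)\<^sup>2 - 1)) 2"
    by (rule unif_bigo_lift) real_asymp
  have "UO (\<lambda>n t. 1 / ((2 * real n + 2 * \<alpha>)\<^sup>2 - 1)
      * (err_invariant n t - 2 * (t * ((2 * real n + (2 * \<alpha> - 1)) * cubic_err n t)))) (q + 2)"
    by (intro unif_bigo_mult[where p = 2 and q = q, OF inv] unif_bigo_diff assms(2) cubic_part_bigo[OF assms(1,3)]) auto
  then show ?thesis
  proof (rule unif_bigo_cong, intro eventually_mono[OF eventually_ge_at_top[of 3]] ballI)
    fix n :: nat and t assume "3 \<le> n"
    then have "2 * real n + 2 * \<alpha> > 1" using \<alpha> by linarith
    then have "(2 * real n + 2 * \<alpha>)\<^sup>2 - 1 \<noteq> 0" by (simp add: power2_eq_1_iff)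
    moreover have "err_invariant n t - 2 * (t * ((2 * real n + (2 * \<alpha> - 1)) * cubic_err n t))
        = ((2 * real n + 2 * \<alpha>)\<^sup>2 - 1) * rec_err n t"
      unfolding err_invariant_def by (simp add: algebra_simps)
    ultimately show "1 / ((2 * real n + 2 * \<alpha>)\<^sup>2 - 1)
      * (err_invariant n t - 2 * (t * ((2 * real n + (2 * \<alpha> - 1)) * cubic_err n t))) = rec_err n t"
      by simp
  qed
qed

lemma rec_err_bigo_1: "UO rec_err 1"
proof -
  have "UO err_invariant (- 1)"
  proof (rule unif_bigo_growth[where p = 0, OF err_invariant_bigo[OF rec_err_bigo_0]])
    show "(\<lambda>n. real n powr - 0) \<in> O(\<lambda>n. real (Suc n) powr 1 - real n powr 1)"
      by real_asymp
  qed (auto intro: err_invariant_diff_bigo[OF rec_err_bigo_0])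
  from rec_err_from_invariant[OF rec_err_bigo_0 this] show ?thesis by simp
qed

text \<open>Increments O(1/n) sum to a logarithm, which is traded for n^(1/2) to stay within powers.
  From here on the increments are summable and the unknown limit of \<open>err_invariant\<close>
  becomes the obstacle.\<close>

lemma rec_err_bigo_32: "UO rec_err (3/2)"
proof -
  have "UO err_invariant (- (1/2))"
  proof (rule unif_bigo_growth[where p = 1, OF err_invariant_bigo[OF rec_err_bigo_1]])
    show "(\<lambda>n. real n powr - 1) \<in> O(\<lambda>n. real (Suc n) powr (1/2) - real n powr (1/2))"
      by real_asymp
  qed (auto intro: err_invariant_diff_bigo[OF rec_err_bigo_1])
  from rec_err_from_invariant[OF rec_err_bigo_1 this] show ?thesis by simp
qed

text \<open>An order above 2 forces \<open>err_invariant\<close> to tend to 0, so it is bounded by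
  the tail sum of its increments. This becomes available only once the coefficient of 1/n^2 is
  confirmed.\<close>

lemma rec_err_step:
  assumes "UO rec_err p" "p \<ge> 5/2" "q \<le> p - 1" "q \<le> 3" "q > 0"
  shows "UO rec_err (q + 2)"
proof (rule rec_err_from_invariant[OF assms(1) _ assms(3)])
  show "UO err_invariant q"
  proof (rule unif_bigo_tail)
    show "UO (\<lambda>n t. err_invariant (Suc n) t - err_invariant n t) (q + 1)"
      using assms by (intro err_invariant_diff_bigo[OF assms(1)]) auto
    show "(\<lambda>n. err_invariant n t) \<longlonglongrightarrow> 0" if "t \<in> {-T..T}" for t
      using that assms(2) by (intro unif_bigo_tendsto[OF err_invariant_bigo[OF assms(1)]]) auto
  qed fact
qed

text \<open>
  The limit of \<open>err_invariant\<close> does not depend on \<open>t\<close>: by the Toda equation the derivative of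
  \<open>b n\<close> is of smaller order than \<open>1/n^2\<close>.
\<close>

lemma rec_err_bigo_52: "UO rec_err (5/2)"
proof -
  define e where "e n t = ((2 * real n + 2 * \<alpha>)\<^sup>2 - 1) * rec_err n t" for n t
  define w where "w n = 1 / ((2 * real n + 2 * \<alpha>)\<^sup>2 - 1)" for n :: nat
  have e0: "UO e (-1/2)"
    unfolding e_def by (intro unif_bigo_mult[OF unif_bigo_quadratic rec_err_bigo_32]) simp
  \<comment> \<open>\<open>e\<close> may grow like n^(1/2), but its increments are O(n^(-1/2)).
    After division by the quadratic factor the increments of \<open>rec_err\<close> are therefore
    O(n^(-5/2)), a full order better than the bound on \<open>rec_err\<close> itself.\<close>
  have "UO (\<lambda>n t. (err_invariant (Suc n) t - err_invariant n t)
      - 2 * (t * ((2 * real (Suc n) + (2 * \<alpha> - 1)) * cubic_err (Suc n) t))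
      + 2 * (t * ((2 * real n + (2 * \<alpha> - 1)) * cubic_err n t))) (1/2)"
    by (intro unif_bigo_add unif_bigo_diff err_invariant_diff_bigo[OF rec_err_bigo_32]
        unif_bigo_Suc[OF cubic_part_bigo[OF rec_err_bigo_32]] cubic_part_bigo[OF rec_err_bigo_32]) auto
  then have e1: "UO (\<lambda>n t. e (Suc n) t - e n t) (1/2)"
    by (rule unif_bigo_cong) (auto simp: e_def err_invariant_def algebra_simps)
  have w: "UO (\<lambda>n t. w n) 2" "UO (\<lambda>n t. w (Suc n) - w n) 3"
    unfolding w_def by (rule unif_bigo_lift, real_asymp)+
  have "UO (\<lambda>n t. w (Suc n) * (e (Suc n) t - e n t) + (w (Suc n) - w n) * e n t) (5/2)"
    by (intro unif_bigo_add unif_bigo_mult[OF unif_bigo_Suc[OF w(1)] e1] unif_bigo_mult[OF w(2) e0]) auto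
  then have d: "UO (\<lambda>n t. rec_err (Suc n) t - rec_err n t) (5/2)"
  proof (rule unif_bigo_cong, intro eventually_mono[OF eventually_ge_at_top[of 3]] ballI)
    fix n :: nat and t assume n: "3 \<le> n"
    have we: "w m * e m t = rec_err m t" if "m \<ge> 3" for m
    proof -
      have "2 * real m + 2 * \<alpha> > 1" using \<alpha> that by linarith
      then have "(2 * real m + 2 * \<alpha>)\<^sup>2 - 1 \<noteq> 0" by (simp add: power2_eq_1_iff)
      then show ?thesis unfolding w_def e_def by simp
    qed
    show "w (Suc n) * (e (Suc n) t - e n t) + (w (Suc n) - w n) * e n t = rec_err (Suc n) t - rec_err n t"
      using we[of n] we[of "Suc n"] n by (simp add: algebra_simps)
  qed
  have "(\<lambda>n. 1 / real (Suc n) ^ 2 - 1 / real n ^ 2) \<in> O(\<lambda>n. real n powr (-3))" by real_asymp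
  then have "UO (\<lambda>n t. (1 - 4 * \<alpha>\<^sup>2) / 16 * (1 / real (Suc n) ^ 2 - 1 / real n ^ 2)) 3"
    by (intro unif_bigo_cmult unif_bigo_lift)
  from unif_bigo_add[OF this unif_bigo_diff[OF unif_bigo_Suc[OF rec_dev_expansion3] rec_dev_expansion3]]
  have "UO (\<lambda>n t. rec_dev \<alpha> (Suc n) t - rec_dev \<alpha> n t) 3"
  proof (rule unif_bigo_cong, intro always_eventually allI ballI)
    fix n t
    have aux: "\<kappa> * (y - z) + (r - \<kappa> * y - (s - \<kappa> * z)) = r - s" for \<kappa> y z r s :: real
      by (simp add: algebra_simps)
    show "(1 - 4 * \<alpha>\<^sup>2) / 16 * (1 / real (Suc n) ^ 2 - 1 / real n ^ 2)
        + (rec_dev \<alpha> (Suc n) t - (1 - 4 * \<alpha>\<^sup>2) / 16 * (1 / real (Suc n) ^ 2)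
          - (rec_dev \<alpha> n t - (1 - 4 * \<alpha>\<^sup>2) / 16 * (1 / real n ^ 2)))
        = rec_dev \<alpha> (Suc n) t - rec_dev \<alpha> n t"
      by (rule aux)
  qed
  from unif_bigo_add[OF d unif_bigo_mono[OF this]]
  have bd: "UO (\<lambda>n t. b (Suc n) t - b n t) (5/2)"
    by (simp add: rec_err_def)
  from unif_bigo_pred[OF this] have "UO (\<lambda>n t. b (Suc (n - 1)) t - b (n - 1) t) (5/2)" .
  from unif_bigo_add[OF bd this]
  have "UO (\<lambda>n t. b (n - 1) t - b (Suc n) t) (5/2)"
    by (rule unif_bigo_cong[OF unif_bigo_minus])
      (auto intro!: eventually_mono[OF eventually_ge_at_top[of 1]])
  then have D: "UO (\<lambda>n t. b n t * (b (n - 1) t - b (Suc n) t)) (5/2)"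
    by (intro unif_bigo_mult[OF rec_coeff_bigo]) auto
  let ?k = "(1 - 4 * \<alpha>\<^sup>2) / 16"
  have n1: "UO (\<lambda>n t. real n) (-1)" and w: "UO (\<lambda>n t. w n) 2"
    unfolding w_def by (rule unif_bigo_lift, real_asymp)+
  \<comment> \<open>Starting value for the integration in t: at t = 0 the coefficient equals 1/4 +
    (1 - 4 \<alpha>^2) / (4 ((2n + 2\<alpha>)^2 - 1)), and the function bounded here is what remains
    after removing 1/4 and the 1/n^2 term.\<close>
  have "UO (\<lambda>n t. ?k * ((1 - 4 * \<alpha>\<^sup>2 - 8 * \<alpha> * real n) * (1 / real n ^ 2 * w n))) (5/2)"
    by (intro unif_bigo_cmult unif_bigo_mult[where p = "-1" and q = 4] unif_bigo_mult[OF unif_bigo_power(1) w]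
        unif_bigo_diff unif_bigo_const n1) auto
  then have "UO (\<lambda>n t. b n 0 - 1/4 - ?k * (1 / real n ^ 2)) (5/2)"
  proof (rule unif_bigo_cong, intro eventually_mono[OF eventually_ge_at_top[of 3]] ballI)
    fix n :: nat assume n: "3 \<le> n"
    define D where "D = (2 * real n + 2 * \<alpha>)\<^sup>2 - 1"
    have D: "D = (2 * real n + 2 * \<alpha> + 1) * (2 * real n + 2 * \<alpha> - 1)"
      unfolding D_def by (simp add: power2_eq_square algebra_simps)
    have "D \<noteq> 0" unfolding D using \<alpha> n by auto
    then have "b n 0 = real n * (real n + 2 * \<alpha>) / D"
      using rec_coeff_0_eq[OF \<alpha>, of n] n by (simp add: eq_divide_eq D)
    moreover have "4 * (real n * (real n + 2 * \<alpha>)) = D + (1 - 4 * \<alpha>\<^sup>2)"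
      unfolding D_def by (simp add: power2_eq_square algebra_simps)
    ultimately have "4 * b n 0 = 1 + (1 - 4 * \<alpha>\<^sup>2) / D"
      using \<open>D \<noteq> 0\<close> by (simp add: add_divide_distrib)
    moreover have "(1 - 4 * \<alpha>\<^sup>2 - 8 * \<alpha> * real n) = 4 * real n ^ 2 - D"
      unfolding D_def by (simp add: power2_eq_square algebra_simps)
    then have "(1 - 4 * \<alpha>\<^sup>2 - 8 * \<alpha> * real n) * (1 / real n ^ 2 * w n) = 4 / D - 1 / real n ^ 2"
      using \<open>D \<noteq> 0\<close> n unfolding w_def D_def[symmetric] by (simp add: field_simps)
    ultimately show "?k * ((1 - 4 * \<alpha>\<^sup>2 - 8 * \<alpha> * real n) * (1 / real n ^ 2 * w n))
        = b n 0 - 1/4 - ?k * (1 / real n ^ 2)"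
    proof -
      assume *: "4 * b n 0 = 1 + (1 - 4 * \<alpha>\<^sup>2) / D"
        "(1 - 4 * \<alpha>\<^sup>2 - 8 * \<alpha> * real n) * (1 / real n ^ 2 * w n) = 4 / D - 1 / real n ^ 2"
      have "?k * (4 / D) = (1 - 4 * \<alpha>\<^sup>2) / D / 4" using \<open>D \<noteq> 0\<close> by (simp add: field_simps)
      moreover have "4 * x = 1 + y \<Longrightarrow> x = 1/4 + y / 4" for x y :: real by simp
      from this[OF *(1)] have "b n 0 = 1/4 + (1 - 4 * \<alpha>\<^sup>2) / D / 4" .
      ultimately show ?thesis unfolding *(2) right_diff_distrib by simp
    qed
  qed
  with D have "UO (\<lambda>n t. b n t - 1/4 - ?k * (1 / real n ^ 2)) (5/2)"
  proof (rule unif_bigo_integrate[rotated])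
    show "\<forall>\<^sub>F n in sequentially. \<forall>t. ((\<lambda>t. b n t - 1/4 - ?k * (1 / real n ^ 2))
        has_real_derivative b n t * (b (n - 1) t - b (Suc n) t)) (at t)"
    proof (intro eventually_mono[OF eventually_ge_at_top[of 1]] allI)
      fix n :: nat and t assume "1 \<le> n"
      from DERIV_diff[OF DERIV_diff[OF has_real_derivative_rec_coeff_moment[OF \<alpha> this] DERIV_const] DERIV_const]
      show "((\<lambda>t. b n t - 1/4 - ?k * (1 / real n ^ 2))
        has_real_derivative b n t * (b (n - 1) t - b (Suc n) t)) (at t)"
        unfolding diff_0_right .
    qed
  qed
  from unif_bigo_diff[OF this unif_bigo_mono[OF rec_dev_expansion3]]
  show ?thesis unfolding rec_err_def[abs_def] by (simp add: algebra_simps)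
qed

text \<open>The order rises by one to 7/2 and to 9/2; the last round is limited to 5 by the
  residual.\<close>

lemma rec_err_bigo_5: "UO rec_err 5"
proof -
  have "UO rec_err (7/2)" using rec_err_step[OF rec_err_bigo_52, of "3/2"] by simp
  from rec_err_step[OF this, of "5/2"] have "UO rec_err (9/2)" by simp
  from rec_err_step[OF this, of 3] show ?thesis by simp
qed


section \<open>Logarithmic derivative of the determinant and its integration\<close>

lemma dev_pair_expansion:
  "UO (\<lambda>n t. rec_dev \<alpha> (n - 1) t + rec_dev \<alpha> (Suc n) t
     - 2 * ((1 - 4 * \<alpha>\<^sup>2) / 16 * (1 / real n ^ 2 + (t - 2 * \<alpha>) * (1 / real n ^ 3)))) 4"
proof -
  let ?\<kappa> = "(1 - 4 * \<alpha>\<^sup>2) / 16"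
  have a: "UO (\<lambda>n t. 1 / real (Suc n) ^ 2 + 1 / (real n - 1) ^ 2 - 2 / real n ^ 2) 4"
    "UO (\<lambda>n t. 1 / real (Suc n) ^ 3 + 1 / (real n - 1) ^ 3 - 2 / real n ^ 3) 4"
    by (rule unif_bigo_lift, real_asymp)+
  have "UO (\<lambda>n t. ?\<kappa> * ((1 / real (Suc n) ^ 2 + 1 / (real n - 1) ^ 2 - 2 / real n ^ 2)
      + (t - 2 * \<alpha>) * (1 / real (Suc n) ^ 3 + 1 / (real n - 1) ^ 3 - 2 / real n ^ 3))) 4"
    by (intro unif_bigo_cmult unif_bigo_add a unif_bigo_mult[OF unif_bigo_shift a(2)]) simp
  from unif_bigo_add[OF this unif_bigo_add[OF unif_bigo_Suc[OF rec_dev_expansion] unif_bigo_pred[OF rec_dev_expansion]]]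
  show ?thesis
  proof (rule unif_bigo_cong, intro eventually_mono[OF eventually_ge_at_top[of 1]] ballI)
    fix n :: nat and t assume "1 \<le> n"
    then have n: "real (n - 1) = real n - 1" by simp
    have aux: "\<kappa> * ((y2 + z2 - 2 / x2) + s * (y3 + z3 - 2 / x3))
        + (r - \<kappa> * (y2 + s * y3) + (r' - \<kappa> * (z2 + s * z3)))
        = r' + r - 2 * (\<kappa> * (1 / x2 + s * (1 / x3)))" for \<kappa> x2 x3 y2 y3 z2 z3 r r' s :: real
      by (simp add: algebra_simps)
    show "?\<kappa> * ((1 / real (Suc n) ^ 2 + 1 / (real n - 1) ^ 2 - 2 / real n ^ 2)
      + (t - 2 * \<alpha>) * (1 / real (Suc n) ^ 3 + 1 / (real n - 1) ^ 3 - 2 / real n ^ 3))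
      + (rec_dev \<alpha> (Suc n) t - ?\<kappa> * (1 / real (Suc n) ^ 2 + (t - 2 * \<alpha>) * (1 / real (Suc n) ^ 3))
      + (rec_dev \<alpha> (n - 1) t - ?\<kappa> * (1 / real (n - 1) ^ 2 + (t - 2 * \<alpha>) * (1 / real (n - 1) ^ 3))))
      = rec_dev \<alpha> (n - 1) t + rec_dev \<alpha> (Suc n) t
        - 2 * (?\<kappa> * (1 / real n ^ 2 + (t - 2 * \<alpha>) * (1 / real n ^ 3)))"
      unfolding n by (rule aux)
  qed
qed

lemma dev_quad_bigo: "UO dev_quad 4"
  unfolding dev_quad_def
  by (rule unif_bigo_mult[where p = 2 and q = 2, OF rec_dev_bigo])
    (intro unif_bigo_add rec_dev_bigo unif_bigo_pred[OF rec_dev_bigo] unif_bigo_Suc[OF rec_dev_bigo], simp)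

text \<open>The factor 2n + 2\<alpha> costs one order, so \<open>rec_err_bigo_5\<close> yields order
  4. The subtracted expression is the t-derivative of the exponent claimed for the ratio.\<close>

lemma log_derivative_bigo:
  "UO (\<lambda>n t. - real n + (2 * real n + 2 * \<alpha>) * b n t + 2 * t * rec_cubic \<alpha> t n
    - (- (real n / 2) + (2 * t + 8 * \<alpha>) / 16 + (1 - 4 * \<alpha>\<^sup>2) / (8 * real n)
       + (1 - 4 * \<alpha>\<^sup>2) * (2 * t - 4 * \<alpha>) / (32 * real n ^ 2)
       + (1 - 4 * \<alpha>\<^sup>2) * (3 * t\<^sup>2 - 12 * \<alpha> * t + 12 * \<alpha>\<^sup>2 + 3) / (96 * real n ^ 3))) 4"
proof -
  let ?\<kappa> = "(1 - 4 * \<alpha>\<^sup>2) / 16" and ?\<tau> = "\<lambda>t. t - 2 * \<alpha>"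
  have "UO (\<lambda>n t. (2 * real n + 2 * \<alpha>) * rec_err n t + 2 * (t * cubic_err n t) - 2 * (t * dev_quad n t)
      - 1/2 * (t * (rec_dev \<alpha> (n - 1) t + rec_dev \<alpha> (Suc n) t
         - 2 * (?\<kappa> * (1 / real n ^ 2 + ?\<tau> t * (1 / real n ^ 3)))))
      + 2 * \<alpha> * ?\<kappa> * ((1 + 3 * (?\<tau> t)\<^sup>2) / 4 * (1 / real n ^ 4))) 4"
    by (intro unif_bigo_add unif_bigo_diff unif_bigo_cmult unif_bigo_tmult dev_quad_bigo dev_pair_expansion
        unif_bigo_mult[OF unif_bigo_affine rec_err_bigo_5] unif_bigo_mono[OF cubic_err_bigo[OF rec_err_bigo_5]]
        unif_bigo_mult[OF unif_bigo_shift2 unif_bigo_power(3)]) auto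
  then show ?thesis
  proof (rule unif_bigo_cong, intro eventually_mono[OF eventually_ge_at_top[of 1]] ballI)
    fix n :: nat and t assume n: "1 \<le> n"
    obtain x where x: "x = 1 / real n" by blast
    have nx: "real n * x = 1" using n x by simp
    have x': "1 / real n ^ 2 = x ^ 2" "1 / real n ^ 3 = x ^ 3" "1 / real n ^ 4 = x ^ 4"
      by (simp_all add: x power_divide)
    have c: "c / (8 * real n) = c / 8 * x" "c / (32 * real n ^ 2) = c / 32 * x ^ 2"
      "c / (96 * real n ^ 3) = c / 96 * x ^ 3" for c :: real
      by (simp_all add: x power_divide)
    have b: "b n t = 1/4 + ?\<kappa> * (x\<^sup>2 + ?\<tau> t * x ^ 3 + (1 + 3 * (?\<tau> t)\<^sup>2) / 4 * x ^ 4) + rec_err n t"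
      by (simp add: rec_err_def rec_dev_def x')
    have "rec_cubic \<alpha> t n = 1/16 - (rec_dev \<alpha> (n - 1) t + rec_dev \<alpha> (Suc n) t) / 4 - dev_quad n t + cubic_err n t"
      by (simp add: cubic_err_def cubic_approx_eq)
    moreover obtain d where "d = rec_dev \<alpha> (n - 1) t + rec_dev \<alpha> (Suc n) t" by blast
    ultimately have g: "rec_cubic \<alpha> t n = 1/16 - d / 4 - dev_quad n t + cubic_err n t"
      "rec_dev \<alpha> (n - 1) t + rec_dev \<alpha> (Suc n) t = d" by simp_all
    have n2: "real n * x ^ 2 = x" "real n * x ^ 3 = x ^ 2" "real n * x ^ 4 = x ^ 3"
      using nx by (simp_all add: power2_eq_square power3_eq_cube power4_eq_xxxx mult.assoc[symmetric])
    have aux: "(2 * N + 2 * a) * (\<kappa> * (x2 + s * x3 + \<gamma> * x4))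
        = \<kappa> * (2 * (N * x2) + 2 * s * (N * x3) + 2 * \<gamma> * (N * x4) + 2 * a * (x2 + s * x3 + \<gamma> * x4))"
      for N a \<kappa> x2 x3 x4 s \<gamma> :: real
      by (simp add: algebra_simps)
    have "(2 * real n + 2 * \<alpha>) * (?\<kappa> * (x\<^sup>2 + ?\<tau> t * x ^ 3 + (1 + 3 * (?\<tau> t)\<^sup>2) / 4 * x ^ 4))
        = ?\<kappa> * (2 * x + 2 * ?\<tau> t * x\<^sup>2 + 2 * ((1 + 3 * (?\<tau> t)\<^sup>2) / 4) * x ^ 3
          + 2 * \<alpha> * (x\<^sup>2 + ?\<tau> t * x ^ 3 + (1 + 3 * (?\<tau> t)\<^sup>2) / 4 * x ^ 4))"
      unfolding aux n2 ..
    then have B: "(2 * real n + 2 * \<alpha>) * b n t = real n / 2 + \<alpha> / 2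
        + ?\<kappa> * (2 * x + 2 * ?\<tau> t * x\<^sup>2 + 2 * ((1 + 3 * (?\<tau> t)\<^sup>2) / 4) * x ^ 3
          + 2 * \<alpha> * (x\<^sup>2 + ?\<tau> t * x ^ 3 + (1 + 3 * (?\<tau> t)\<^sup>2) / 4 * x ^ 4))
        + (2 * real n + 2 * \<alpha>) * rec_err n t"
      unfolding b by (simp only: distrib_left[of "2 * real n + 2 * \<alpha>"]) simp
    show "(2 * real n + 2 * \<alpha>) * rec_err n t + 2 * (t * cubic_err n t) - 2 * (t * dev_quad n t)
      - 1/2 * (t * (rec_dev \<alpha> (n - 1) t + rec_dev \<alpha> (Suc n) t
         - 2 * (?\<kappa> * (1 / real n ^ 2 + ?\<tau> t * (1 / real n ^ 3)))))
      + 2 * \<alpha> * ?\<kappa> * ((1 + 3 * (?\<tau> t)\<^sup>2) / 4 * (1 / real n ^ 4))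
      = - real n + (2 * real n + 2 * \<alpha>) * b n t + 2 * t * rec_cubic \<alpha> t n
        - (- (real n / 2) + (2 * t + 8 * \<alpha>) / 16 + (1 - 4 * \<alpha>\<^sup>2) / (8 * real n)
       + (1 - 4 * \<alpha>\<^sup>2) * (2 * t - 4 * \<alpha>) / (32 * real n ^ 2)
       + (1 - 4 * \<alpha>\<^sup>2) * (3 * t\<^sup>2 - 12 * \<alpha> * t + 12 * \<alpha>\<^sup>2 + 3) / (96 * real n ^ 3))"
      unfolding B g x' c by (simp add: field_simps power2_eq_square)
  qed
qed

lemma ln_hankel_ratio_bigo:
  "UO (\<lambda>n t. ln (hankel_det \<alpha> n t) - ln (hankel_det \<alpha> n 0)
    - (- (real n * t / 2) + t * (t + 8 * \<alpha>) / 16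
       + t * (1 - 4 * \<alpha>\<^sup>2) / (8 * real n)
       + t * (1 - 4 * \<alpha>\<^sup>2) * (t - 4 * \<alpha>) / (32 * real n ^ 2)
       + t * (1 - 4 * \<alpha>\<^sup>2) * (t\<^sup>2 - 6 * \<alpha> * t + 12 * \<alpha>\<^sup>2 + 3) / (96 * real n ^ 3))) 4"
proof (rule unif_bigo_integrate[OF _ log_derivative_bigo])
  show "UO (\<lambda>n t. ln (hankel_det \<alpha> n 0) - ln (hankel_det \<alpha> n 0)
    - (- (real n * 0 / 2) + 0 * (0 + 8 * \<alpha>) / 16
       + 0 * (1 - 4 * \<alpha>\<^sup>2) / (8 * real n)
       + 0 * (1 - 4 * \<alpha>\<^sup>2) * (0 - 4 * \<alpha>) / (32 * real n ^ 2)
       + 0 * (1 - 4 * \<alpha>\<^sup>2) * (0\<^sup>2 - 6 * \<alpha> * 0 + 12 * \<alpha>\<^sup>2 + 3) / (96 * real n ^ 3))) 4"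
    by (intro unif_bigoI[of _ _ 0]) simp
next
  have aux: "((\<lambda>t. - (N * t / 2) + t * (t + 8 * a) / 16 + t * k * A + t * k * (t - 4 * a) * B
        + t * k * (t\<^sup>2 - 6 * a * t + 12 * a\<^sup>2 + 3) * C) has_real_derivative
      - (N / 2) + (2 * t + 8 * a) / 16 + k * A + k * (2 * t - 4 * a) * B
        + k * (3 * t\<^sup>2 - 12 * a * t + 12 * a\<^sup>2 + 3) * C) (at t)" for N a k A B C t :: real
    by (auto intro!: derivative_eq_intros simp: field_simps power2_eq_square)
  show "\<forall>\<^sub>F n in sequentially. \<forall>t. ((\<lambda>t. ln (hankel_det \<alpha> n t) - ln (hankel_det \<alpha> n 0)
    - (- (real n * t / 2) + t * (t + 8 * \<alpha>) / 16
       + t * (1 - 4 * \<alpha>\<^sup>2) / (8 * real n)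
       + t * (1 - 4 * \<alpha>\<^sup>2) * (t - 4 * \<alpha>) / (32 * real n ^ 2)
       + t * (1 - 4 * \<alpha>\<^sup>2) * (t\<^sup>2 - 6 * \<alpha> * t + 12 * \<alpha>\<^sup>2 + 3) / (96 * real n ^ 3))) has_real_derivative
    - real n + (2 * real n + 2 * \<alpha>) * b n t + 2 * t * rec_cubic \<alpha> t n
    - (- (real n / 2) + (2 * t + 8 * \<alpha>) / 16 + (1 - 4 * \<alpha>\<^sup>2) / (8 * real n)
       + (1 - 4 * \<alpha>\<^sup>2) * (2 * t - 4 * \<alpha>) / (32 * real n ^ 2)
       + (1 - 4 * \<alpha>\<^sup>2) * (3 * t\<^sup>2 - 12 * \<alpha> * t + 12 * \<alpha>\<^sup>2 + 3) / (96 * real n ^ 3))) (at t)"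
  proof (intro eventually_mono[OF eventually_ge_at_top[of 1]] allI)
    fix n :: nat and t assume "1 \<le> n"
    from DERIV_diff[OF DERIV_diff[OF has_real_derivative_ln_hankel_det[OF \<alpha> this, of t] DERIV_const]
        aux[of "real n" \<alpha> "1 - 4 * \<alpha>\<^sup>2" "inverse (8 * real n)" "inverse (32 * real n ^ 2)" "inverse (96 * real n ^ 3)"],
        of "ln (hankel_det \<alpha> n 0)"]
    show "((\<lambda>t. ln (hankel_det \<alpha> n t) - ln (hankel_det \<alpha> n 0)
    - (- (real n * t / 2) + t * (t + 8 * \<alpha>) / 16
       + t * (1 - 4 * \<alpha>\<^sup>2) / (8 * real n)
       + t * (1 - 4 * \<alpha>\<^sup>2) * (t - 4 * \<alpha>) / (32 * real n ^ 2)
       + t * (1 - 4 * \<alpha>\<^sup>2) * (t\<^sup>2 - 6 * \<alpha> * t + 12 * \<alpha>\<^sup>2 + 3) / (96 * real n ^ 3))) has_real_derivative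
    - real n + (2 * real n + 2 * \<alpha>) * b n t + 2 * t * rec_cubic \<alpha> t n
    - (- (real n / 2) + (2 * t + 8 * \<alpha>) / 16 + (1 - 4 * \<alpha>\<^sup>2) / (8 * real n)
       + (1 - 4 * \<alpha>\<^sup>2) * (2 * t - 4 * \<alpha>) / (32 * real n ^ 2)
       + (1 - 4 * \<alpha>\<^sup>2) * (3 * t\<^sup>2 - 12 * \<alpha> * t + 12 * \<alpha>\<^sup>2 + 3) / (96 * real n ^ 3))) (at t)"
      by (simp only: divide_inverse diff_0_right)
  qed
qed

end

section \<open>Limits of sums of logarithms\<close>

lemma unif_bigo_imp_bigo:
  assumes "unif_bigo T f p" "t \<in> {-T..T}"
  shows "(\<lambda>n. f n t) \<in> O(\<lambda>n. real n powr (- p))"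
proof -
  from assms(1) obtain C where
    "\<forall>\<^sub>F n in sequentially. \<forall>t\<in>{-T..T}. \<bar>f n t\<bar> \<le> C * real n powr (- p)"
    unfolding unif_bigo_def by blast
  then show ?thesis
    by (intro bigoI[of _ C]) (use assms(2) in \<open>auto elim!: eventually_mono\<close>)
qed

text \<open>Summable increments make f converge, so its limit may be identified along even indices,
  where the sums split by parity are available.\<close>

lemma bigo_tail_subseq:
  fixes f :: "nat \<Rightarrow> real"
  assumes D: "(\<lambda>n. f (Suc n) - f n) \<in> O(\<lambda>n. real n powr (- (q + 1)))" and "q > 0"
    and lim: "(\<lambda>n. f (2 * n)) \<longlonglongrightarrow> 0"
  shows "f \<longlonglongrightarrow> 0" "f \<in> O(\<lambda>n. real n powr (- q))"
proof -
  have "summable (\<lambda>n. norm (real n powr (- (q + 1))))"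
    using \<open>q > 0\<close> by (simp add: summable_real_powr_iff)
  then have "summable (\<lambda>n. f (Suc n) - f n)" using D by (rule summable_comparison_test_bigo)
  then have "convergent (\<lambda>n. f n - f 0)"
    unfolding summable_iff_convergent sum_lessThan_telescope .
  then have "convergent (\<lambda>n. (f n - f 0) + f 0)" by (rule convergent_add) (rule convergent_const)
  then obtain L where L: "f \<longlonglongrightarrow> L" by (auto simp: convergent_def)
  have "strict_mono (\<lambda>n::nat. 2 * n)" by (simp add: strict_mono_def)
  from LIMSEQ_subseq_LIMSEQ[OF L this] have "(\<lambda>n. f (2 * n)) \<longlonglongrightarrow> L"
    by (simp add: o_def)
  then have "L = 0" using lim by (rule LIMSEQ_unique)
  with L show *: "f \<longlonglongrightarrow> 0" by simp
  have "unif_bigo 0 (\<lambda>n t. f n) q"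
    by (rule unif_bigo_tail[OF unif_bigo_lift[OF D] \<open>q > 0\<close> *])
  from unif_bigo_imp_bigo[OF this, of 0] show "f \<in> O(\<lambda>n. real n powr (- q))" by simp
qed

lemma ln_one_plus_bigo:
  fixes c :: real
  shows "(\<lambda>n. ln (1 + c / real n) - c / real n) \<in> O(\<lambda>n. real n powr (-2))"
    and "(\<lambda>n. ln (1 + c / real n) - (c / real n - (c / real n)^2 / 2)) \<in> O(\<lambda>n. real n powr (-3))"
    and "(\<lambda>n. ln (1 + c / real n) - (c / real n - (c / real n)^2 / 2 + (c / real n)^3 / 3
      - (c / real n)^4 / 4 + (c / real n)^5 / 5)) \<in> O(\<lambda>n. real n powr (-6))"
proof -
  have *: "(\<lambda>n. g (c / real n)) \<in> O(\<lambda>n. real n powr (- real k))"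
    if "g 0 = 0" "g \<in> O[at 0](\<lambda>y. y ^ k)" for g :: "real \<Rightarrow> real" and k
  \<comment> \<open>The filter at 0 excludes 0 itself, so composing with c / n needs c nonzero; for
    c = 0 the claim is g 0 = 0.\<close>
  proof (cases "c = 0")
    case False
    have "filterlim (\<lambda>n. c / real n) (at 0) sequentially"
    proof (rule filterlim_atI)
      show "(\<lambda>n. c / real n) \<longlonglongrightarrow> 0" by real_asymp
      show "\<forall>\<^sub>F n in sequentially. c / real n \<noteq> 0"
        using eventually_gt_at_top[of 0] by eventually_elim (use False in auto)
    qed
    from landau_o.big.compose[OF that(2) this]
    have "(\<lambda>n. g (c / real n)) \<in> O(\<lambda>n. (c / real n) ^ k)" .
    also have "(\<lambda>n. (c / real n) ^ k) \<in> O(\<lambda>n. real n powr (- real k))"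
    proof (rule bigoI[of _ "\<bar>c\<bar> ^ k"], rule eventually_mono[OF eventually_gt_at_top[of 0]])
      fix n :: nat assume "0 < n"
      have "norm ((c / real n) ^ k) = (\<bar>c\<bar> / real n) ^ k"
        unfolding real_norm_def power_abs abs_divide by simp
      also have "\<dots> = \<bar>c\<bar> ^ k * (1 / real n ^ k)"
        by (simp add: power_divide)
      also have "1 / real n ^ k = norm (real n powr (- real k))"
        using \<open>0 < n\<close> by (simp add: powr_minus_divide powr_realpow)
      finally show "norm ((c / real n) ^ k) \<le> \<bar>c\<bar> ^ k * norm (real n powr (- real k))"
        by simp
    qed
    finally show ?thesis .
  qed (simp add: that(1))
  have "(\<lambda>y::real. ln (1 + y) - y) \<in> O[at 0](\<lambda>y. y ^ 2)" by real_asymp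
  from *[OF _ this] show "(\<lambda>n. ln (1 + c / real n) - c / real n) \<in> O(\<lambda>n. real n powr (-2))" by simp
  have "(\<lambda>y::real. ln (1 + y) - (y - y^2 / 2)) \<in> O[at 0](\<lambda>y. y ^ 3)" by real_asymp
  from *[OF _ this] show "(\<lambda>n. ln (1 + c / real n) - (c / real n - (c / real n)^2 / 2)) \<in> O(\<lambda>n. real n powr (-3))"
    by simp
  have "(\<lambda>y::real. ln (1 + y) - (y - y^2 / 2 + y^3 / 3 - y^4 / 4 + y^5 / 5)) \<in> O[at 0](\<lambda>y. y ^ 6)" by real_asymp
  from *[OF _ this] show "(\<lambda>n. ln (1 + c / real n) - (c / real n - (c / real n)^2 / 2 + (c / real n)^3 / 3
      - (c / real n)^4 / 4 + (c / real n)^5 / 5)) \<in> O(\<lambda>n. real n powr (-6))"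
    by simp
qed

lemma harm_ln_LIMSEQ: "(\<lambda>n. (\<Sum>j=1..n. 1 / real j) - ln (real n)) \<longlonglongrightarrow> euler_mascheroni"
  using euler_mascheroni_LIMSEQ by (simp add: harm_def inverse_eq_divide)

lemma filterlim_mult_2_nat: "filterlim (\<lambda>n::nat. 2 * n) at_top at_top"
  by (rule filterlim_at_top_mono[OF filterlim_ident]) (auto intro: always_eventually)

text \<open>Only the part c / j contributes, through the harmonic sum over the block; the remainder
  is a block of a convergent series.\<close>

lemma block_sum_LIMSEQ:
  fixes f :: "nat \<Rightarrow> real"
  assumes "(\<lambda>j. f j - c / real j) \<in> O(\<lambda>j. real j powr (-2))"
  shows "(\<lambda>M. \<Sum>j=Suc M..2 * M. f j) \<longlonglongrightarrow> c * ln 2"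
proof -
  define r where "r j = f j - c / real j" for j
  have "summable (\<lambda>n. norm (real n powr (-2)))" by (simp add: summable_real_powr_iff)
  then have "summable r" using assms unfolding r_def by (rule summable_comparison_test_bigo)
  then have S: "(\<lambda>n. \<Sum>j<n. r j) \<longlonglongrightarrow> suminf r" by (rule summable_LIMSEQ)
  have "(\<lambda>M. (\<Sum>j<Suc (2 * M). r j) - (\<Sum>j<Suc M. r j)) \<longlonglongrightarrow> suminf r - suminf r"
    by (intro tendsto_diff[OF filterlim_compose[OF S filterlim_compose[OF filterlim_Suc filterlim_mult_2_nat]]
        filterlim_compose[OF S filterlim_Suc]])
  moreover have "(\<Sum>j<Suc (2 * M). r j) - (\<Sum>j<Suc M. r j) = (\<Sum>j=Suc M..2 * M. r j)" for M
  proof -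
    have "(\<Sum>j<Suc M. r j) + (\<Sum>j=Suc M..<Suc (2 * M). r j) = (\<Sum>j<Suc (2 * M). r j)"
      unfolding lessThan_atLeast0 by (rule sum.atLeastLessThan_concat) auto
    then show ?thesis unfolding atLeastLessThanSuc_atLeastAtMost by linarith
  qed
  ultimately have R: "(\<lambda>M. \<Sum>j=Suc M..2 * M. r j) \<longlonglongrightarrow> 0" by simp
  have "(\<lambda>M. ((\<Sum>j=1..2 * M. 1 / real j) - ln (real (2 * M))) - ((\<Sum>j=1..M. 1 / real j) - ln (real M)) + ln 2)
      \<longlonglongrightarrow> euler_mascheroni - euler_mascheroni + ln 2"
    by (rule tendsto_add[OF tendsto_diff[OF filterlim_compose[OF harm_ln_LIMSEQ filterlim_mult_2_nat]
        harm_ln_LIMSEQ] tendsto_const])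
  also have "?this \<longleftrightarrow> (\<lambda>M. \<Sum>j=Suc M..2 * M. 1 / real j) \<longlonglongrightarrow> ln 2"
    unfolding diff_self add_0_left
  proof (rule tendsto_cong, rule eventually_mono[OF eventually_gt_at_top[of 0]])
    fix M :: nat assume "0 < M"
    have "(\<Sum>j=1..<Suc M. 1 / real j) + (\<Sum>j=Suc M..<Suc (2 * M). 1 / real j)
        = (\<Sum>j=1..<Suc (2 * M). 1 / real j)"
      by (rule sum.atLeastLessThan_concat) auto
    then have "(\<Sum>j=1..2 * M. 1 / real j) = (\<Sum>j=1..M. 1 / real j) + (\<Sum>j=Suc M..2 * M. 1 / real j)"
      unfolding atLeastLessThanSuc_atLeastAtMost by linarith
    then show "((\<Sum>j=1..2 * M. 1 / real j) - ln (real (2 * M))) - ((\<Sum>j=1..M. 1 / real j) - ln (real M)) + ln 2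
        = (\<Sum>j=Suc M..2 * M. 1 / real j)"
      using \<open>0 < M\<close> by (simp add: ln_mult)
  qed
  finally have H: "(\<lambda>M. \<Sum>j=Suc M..2 * M. 1 / real j) \<longlonglongrightarrow> ln 2" .
  have "(\<lambda>M. c * (\<Sum>j=Suc M..2 * M. 1 / real j) + (\<Sum>j=Suc M..2 * M. r j)) \<longlonglongrightarrow> c * ln 2 + 0"
    by (rule tendsto_add[OF tendsto_mult[OF tendsto_const H] R])
  moreover have "c * (\<Sum>j=Suc M..2 * M. 1 / real j) + (\<Sum>j=Suc M..2 * M. r j) = (\<Sum>j=Suc M..2 * M. f j)" for M
    unfolding sum_distrib_left sum.distrib[symmetric] r_def by simp
  ultimately show ?thesis by simp
qed

text \<open>An index shift of \<open>ln_Gamma_series\<close> at 1 + w: its separate term ln (1 + w)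
  becomes the summand i = 1, and the k-th factor becomes the one for i = k + 1 up to a telescoping
  (k + 1) / k.\<close>

lemma sum_ln_LIMSEQ_Gamma:
  fixes w :: real
  assumes "w > -1"
  shows "(\<lambda>M. (\<Sum>i=1..M. ln (1 + w / real i)) - w * ln (real M)) \<longlonglongrightarrow> - ln (Gamma (1 + w))"
proof -
  let ?f = "\<lambda>M. (\<Sum>i=1..M. ln (1 + w / real i)) - w * ln (real M)"
  have eq: "ln_Gamma_series (1 + w) n = (1 + w) * (ln (real n) - ln (real (Suc n))) - ?f (Suc n)" if "n > 0" for n
  proof -
    have a: "(\<Sum>k=1..n. ln ((1 + w) / real k + 1)) = (\<Sum>i=1..Suc n. ln (1 + w / real i)) - ln (1 + w) + ln (real (Suc n))"
    proof (induction n)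
      case (Suc n)
      have "ln ((1 + w) / real (Suc n) + 1) = ln (1 + w / real (Suc (Suc n))) + ln (real (Suc (Suc n))) - ln (real (Suc n))"
      proof -
        have p: "1 + w / real (Suc (Suc n)) > 0" using assms by (simp add: field_simps)
        have "(1 + w / real (Suc (Suc n))) * real (Suc (Suc n)) = (1 + w) + real (Suc n)"
          by (simp add: distrib_right)
        then have "(1 + w) / real (Suc n) + 1 = (1 + w / real (Suc (Suc n))) * real (Suc (Suc n)) / real (Suc n)"
          by (simp add: add_divide_distrib del: of_nat_Suc)
        also have "ln \<dots> = ln (1 + w / real (Suc (Suc n))) + ln (real (Suc (Suc n))) - ln (real (Suc n))"
          using p by (subst ln_div) (auto simp: ln_mult simp del: of_nat_Suc)
        finally show ?thesis .
      qed
      with Suc show ?case by (simp del: of_nat_Suc)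
    qed simp
    show ?thesis unfolding ln_Gamma_series_def a by (simp add: algebra_simps)
  qed
  have "(\<lambda>n. (1 + w) * (ln (real n) - ln (real (Suc n))) - ln_Gamma_series (1 + w) n)
      \<longlonglongrightarrow> (1 + w) * 0 - ln_Gamma (1 + w)"
  proof (intro tendsto_diff tendsto_mult tendsto_const ln_Gamma_real_LIMSEQ)
    show "(\<lambda>n. ln (real n) - ln (real (Suc n))) \<longlonglongrightarrow> 0" by real_asymp
  qed (use assms in auto)
  then have "(\<lambda>n. ?f (Suc n)) \<longlonglongrightarrow> - ln_Gamma (1 + w)"
    unfolding mult_zero_right diff_0
    by (rule Lim_transform_eventually)
      (use eventually_gt_at_top[of 0] in \<open>eventually_elim, simp add: eq\<close>)
  then have "?f \<longlonglongrightarrow> - ln_Gamma (1 + w)" by (rule LIMSEQ_imp_Suc)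
  then show ?thesis using assms by (simp add: ln_Gamma_real_pos)
qed

text \<open>The logarithm of the Weierstrass product. Its convergence factors w^2 / (2 i) form a
  harmonic sum, whose constant cancels the \<open>euler_mascheroni\<close> of the prefactor and
  leaves the logarithm of M.\<close>

lemma sum_ln_LIMSEQ_barnes_G:
  fixes w :: real
  assumes "w > -1"
  shows "barnes_G (1 + w) > 0"
    and "(\<lambda>M. (\<Sum>i=1..M. real i * ln (1 + w / real i)) - w * real M + w\<^sup>2 / 2 * ln (real M))
      \<longlonglongrightarrow> ln (barnes_G (1 + w)) - w / 2 * ln (2 * pi) + (w + w\<^sup>2) / 2"
proof -
  define g where "g i = real i * ln (1 + w / real i) + w\<^sup>2 / (2 * real i) - w" for i
  have "(\<lambda>n. real n * (ln (1 + w / real n) - (w / real n - (w / real n)^2 / 2)))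
      \<in> O(\<lambda>n. real n * real n powr (-3))"
    by (intro landau_o.big.mult landau_o.big_refl ln_one_plus_bigo(2))
  also have "(\<lambda>n. real n * real n powr (-3)) \<in> O(\<lambda>n. real n powr (-2))" by real_asymp
  also have "(\<lambda>n. real n * (ln (1 + w / real n) - (w / real n - (w / real n)^2 / 2))) \<in> O(\<lambda>n. real n powr (-2))
      \<longleftrightarrow> g \<in> O(\<lambda>n. real n powr (-2))"
    by (intro landau_o.big.in_cong eventually_mono[OF eventually_gt_at_top[of 0]])
      (simp add: g_def field_simps power2_eq_square)
  finally have gO: "g \<in> O(\<lambda>n. real n powr (-2))" .
  have "summable (\<lambda>n. norm (real n powr (-2)))" by (simp add: summable_real_powr_iff)
  then have "summable g" using gO by (rule summable_comparison_test_bigo)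
  then have sum: "summable (\<lambda>i. g (Suc i))" by (simp add: summable_Suc_iff)
  have pos: "1 + w / real (Suc i) > 0" for i using assms by (simp add: field_simps)
  have fac: "(1 + w / of_nat (Suc i)) ^ Suc i * exp (w\<^sup>2 / (2 * of_nat (Suc i)) - w) = exp (g (Suc i))" for i
  proof -
    have "(1 + w / real (Suc i)) ^ Suc i = exp (real (Suc i) * ln (1 + w / real (Suc i)))"
      using pos[of i] by (subst exp_of_nat_mult) (simp del: of_nat_Suc power_Suc)
    then show ?thesis unfolding g_def by (simp add: exp_add[symmetric] del: of_nat_Suc power_Suc)
  qed
  have G: "barnes_G (1 + w) = exp (w / 2 * ln (2 * pi) - (w + w\<^sup>2 * (1 + euler_mascheroni)) / 2 + (\<Sum>i. g (Suc i)))"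
  proof -
    have "1 + w - 1 = w" by simp
    then show ?thesis
      unfolding barnes_G_def Let_def by (simp only: fac prodinf_exp[OF sum]) (simp add: exp_add)
  qed
  then show "barnes_G (1 + w) > 0" by simp
  have "(\<lambda>M. \<Sum>i<M. g (Suc i)) \<longlonglongrightarrow> (\<Sum>i. g (Suc i))" using sum by (rule summable_LIMSEQ)
  then have "(\<lambda>M. \<Sum>i=1..M. g i) \<longlonglongrightarrow> (\<Sum>i. g (Suc i))"
    by (simp add: sum.atLeast1_atMost_eq)
  then have "(\<lambda>M. (\<Sum>i=1..M. g i) - w\<^sup>2 / 2 * ((\<Sum>i=1..M. 1 / real i) - ln (real M)))
      \<longlonglongrightarrow> (\<Sum>i. g (Suc i)) - w\<^sup>2 / 2 * euler_mascheroni"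
    by (intro tendsto_diff tendsto_mult tendsto_const harm_ln_LIMSEQ)
  moreover have "(\<Sum>i=1..M. g i) - w\<^sup>2 / 2 * ((\<Sum>i=1..M. 1 / real i) - ln (real M))
      = (\<Sum>i=1..M. real i * ln (1 + w / real i)) - w * real M + w\<^sup>2 / 2 * ln (real M)" for M
    by (simp add: g_def sum.distrib sum_subtractf sum_distrib_left right_diff_distrib)
  moreover have "(\<Sum>i. g (Suc i)) - w\<^sup>2 / 2 * euler_mascheroni
      = ln (barnes_G (1 + w)) - w / 2 * ln (2 * pi) + (w + w\<^sup>2) / 2"
    unfolding G by (simp add: field_simps)
  ultimately show "(\<lambda>M. (\<Sum>i=1..M. real i * ln (1 + w / real i)) - w * real M + w\<^sup>2 / 2 * ln (real M))
      \<longlonglongrightarrow> ln (barnes_G (1 + w)) - w / 2 * ln (2 * pi) + (w + w\<^sup>2) / 2"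
    by simp
qed

section \<open>The determinant at t = 0\<close>

lemma sum_block_Suc:
  fixes f :: "nat \<Rightarrow> real"
  assumes "M \<ge> 1"
  shows "(\<Sum>j=Suc (Suc M)..2 * Suc M. f j) = (\<Sum>j=Suc M..2 * M. f j) - f (Suc M) + f (Suc (2 * M)) + f (Suc (Suc (2 * M)))"
proof -
  have "(\<Sum>j=Suc M..2 * M. f j) = f (Suc M) + (\<Sum>j=Suc (Suc M)..2 * M. f j)"
    using assms by (intro sum.atLeast_Suc_atMost) auto
  then show ?thesis using assms by simp
qed

context
  fixes \<alpha> :: real
  assumes \<alpha>: "\<alpha> > -1"
begin

text \<open>The factor 4 normalises by the limit 1/4, so these logarithms tend to 0.\<close>

definition log_rec :: "nat \<Rightarrow> real" where
  "log_rec j = ln (4 * rec_coeff (moment \<alpha> 0) j)"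

lemma log_rec_eq:
  assumes "j \<ge> 2"
  shows "log_rec j = ln (real j) + ln (real j + 2 * \<alpha>) - ln (real j + \<alpha> - 1/2) - ln (real j + \<alpha> + 1/2)"
proof -
  have pos: "real j > 0" "real j + 2 * \<alpha> > 0" "real j + \<alpha> - 1/2 > 0" "real j + \<alpha> + 1/2 > 0"
    using assms \<alpha> by auto
  have "4 * rec_coeff (moment \<alpha> 0) j * ((real j + \<alpha> - 1/2) * (real j + \<alpha> + 1/2)) = real j * (real j + 2 * \<alpha>)"
    using rec_coeff_0_eq[OF \<alpha>, of j] assms by (simp add: field_simps)
  then have "4 * rec_coeff (moment \<alpha> 0) j = (real j * (real j + 2 * \<alpha>)) / ((real j + \<alpha> - 1/2) * (real j + \<alpha> + 1/2))"
    using pos by (simp add: eq_divide_eq)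
  then show ?thesis
    unfolding log_rec_def using pos by (simp only: ln_div ln_mult mult_pos_pos less_imp_neq[symmetric]) (simp add: ln_mult ln_div)
qed

lemma log_rec_1: "log_rec 1 = ln 2 - ln (\<alpha> + 3/2)"
proof -
  have "4 * rec_coeff (moment \<alpha> 0) 1 = 2 / (\<alpha> + 3/2)"
    unfolding rec_coeff_0_1[OF \<alpha>] using \<alpha> by (simp add: field_simps)
  then show ?thesis unfolding log_rec_def using \<alpha> by (simp add: ln_div)
qed

lemma log_rec_odd_even:
  fixes M :: nat
  assumes "M \<ge> 1"
  defines "x \<equiv> real M"
  shows "log_rec (Suc (2 * M)) = ln (2 * x + 1) + (ln 2 + ln (x + \<alpha> + 1/2)) - ln (2 * x + \<alpha> + 1/2) - ln (2 * x + \<alpha> + 3/2)"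
    and "log_rec (Suc (Suc (2 * M))) = (ln 2 + ln (x + 1)) + (ln 2 + ln (x + 1 + \<alpha>))
      - ln (2 * x + \<alpha> + 3/2) - ln (2 * x + \<alpha> + 5/2)"
proof -
  have x: "x \<ge> 1" using assms by simp
  have d: "ln (2 * y) = ln 2 + ln y" if "y > 0" for y :: real
    using that by (simp add: ln_mult)
  have l: "ln (2 * x + 1 + 2 * \<alpha>) = ln 2 + ln (x + \<alpha> + 1/2)" "ln (2 * x + 2) = ln 2 + ln (x + 1)"
      "ln (2 * x + 2 + 2 * \<alpha>) = ln 2 + ln (x + 1 + \<alpha>)"
    using d[of "x + \<alpha> + 1/2"] d[of "x + 1"] d[of "x + 1 + \<alpha>"] x \<alpha> by (simp_all add: algebra_simps)
  have r: "real (Suc (2 * M)) = 2 * x + 1" "real (Suc (Suc (2 * M))) = 2 * x + 2"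
    by (simp_all add: x_def)
  show "log_rec (Suc (2 * M)) = ln (2 * x + 1) + (ln 2 + ln (x + \<alpha> + 1/2)) - ln (2 * x + \<alpha> + 1/2) - ln (2 * x + \<alpha> + 3/2)"
    using log_rec_eq[of "Suc (2 * M)"] assms(1) unfolding r l by (simp add: algebra_simps)
  show "log_rec (Suc (Suc (2 * M))) = (ln 2 + ln (x + 1)) + (ln 2 + ln (x + 1 + \<alpha>))
      - ln (2 * x + \<alpha> + 3/2) - ln (2 * x + \<alpha> + 5/2)"
    using log_rec_eq[of "Suc (Suc (2 * M))"] assms(1) unfolding r l by (simp add: algebra_simps)
qed

lemma ln_step_identities:
  fixes M :: nat
  assumes "M \<ge> 1"
  defines "x \<equiv> real M"
  shows "ln (real (Suc M) + \<alpha>) = ln (x + 1 + \<alpha>)" "ln (real (Suc M) - 1/2) = ln (2 * x + 1) - ln 2"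
    "ln (real (Suc M) - 1) = ln x" "ln (real (Suc M) + \<alpha> - 1/2) = ln (x + \<alpha> + 1/2)"
    "ln (real (Suc (2 * M)) - 1) = ln 2 + ln x" "ln (real (Suc (2 * M)) + \<alpha> - 1/2) = ln (2 * x + \<alpha> + 1/2)"
    "ln (real (Suc (Suc (2 * M))) - 1) = ln (2 * x + 1)"
    "ln (real (Suc (Suc (2 * M))) + \<alpha> - 1/2) = ln (2 * x + \<alpha> + 3/2)"
    "ln (real (Suc (2 * M))) = ln (2 * x + 1)" "ln (real (Suc (2 * M)) + \<alpha> + 1/2) = ln (2 * x + \<alpha> + 3/2)"
    "ln (real (Suc (Suc (2 * M)))) = ln 2 + ln (x + 1)"
    "ln (real (Suc (Suc (2 * M))) + \<alpha> + 1/2) = ln (2 * x + \<alpha> + 5/2)"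
    "ln (real (2 * M)) = ln 2 + ln x" "ln (real (2 * M) + \<alpha> + 1/2) = ln (2 * x + \<alpha> + 1/2)"
proof -
  have x: "x \<ge> 1" using assms by simp
  have "ln (2 * (x + 1/2)) = ln 2 + ln (x + 1/2)" using x by (subst ln_mult) auto
  then have "ln (x + 1/2) = ln (2 * x + 1) - ln 2" by (simp add: algebra_simps)
  then show "ln (real (Suc M) - 1/2) = ln (2 * x + 1) - ln 2" by (simp add: x_def add.commute)
  have "ln (2 * x) = ln 2 + ln x" "ln (2 * (x + 1)) = ln 2 + ln (x + 1)" using x by (simp_all only: ln_mult) simp_all
  then show "ln (real (Suc (2 * M)) - 1) = ln 2 + ln x" "ln (real (Suc (Suc (2 * M)))) = ln 2 + ln (x + 1)"
    "ln (real (2 * M)) = ln 2 + ln x"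
    by (simp_all add: x_def algebra_simps)
qed (simp_all add: x_def algebra_simps)

text \<open>
  Splitting the sums by parity; the summands are normalised by those of \<open>\<alpha> = -1/2\<close>, for which all
  recurrence coefficients but the first are \<open>1/4\<close>.
\<close>

lemma sum_log_rec:
  assumes "M \<ge> 1"
  shows "(\<Sum>j=1..2 * M. log_rec j) = ln 2 + (\<Sum>i=1..M. ln (real i + \<alpha>) - ln (real i - 1/2))
    + (\<Sum>j=Suc M..2 * M. ln (real j - 1) - ln (real j + \<alpha> - 1/2))
    + (\<Sum>i=1..2 * M. ln (real i) - ln (real i + \<alpha> + 1/2))"
  using assms
proof (induction M rule: dec_induct)
  case base
  have "ln (2 + 2 * \<alpha>) = ln 2 + ln (1 + \<alpha>)" using \<alpha> ln_mult[of 2 "1 + \<alpha>"] by (simp add: algebra_simps)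
  then show ?case
    using log_rec_1 log_rec_eq[of 2] by (simp add: numeral_2_eq_2 ln_div algebra_simps)
next
  case (step M)
  note l = ln_step_identities[OF step(1)] log_rec_odd_even[OF step(1)]
  have "(\<Sum>j=1..2 * Suc M. log_rec j) = (\<Sum>j=1..2 * M. log_rec j) + log_rec (Suc (2 * M)) + log_rec (Suc (Suc (2 * M)))"
    by simp
  moreover have "(\<Sum>i=1..2 * Suc M. ln (real i) - ln (real i + \<alpha> + 1/2)) = (\<Sum>i=1..2 * M. ln (real i) - ln (real i + \<alpha> + 1/2))
      + (ln (real (Suc (2 * M))) - ln (real (Suc (2 * M)) + \<alpha> + 1/2))
      + (ln (real (Suc (Suc (2 * M)))) - ln (real (Suc (Suc (2 * M))) + \<alpha> + 1/2))"
    by simp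
  moreover have "(\<Sum>i=1..Suc M. ln (real i + \<alpha>) - ln (real i - 1/2)) = (\<Sum>i=1..M. ln (real i + \<alpha>) - ln (real i - 1/2))
      + (ln (real (Suc M) + \<alpha>) - ln (real (Suc M) - 1/2))" by simp
  ultimately show ?case unfolding sum_block_Suc[OF step(1)] step.IH l by linarith
qed

text \<open>Shifting the index merges j ln (j + \<alpha> - 1/2) and (j - 1) ln (j - 1 + \<alpha> +
  1/2) into the weight 2 j - 1 and leaves a boundary term at 2 M. The odd-index part of ln (j + 2
  \<alpha>) then cancels the first M of these terms, so only the block from M + 1 to 2 M remains.
  The summand ln 2 is the value of \<open>log_rec 1\<close> at \<alpha> = -1/2.\<close>

lemma sum_weighted_log_rec:
  assumes "M \<ge> 1"
  shows "(\<Sum>j=1..2 * M. real j * log_rec j) = ln 2 + 2 * (\<Sum>i=1..M. real i * (ln (real i + \<alpha>) - ln (real i - 1/2)))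
    + (\<Sum>j=Suc M..2 * M. (2 * real j - 1) * (ln (real j - 1) - ln (real j + \<alpha> - 1/2)))
    + real (2 * M) * (ln (real (2 * M)) - ln (real (2 * M) + \<alpha> + 1/2))"
  using assms
proof (induction M rule: dec_induct)
  case base
  have "ln (2 + 2 * \<alpha>) = ln 2 + ln (1 + \<alpha>)" using \<alpha> ln_mult[of 2 "1 + \<alpha>"] by (simp add: algebra_simps)
  then show ?case
    using log_rec_1 log_rec_eq[of 2] by (simp add: numeral_2_eq_2 ln_div algebra_simps)
next
  case (step M)
  note l = ln_step_identities[OF step(1)] log_rec_odd_even[OF step(1)]
  have "(\<Sum>j=1..2 * Suc M. real j * log_rec j) = (\<Sum>j=1..2 * M. real j * log_rec j)
      + real (Suc (2 * M)) * log_rec (Suc (2 * M)) + real (Suc (Suc (2 * M))) * log_rec (Suc (Suc (2 * M)))"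
    by simp
  moreover have "(\<Sum>i=1..Suc M. real i * (ln (real i + \<alpha>) - ln (real i - 1/2)))
      = (\<Sum>i=1..M. real i * (ln (real i + \<alpha>) - ln (real i - 1/2)))
      + real (Suc M) * (ln (real (Suc M) + \<alpha>) - ln (real (Suc M) - 1/2))" by simp
  moreover have "real (2 * Suc M) * (ln (real (2 * Suc M)) - ln (real (2 * Suc M) + \<alpha> + 1/2))
      = real (Suc (Suc (2 * M))) * (ln (real (Suc (Suc (2 * M)))) - ln (real (Suc (Suc (2 * M))) + \<alpha> + 1/2))"
    by simp
  ultimately show ?case unfolding sum_block_Suc[OF step(1)] step.IH l by (simp add: algebra_simps)
qed

end

lemma Gamma_legendre_duplication_real:
  fixes z :: real
  assumes "z > 0"
  shows "Gamma z * Gamma (z + 1/2) = exp ((1 - 2 * z) * ln 2) * sqrt pi * Gamma (2 * z)"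
proof -
  have "complex_of_real z \<notin> \<int>\<^sub>\<le>\<^sub>0" "complex_of_real (z + 1/2) \<notin> \<int>\<^sub>\<le>\<^sub>0"
    unfolding of_real_in_nonpos_Ints_iff using assms by (auto elim!: nonpos_Ints_cases)
  then have "complex_of_real z \<notin> \<int>\<^sub>\<le>\<^sub>0" "complex_of_real z + 1/2 \<notin> \<int>\<^sub>\<le>\<^sub>0" by simp_all
  from Gamma_legendre_duplication[OF this]
  have "complex_of_real (Gamma z * Gamma (z + 1/2))
      = complex_of_real (exp ((1 - 2 * z) * ln 2) * sqrt pi * Gamma (2 * z))"
    by (simp add: exp_of_real[symmetric] flip: Gamma_complex_of_real)
  then show ?thesis by (simp only: of_real_eq_iff)
qed

context
  fixes \<alpha> :: real
  assumes \<alpha>: "\<alpha> > -1"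
begin

abbreviation "lr \<equiv> log_rec \<alpha>"
abbreviation "hh n \<equiv> op_norm (moment \<alpha> 0) n"

text \<open>The duplication formula removes \<Gamma>(2 \<alpha> + 2) from the Beta value, so that
  the remaining Gamma values cancel those of \<open>sum_log_rec_LIMSEQ\<close>.\<close>

lemma ln_h_0: "ln (hh 0) = ln pi / 2 + ln (Gamma (1 + \<alpha>)) - ln (Gamma (\<alpha> + 3/2))"
proof -
  have "hh 0 = moment \<alpha> 0 0"
    by (simp add: op_norm_def functional_def)
  also have "\<dots> = 2 powr (2 * \<alpha> + 1) * (Gamma (\<alpha> + 1) * Gamma (\<alpha> + 1) / Gamma (2 * (\<alpha> + 1)))"
    using moment_0_0[OF \<alpha>] by (simp add: Beta_def mult_2 algebra_simps)
  finally have h: "hh 0 = 2 powr (2 * \<alpha> + 1) * (Gamma (\<alpha> + 1) * Gamma (\<alpha> + 1) / Gamma (2 * (\<alpha> + 1)))" .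
  have p: "Gamma (\<alpha> + 1) > 0" "Gamma (2 * (\<alpha> + 1)) > 0" "Gamma (\<alpha> + 3/2) > 0"
    using \<alpha> by (auto intro!: Gamma_real_pos)
  have "Gamma (\<alpha> + 1) * Gamma (\<alpha> + 3/2) = exp ((1 - 2 * (\<alpha> + 1)) * ln 2) * sqrt pi * Gamma (2 * (\<alpha> + 1))"
    using Gamma_legendre_duplication_real[of "\<alpha> + 1"] \<alpha> by (simp add: add.assoc)
  then have "ln (Gamma (\<alpha> + 1) * Gamma (\<alpha> + 3/2)) = ln (exp ((1 - 2 * (\<alpha> + 1)) * ln 2) * sqrt pi * Gamma (2 * (\<alpha> + 1)))"
    by simp
  then have "ln (Gamma (\<alpha> + 1)) + ln (Gamma (\<alpha> + 3/2)) = (1 - 2 * (\<alpha> + 1)) * ln 2 + ln pi / 2 + ln (Gamma (2 * (\<alpha> + 1)))"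
    using p by (simp add: ln_mult ln_sqrt)
  moreover have "ln (hh 0) = (2 * \<alpha> + 1) * ln 2 + (2 * ln (Gamma (\<alpha> + 1)) - ln (Gamma (2 * (\<alpha> + 1))))"
    unfolding h using p by (simp add: ln_mult ln_div ln_powr)
  ultimately show ?thesis by (simp add: algebra_simps)
qed

lemma ln_h_Suc: "ln (hh (Suc n)) = ln (hh n) + lr (Suc n) - 2 * ln 2"
proof -
  have p: "hh n > 0" "rec_coeff (moment \<alpha> 0) (Suc n) > 0"
    using op_norm_moment_pos[OF \<alpha>] rec_coeff_moment_pos[OF \<alpha>] by auto
  have "ln (4::real) = 2 * ln 2" using ln_realpow[of 2 2] by simp
  then show ?thesis
    unfolding op_norm_moment_Suc[OF \<alpha>] log_rec_def[OF \<alpha>] using p by (simp add: ln_mult)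
qed

lemma ln_h_eq: "ln (hh n) = ln (hh 0) + (\<Sum>j=1..n. lr j) - 2 * real n * ln 2"
  by (induction n) (simp_all add: ln_h_Suc algebra_simps)

lemma ln_hankel_Suc: "ln (hankel_det \<alpha> (Suc n) 0) = ln (hankel_det \<alpha> n 0) + ln (hh n)"
proof -
  have "hankel_det \<alpha> (Suc n) 0 = hankel_det \<alpha> n 0 * hh n"
    by (simp add: hankel_det_eq_prod[OF \<alpha>])
  then show ?thesis
    using hankel_det_pos[OF \<alpha>, of n 0] op_norm_moment_pos[OF \<alpha>, of 0 n] by (simp add: ln_mult)
qed

lemma ln_hankel_0: "ln (hankel_det \<alpha> 0 0) = 0"
  unfolding hankel_det_eq_prod[OF \<alpha>] by simp

text \<open>Abel summation of the logarithms of the norms; it isolates the weighted sum governed by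
  the Barnes function.\<close>

lemma ln_hankel_minus: "ln (hankel_det \<alpha> n 0) - real n * ln (hh n)
  = real n * (real n + 1) * ln 2 - (\<Sum>j=1..n. real j * lr j)"
proof (induction n)
  case (Suc n)
  then show ?case by (simp add: ln_hankel_Suc ln_h_Suc algebra_simps)
qed (simp add: ln_hankel_0)

section \<open>The claimed expansion at t = 0 and its second difference\<close>

definition correction_1 where "correction_1 = (1 - 4 * \<alpha>\<^sup>2) * (- 2 * \<alpha>) / 8"
definition correction_2 where "correction_2 = (1 - 4 * \<alpha>\<^sup>2) * (28 * \<alpha>\<^sup>2 - 3) / 192"
definition correction_3 where "correction_3 = (1 - 4 * \<alpha>\<^sup>2) * (3 * \<alpha> * (1 - 4 * \<alpha>\<^sup>2)) / 96"

text \<open>Logarithm of the right side of the second claim at t = 0 without its error term; the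
  corrections are the coefficients of the negative powers of n in its exponent there.\<close>

definition hankel_0_main :: "nat \<Rightarrow> real" where
  "hankel_0_main n = (real n + \<alpha> + 1/2) * ln pi + (\<alpha>\<^sup>2 - 1/4) * ln (real n) + 2 * ln (barnes_G (1/2))
    - (real n ^ 2 + (2 * \<alpha> - 1) * (real n + \<alpha>)) * ln 2 - 2 * ln (barnes_G (\<alpha> + 1))
    + correction_1 * (1 / real n) + correction_2 * (1 / real n ^ 2) + correction_3 * (1 / real n ^ 3)"

definition hankel_0_err where "hankel_0_err n = ln (hankel_det \<alpha> n 0) - hankel_0_main n"

text \<open>Up to a constant \<open>lr n\<close> is the second difference of ln D_n(0) centred at n,
  so it is compared with that of \<open>hankel_0_main\<close>. Order 6 is needed because two
  summations lose one order each.\<close>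

lemma log_rec_expansion:
  "(\<lambda>n. lr n - ((\<alpha>\<^sup>2 - 1/4) * (ln (real n + 1) + ln (real n - 1) - 2 * ln (real n))
      + correction_1 * (1 / (real n + 1) + 1 / (real n - 1) - 2 / real n)
      + correction_2 * (1 / (real n + 1) ^ 2 + 1 / (real n - 1) ^ 2 - 2 / real n ^ 2)
      + correction_3 * (1 / (real n + 1) ^ 3 + 1 / (real n - 1) ^ 3 - 2 / real n ^ 3))) \<in> O(\<lambda>n. real n powr (-6))"
proof -
  define P where "P c n = c / real n - (c / real n)^2 / 2 + (c / real n)^3 / 3 - (c / real n)^4 / 4 + (c / real n)^5 / 5" for c n
  have ln: "unif_bigo 0 (\<lambda>n t. ln (1 + c / real n) - P c n) 6" for c
    unfolding P_def by (rule unif_bigo_lift, rule ln_one_plus_bigo(3))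
  have R: "unif_bigo 0 (\<lambda>n t. ln (real n + 1) + ln (real n - 1) - 2 * ln (real n) + 1 / real n ^ 2 + 1 / (2 * real n ^ 4)) 6"
    "unif_bigo 0 (\<lambda>n t. 1 / (real n + 1) + 1 / (real n - 1) - 2 / real n - 2 / real n ^ 3 - 2 / real n ^ 5) 6"
    "unif_bigo 0 (\<lambda>n t. 1 / (real n + 1) ^ 2 + 1 / (real n - 1) ^ 2 - 2 / real n ^ 2 - 6 / real n ^ 4) 6"
    "unif_bigo 0 (\<lambda>n t. 1 / (real n + 1) ^ 3 + 1 / (real n - 1) ^ 3 - 2 / real n ^ 3 - 12 / real n ^ 5) 6"
    by (rule unif_bigo_lift, real_asymp)+
  have U: "unif_bigo 0 (\<lambda>n t. (ln (1 + (2 * \<alpha>) / real n) - P (2 * \<alpha>) n) - (ln (1 + (\<alpha> - 1/2) / real n) - P (\<alpha> - 1/2) n)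
      - (ln (1 + (\<alpha> + 1/2) / real n) - P (\<alpha> + 1/2) n)
      - (\<alpha>\<^sup>2 - 1/4) * (ln (real n + 1) + ln (real n - 1) - 2 * ln (real n) + 1 / real n ^ 2 + 1 / (2 * real n ^ 4))
      - correction_1 * (1 / (real n + 1) + 1 / (real n - 1) - 2 / real n - 2 / real n ^ 3 - 2 / real n ^ 5)
      - correction_2 * (1 / (real n + 1) ^ 2 + 1 / (real n - 1) ^ 2 - 2 / real n ^ 2 - 6 / real n ^ 4)
      - correction_3 * (1 / (real n + 1) ^ 3 + 1 / (real n - 1) ^ 3 - 2 / real n ^ 3 - 12 / real n ^ 5)) 6"
    by (intro unif_bigo_diff unif_bigo_cmult ln R)
  have "unif_bigo 0 (\<lambda>n t. lr n - ((\<alpha>\<^sup>2 - 1/4) * (ln (real n + 1) + ln (real n - 1) - 2 * ln (real n))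
      + correction_1 * (1 / (real n + 1) + 1 / (real n - 1) - 2 / real n)
      + correction_2 * (1 / (real n + 1) ^ 2 + 1 / (real n - 1) ^ 2 - 2 / real n ^ 2)
      + correction_3 * (1 / (real n + 1) ^ 3 + 1 / (real n - 1) ^ 3 - 2 / real n ^ 3))) 6"
  proof (rule unif_bigo_cong[OF U], intro eventually_mono[OF eventually_ge_at_top[of 2]] ballI)
    fix n :: nat and t :: real assume n: "2 \<le> n"
    have l: "ln (1 + c / real n) = ln (real n + c) - ln (real n)" if "real n + c > 0" for c
    proof -
      have "1 + c / real n = (real n + c) / real n" using n by (simp add: field_simps)
      then show ?thesis using that n by (simp add: ln_div)
    qed
    have lr: "ln (1 + (2 * \<alpha>) / real n) - ln (1 + (\<alpha> - 1/2) / real n) - ln (1 + (\<alpha> + 1/2) / real n) = lr n"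
      using n \<alpha> by (simp add: l log_rec_eq[OF \<alpha>] algebra_simps)
    \<comment> \<open>Taylor polynomials of degree five in x = 1/n are matched with second
      differences; the three corrections are determined by this identity.\<close>
    have poly: "(2 * a) * x - ((2 * a) * x)^2 / 2 + ((2 * a) * x)^3 / 3 - ((2 * a) * x)^4 / 4 + ((2 * a) * x)^5 / 5
      - ((a - 1/2) * x - ((a - 1/2) * x)^2 / 2 + ((a - 1/2) * x)^3 / 3 - ((a - 1/2) * x)^4 / 4 + ((a - 1/2) * x)^5 / 5)
      - ((a + 1/2) * x - ((a + 1/2) * x)^2 / 2 + ((a + 1/2) * x)^3 / 3 - ((a + 1/2) * x)^4 / 4 + ((a + 1/2) * x)^5 / 5)
      = - ((a\<^sup>2 - 1/4) * (x^2 + x^4 / 2)) + (1 - 4 * a\<^sup>2) * (- 2 * a) / 8 * (2 * x^3 + 2 * x^5)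
        + (1 - 4 * a\<^sup>2) * (28 * a\<^sup>2 - 3) / 192 * (6 * x^4)
        + (1 - 4 * a\<^sup>2) * (3 * a * (1 - 4 * a\<^sup>2)) / 96 * (12 * x^5)" for a x :: real
      by (simp add: field_simps eval_nat_numeral)
    have PP: "P (2 * \<alpha>) n - P (\<alpha> - 1/2) n - P (\<alpha> + 1/2) n
      = - ((\<alpha>\<^sup>2 - 1/4) * (1 / real n ^ 2 + 1 / (2 * real n ^ 4))) + correction_1 * (2 / real n ^ 3 + 2 / real n ^ 5)
        + correction_2 * (6 / real n ^ 4) + correction_3 * (12 / real n ^ 5)"
      using poly[of \<alpha> "1 / real n"] by (simp add: P_def correction_1_def correction_2_def correction_3_def power_divide)
    have aux: "(A - p1) - (B - p2) - (C - p3) - k * (l + u + v) - a1 * (r1 - s1 - s1') - a2 * (r2 - s2) - a3 * (r3 - s3)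
        = (A - B - C) - (k * l + a1 * r1 + a2 * r2 + a3 * r3)"
      if "p1 - p2 - p3 = - (k * (u + v)) + a1 * (s1 + s1') + a2 * s2 + a3 * s3"
      for A B C p1 p2 p3 k l u v a1 a2 a3 r1 r2 r3 s1 s1' s2 s3 :: real
      using that by (simp add: algebra_simps)
    show "(ln (1 + (2 * \<alpha>) / real n) - P (2 * \<alpha>) n) - (ln (1 + (\<alpha> - 1/2) / real n) - P (\<alpha> - 1/2) n)
      - (ln (1 + (\<alpha> + 1/2) / real n) - P (\<alpha> + 1/2) n)
      - (\<alpha>\<^sup>2 - 1/4) * (ln (real n + 1) + ln (real n - 1) - 2 * ln (real n) + 1 / real n ^ 2 + 1 / (2 * real n ^ 4))
      - correction_1 * (1 / (real n + 1) + 1 / (real n - 1) - 2 / real n - 2 / real n ^ 3 - 2 / real n ^ 5)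
      - correction_2 * (1 / (real n + 1) ^ 2 + 1 / (real n - 1) ^ 2 - 2 / real n ^ 2 - 6 / real n ^ 4)
      - correction_3 * (1 / (real n + 1) ^ 3 + 1 / (real n - 1) ^ 3 - 2 / real n ^ 3 - 12 / real n ^ 5)
      = lr n - ((\<alpha>\<^sup>2 - 1/4) * (ln (real n + 1) + ln (real n - 1) - 2 * ln (real n))
      + correction_1 * (1 / (real n + 1) + 1 / (real n - 1) - 2 / real n)
      + correction_2 * (1 / (real n + 1) ^ 2 + 1 / (real n - 1) ^ 2 - 2 / real n ^ 2)
      + correction_3 * (1 / (real n + 1) ^ 3 + 1 / (real n - 1) ^ 3 - 2 / real n ^ 3))"
      unfolding aux[OF PP] lr ..
  qed
  from unif_bigo_imp_bigo[OF this, of 0] show ?thesis by simp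
qed

lemma hankel_0_err_second_difference:
  "(\<lambda>n. (hankel_0_err (Suc (Suc n)) - hankel_0_err (Suc n)) - (hankel_0_err (Suc n) - hankel_0_err n)) \<in> O(\<lambda>n. real n powr (-6))"
proof -
  let ?f = "\<lambda>n. lr n - ((\<alpha>\<^sup>2 - 1/4) * (ln (real n + 1) + ln (real n - 1) - 2 * ln (real n))
      + correction_1 * (1 / (real n + 1) + 1 / (real n - 1) - 2 / real n)
      + correction_2 * (1 / (real n + 1) ^ 2 + 1 / (real n - 1) ^ 2 - 2 / real n ^ 2)
      + correction_3 * (1 / (real n + 1) ^ 3 + 1 / (real n - 1) ^ 3 - 2 / real n ^ 3))"
  have "unif_bigo 0 (\<lambda>n t. ?f n) 6" by (rule unif_bigo_lift, rule log_rec_expansion)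
  from unif_bigo_imp_bigo[OF unif_bigo_Suc[OF this], of 0]
  have "(\<lambda>n. ?f (Suc n)) \<in> O(\<lambda>n. real n powr (-6))" by simp
  moreover have "?f (Suc n) = (hankel_0_err (Suc (Suc n)) - hankel_0_err (Suc n)) - (hankel_0_err (Suc n) - hankel_0_err n)" for n
  proof -
    have r: "real (Suc n) + 1 = real (Suc (Suc n))" "real (Suc n) - 1 = real n" by simp_all
    show ?thesis
      unfolding r hankel_0_err_def hankel_0_main_def ln_hankel_Suc ln_h_Suc
      by (simp add: algebra_simps power2_eq_square)
  qed
  ultimately show ?thesis by simp
qed


section \<open>Evaluation of the two constants of summation\<close>

lemma block_asymp:
  "(\<lambda>j. (ln (real j - 1) - ln (real j + \<alpha> - 1/2)) - (- (\<alpha> + 1/2)) / real j) \<in> O(\<lambda>j. real j powr (-2))"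
  "(\<lambda>j. ((2 * real j - 1) * (ln (real j - 1) - ln (real j + \<alpha> - 1/2)) + (2 * \<alpha> + 1)) - (\<alpha>\<^sup>2 - 1/4) / real j)
     \<in> O(\<lambda>j. real j powr (-2))"
proof -
  let ?a = "\<alpha> - 1/2"
  have l: "ln (real j - 1) - ln (real j + \<alpha> - 1/2) = ln (1 + (-1) / real j) - ln (1 + ?a / real j)" if "j \<ge> 2" for j
  proof -
    have "1 + (-1) / real j = (real j - 1) / real j" "1 + ?a / real j = (real j + \<alpha> - 1/2) / real j"
      using that by (simp_all add: field_simps)
    then show ?thesis using that \<alpha> by (simp add: ln_div)
  qed
  have "unif_bigo 0 (\<lambda>j t. (ln (1 + (-1) / real j) - (-1) / real j) - (ln (1 + ?a / real j) - ?a / real j)) 2"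
    by (rule unif_bigo_diff) (rule unif_bigo_lift, rule ln_one_plus_bigo(1))+
  then have "unif_bigo 0 (\<lambda>j t. (ln (real j - 1) - ln (real j + \<alpha> - 1/2)) - (- (\<alpha> + 1/2)) / real j) 2"
  proof (rule unif_bigo_cong, intro eventually_mono[OF eventually_ge_at_top[of 2]] ballI)
    fix j :: nat assume j: "2 \<le> j"
    have aux: "(A - (-1) / x) - (B - (a - 1/2) / x) = A - B - (- (a + 1/2)) / x" for A B a x :: real
      by (simp add: diff_divide_distrib add_divide_distrib)
    show "(ln (1 + (-1) / real j) - (-1) / real j) - (ln (1 + ?a / real j) - ?a / real j)
      = (ln (real j - 1) - ln (real j + \<alpha> - 1/2)) - (- (\<alpha> + 1/2)) / real j"
      unfolding l[OF j] by (rule aux)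
  qed
  from unif_bigo_imp_bigo[OF this, of 0]
  show "(\<lambda>j. (ln (real j - 1) - ln (real j + \<alpha> - 1/2)) - (- (\<alpha> + 1/2)) / real j) \<in> O(\<lambda>j. real j powr (-2))" by simp
  define Q where "Q c j = ln (1 + c / real j) - (c / real j - (c / real j)^2 / 2)" for c j
  have Q: "unif_bigo 0 (\<lambda>j t. Q c j) 3" for c
    unfolding Q_def by (rule unif_bigo_lift, rule ln_one_plus_bigo(2))
  have n1: "unif_bigo 0 (\<lambda>j t. 2 * real j - 1) (-1)" and n2: "unif_bigo 0 (\<lambda>j t. 1 / real j ^ 2) 2"
    by (rule unif_bigo_lift, real_asymp)+
  have "unif_bigo 0 (\<lambda>j t. (2 * real j - 1) * (Q (-1) j - Q ?a j) + (1 - ?a\<^sup>2) / 2 * (1 / real j ^ 2)) 2"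
    by (intro unif_bigo_add unif_bigo_cmult n2 unif_bigo_mult[OF n1 unif_bigo_diff[OF Q Q]]) simp
  then have "unif_bigo 0 (\<lambda>j t. ((2 * real j - 1) * (ln (real j - 1) - ln (real j + \<alpha> - 1/2)) + (2 * \<alpha> + 1))
      - (\<alpha>\<^sup>2 - 1/4) / real j) 2"
  proof (rule unif_bigo_cong, intro eventually_mono[OF eventually_ge_at_top[of 2]] ballI)
    fix j :: nat assume j: "2 \<le> j"
    have aux: "(2 * x - 1) * ((A - (-1 / x - (-1 / x)^2 / 2)) - (B - (a / x - (a / x)^2 / 2))) + (1 - a\<^sup>2) / 2 * (1 / x ^ 2)
        = (2 * x - 1) * (A - B) + (2 * (a + 1/2) + 1) - ((a + 1/2)\<^sup>2 - 1/4) / x" if "x > 0" for A B a x :: real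
      using that by (simp add: field_simps power2_eq_square)
    show "(2 * real j - 1) * (Q (-1) j - Q ?a j) + (1 - ?a\<^sup>2) / 2 * (1 / real j ^ 2)
      = ((2 * real j - 1) * (ln (real j - 1) - ln (real j + \<alpha> - 1/2)) + (2 * \<alpha> + 1)) - (\<alpha>\<^sup>2 - 1/4) / real j"
      unfolding l[OF j] Q_def using aux[of "real j" "ln (1 + (-1) / real j)" "ln (1 + ?a / real j)" ?a] j by simp
  qed
  from unif_bigo_imp_bigo[OF this, of 0]
  show "(\<lambda>j. ((2 * real j - 1) * (ln (real j - 1) - ln (real j + \<alpha> - 1/2)) + (2 * \<alpha> + 1)) - (\<alpha>\<^sup>2 - 1/4) / real j)
     \<in> O(\<lambda>j. real j powr (-2))" by simp
qed

lemma ln_shift: "i > 0 \<Longrightarrow> c > -1 \<Longrightarrow> ln (real i + c) = ln (real i) + ln (1 + c / real i)"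
proof -
  assume i: "i > 0" and c: "c > -1"
  have "real i + c > 0" using i c by linarith
  moreover have "1 + c / real i = (real i + c) / real i" using i by (simp add: field_simps)
  ultimately show ?thesis using i by (simp add: ln_div)
qed

text \<open>The full sums of \<open>sum_log_rec\<close> produce Gamma at 1 + \<alpha>, 1/2 and
  \<alpha> + 3/2. Their logarithmic growth cancels except for (\<alpha> + 1/2) ln 2, as one of them
  runs to 2 M and the others to M.\<close>

lemma sum_log_rec_LIMSEQ:
  "(\<lambda>M. \<Sum>j=1..2 * M. lr j) \<longlonglongrightarrow> ln 2 - ln (Gamma (1 + \<alpha>)) + ln pi / 2 + ln (Gamma (\<alpha> + 3/2)) - (2 * \<alpha> + 1) * ln 2"
proof -
  let ?S = "\<lambda>w M. (\<Sum>i=1..M. ln (1 + w / real i)) - w * ln (real M)"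
  have "(\<lambda>M. ln 2 + (?S \<alpha> M - ?S (-1/2) M) + (\<Sum>j=Suc M..2 * M. ln (real j - 1) - ln (real j + \<alpha> - 1/2))
      - ?S (\<alpha> + 1/2) (2 * M) - (\<alpha> + 1/2) * ln 2)
    \<longlonglongrightarrow> ln 2 + (- ln (Gamma (1 + \<alpha>)) - - ln (Gamma (1 + (-1/2)))) + - (\<alpha> + 1/2) * ln 2
      - - ln (Gamma (1 + (\<alpha> + 1/2))) - (\<alpha> + 1/2) * ln 2"
    using \<alpha> by (intro tendsto_add tendsto_diff tendsto_const sum_ln_LIMSEQ_Gamma block_sum_LIMSEQ block_asymp
        filterlim_compose[OF sum_ln_LIMSEQ_Gamma filterlim_mult_2_nat]) auto
  also have "Gamma (1 + (-1/2) :: real) = sqrt pi" using Gamma_one_half_real by simp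
  also have "ln 2 + (- ln (Gamma (1 + \<alpha>)) - - ln (sqrt pi)) + - (\<alpha> + 1/2) * ln 2
      - - ln (Gamma (1 + (\<alpha> + 1/2))) - (\<alpha> + 1/2) * ln 2
    = ln 2 - ln (Gamma (1 + \<alpha>)) + ln pi / 2 + ln (Gamma (\<alpha> + 3/2)) - (2 * \<alpha> + 1) * ln 2"
    by (simp add: ln_sqrt add.commute algebra_simps)
  finally show ?thesis
  proof (rule Lim_transform_eventually, intro eventually_mono[OF eventually_ge_at_top[of 1]])
    fix M :: nat assume M: "1 \<le> M"
    have 1: "(\<Sum>i=1..M. ln (real i + \<alpha>) - ln (real i - 1/2)) = (\<Sum>i=1..M. ln (1 + \<alpha> / real i)) - (\<Sum>i=1..M. ln (1 + (-1/2) / real i))"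
      unfolding sum_subtractf[symmetric] using ln_shift[of _ \<alpha>] ln_shift[of _ "-1/2"] \<alpha> by (intro sum.cong) auto
    have 2: "(\<Sum>i=1..2 * M. ln (real i) - ln (real i + \<alpha> + 1/2)) = - (\<Sum>i=1..2 * M. ln (1 + (\<alpha> + 1/2) / real i))"
      unfolding sum_negf[symmetric] using ln_shift[of _ "\<alpha> + 1/2"] \<alpha> by (intro sum.cong) (auto simp: add.assoc)
    have 3: "ln (real (2 * M)) = ln 2 + ln (real M)" using M by (simp add: ln_mult)
    show "ln 2 + (?S \<alpha> M - ?S (-1/2) M) + (\<Sum>j=Suc M..2 * M. ln (real j - 1) - ln (real j + \<alpha> - 1/2))
      - ?S (\<alpha> + 1/2) (2 * M) - (\<alpha> + 1/2) * ln 2 = (\<Sum>j=1..2 * M. lr j)"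
      unfolding sum_log_rec[OF \<alpha> M] 1 2 3 by (simp add: algebra_simps)
  qed
qed

lemma sum_weighted_log_rec_LIMSEQ:
  "(\<lambda>M. (\<Sum>j=1..2 * M. real j * lr j) + (\<alpha>\<^sup>2 - 1/4) * ln (real (2 * M)))
    \<longlonglongrightarrow> ln 2 + 2 * ln (barnes_G (1 + \<alpha>)) - 2 * ln (barnes_G (1/2)) - (\<alpha> + 1/2) * (ln 2 + ln pi)
      + (\<alpha>\<^sup>2 - 1/4) * (1 + 2 * ln 2)"
proof -
  let ?S = "\<lambda>w M. (\<Sum>i=1..M. real i * ln (1 + w / real i)) - w * real M + w\<^sup>2 / 2 * ln (real M)"
  let ?l = "\<lambda>w. ln (barnes_G (1 + w)) - w / 2 * ln (2 * pi) + (w + w\<^sup>2) / 2"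
  let ?f = "\<lambda>j. (2 * real j - 1) * (ln (real j - 1) - ln (real j + \<alpha> - 1/2)) + (2 * \<alpha> + 1)"
  have n: "(\<lambda>n. real n * ln (1 + (\<alpha> + 1/2) / real n)) \<longlonglongrightarrow> \<alpha> + 1/2" by real_asymp
  have "(\<lambda>M. ln 2 + 2 * (?S \<alpha> M - ?S (-1/2) M) + (\<Sum>j=Suc M..2 * M. ?f j)
      - real (2 * M) * ln (1 + (\<alpha> + 1/2) / real (2 * M)) + (\<alpha>\<^sup>2 - 1/4) * ln 2)
    \<longlonglongrightarrow> ln 2 + 2 * (?l \<alpha> - ?l (-1/2)) + (\<alpha>\<^sup>2 - 1/4) * ln 2 - (\<alpha> + 1/2) + (\<alpha>\<^sup>2 - 1/4) * ln 2"
    using \<alpha> by (intro tendsto_add tendsto_diff tendsto_mult tendsto_const sum_ln_LIMSEQ_barnes_G block_sum_LIMSEQ block_asymp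
        filterlim_compose[OF n filterlim_mult_2_nat]) auto
  also have "ln 2 + 2 * (?l \<alpha> - ?l (-1/2)) + (\<alpha>\<^sup>2 - 1/4) * ln 2 - (\<alpha> + 1/2) + (\<alpha>\<^sup>2 - 1/4) * ln 2
    = ln 2 + 2 * ln (barnes_G (1 + \<alpha>)) - 2 * ln (barnes_G (1/2)) - (\<alpha> + 1/2) * (ln 2 + ln pi)
      + (\<alpha>\<^sup>2 - 1/4) * (1 + 2 * ln 2)"
    by (simp add: ln_mult field_simps power2_eq_square)
  finally show ?thesis
  proof (rule Lim_transform_eventually, intro eventually_mono[OF eventually_ge_at_top[of 1]])
    fix M :: nat assume M: "1 \<le> M"
    have 1: "(\<Sum>i=1..M. real i * (ln (real i + \<alpha>) - ln (real i - 1/2)))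
        = (\<Sum>i=1..M. real i * ln (1 + \<alpha> / real i)) - (\<Sum>i=1..M. real i * ln (1 + (-1/2) / real i))"
      unfolding sum_subtractf[symmetric] using ln_shift[of _ \<alpha>] ln_shift[of _ "-1/2"] \<alpha>
      by (intro sum.cong) (auto simp: right_diff_distrib)
    \<comment> \<open>The constant 2 \<alpha> + 1 makes the summand O(1/j), as
      \<open>block_sum_LIMSEQ\<close> requires; over the block it adds up to M (2 \<alpha> + 1),
      which balances the linear terms of the two Barnes limits.\<close>
    have 2: "(\<Sum>j=Suc M..2 * M. ?f j) = (\<Sum>j=Suc M..2 * M. (2 * real j - 1) * (ln (real j - 1) - ln (real j + \<alpha> - 1/2)))
        + real M * (2 * \<alpha> + 1)"
      unfolding sum.distrib using M by (simp add: algebra_simps)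
    have 3: "ln (real (2 * M) + \<alpha> + 1/2) = ln (real (2 * M)) + ln (1 + (\<alpha> + 1/2) / real (2 * M))"
      using ln_shift[of "2 * M" "\<alpha> + 1/2"] M \<alpha> by (simp add: add.assoc)
    have 4: "ln (real (2 * M)) = ln 2 + ln (real M)" using M by (simp add: ln_mult)
    have q: "(- 1 / 2)\<^sup>2 = (1/4 :: real)" by (simp add: power2_eq_square)
    show "ln 2 + 2 * (?S \<alpha> M - ?S (-1/2) M) + (\<Sum>j=Suc M..2 * M. ?f j)
      - real (2 * M) * ln (1 + (\<alpha> + 1/2) / real (2 * M)) + (\<alpha>\<^sup>2 - 1/4) * ln 2
      = (\<Sum>j=1..2 * M. real j * lr j) + (\<alpha>\<^sup>2 - 1/4) * ln (real (2 * M))"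
      unfolding sum_weighted_log_rec[OF \<alpha> M] 1 2 3 4 q by (simp add: algebra_simps)
  qed
qed

lemma hankel_0_err_bigo: "hankel_0_err \<in> O(\<lambda>n. real n powr (-4))"
proof -
  define w where "w n = (\<alpha>\<^sup>2 - 1/4) * (ln (real (Suc n)) - ln (real n)) + correction_1 * (1 / real (Suc n) - 1 / real n)
    + correction_2 * (1 / real (Suc n) ^ 2 - 1 / real n ^ 2) + correction_3 * (1 / real (Suc n) ^ 3 - 1 / real n ^ 3)" for n
  have d: "hankel_0_err (Suc n) - hankel_0_err n = ln (hh 0) + (\<Sum>j=1..n. lr j) - ln pi + 2 * \<alpha> * ln 2 - w n" for n
    unfolding hankel_0_err_def ln_hankel_Suc ln_h_eq[of n] hankel_0_main_def w_def
    by (simp add: algebra_simps power2_eq_square)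
  have "w \<longlonglongrightarrow> (\<alpha>\<^sup>2 - 1/4) * 0 + correction_1 * 0 + correction_2 * 0 + correction_3 * 0"
    unfolding w_def by (intro tendsto_add tendsto_mult tendsto_const; real_asymp)
  then have "(\<lambda>M. ln (hh 0) + (\<Sum>j=1..2 * M. lr j) - ln pi + 2 * \<alpha> * ln 2 - w (2 * M))
    \<longlonglongrightarrow> ln (hh 0) + (ln 2 - ln (Gamma (1 + \<alpha>)) + ln pi / 2 + ln (Gamma (\<alpha> + 3/2)) - (2 * \<alpha> + 1) * ln 2)
      - ln pi + 2 * \<alpha> * ln 2 - 0"
    by (intro tendsto_add tendsto_diff tendsto_const sum_log_rec_LIMSEQ filterlim_compose[OF _ filterlim_mult_2_nat]) simp
  also have "ln (hh 0) + (ln 2 - ln (Gamma (1 + \<alpha>)) + ln pi / 2 + ln (Gamma (\<alpha> + 3/2)) - (2 * \<alpha> + 1) * ln 2)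
      - ln pi + 2 * \<alpha> * ln 2 - 0 = 0"
    unfolding ln_h_0 by (simp add: algebra_simps)
  finally have "(\<lambda>M. hankel_0_err (Suc (2 * M)) - hankel_0_err (2 * M)) \<longlonglongrightarrow> 0" unfolding d .
  with hankel_0_err_second_difference
  have D: "(\<lambda>n. hankel_0_err (Suc n) - hankel_0_err n) \<in> O(\<lambda>n. real n powr (-5))"
    using bigo_tail_subseq(2)[of "\<lambda>n. hankel_0_err (Suc n) - hankel_0_err n" 5] by simp
  \<comment> \<open>Here n (ln (n + 1) - ln n) tends to 1, so the logarithmic term of the expansion
    leaves a nonzero limit while the corrections do not.\<close>
  have nw: "(\<lambda>n. real n * w n) \<longlonglongrightarrow> \<alpha>\<^sup>2 - 1/4"
  proof -
    have "(\<lambda>n. (\<alpha>\<^sup>2 - 1/4) * (real n * (ln (real (Suc n)) - ln (real n))) + correction_1 * (real n * (1 / real (Suc n) - 1 / real n))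
      + correction_2 * (real n * (1 / real (Suc n) ^ 2 - 1 / real n ^ 2)) + correction_3 * (real n * (1 / real (Suc n) ^ 3 - 1 / real n ^ 3)))
      \<longlonglongrightarrow> (\<alpha>\<^sup>2 - 1/4) * 1 + correction_1 * 0 + correction_2 * 0 + correction_3 * 0"
      by (intro tendsto_add tendsto_mult[OF tendsto_const]; real_asymp)
    moreover have "N * (k * a + k1 * a1 + k2 * a2 + k3 * a3) = k * (N * a) + k1 * (N * a1) + k2 * (N * a2) + k3 * (N * a3)"
      for N k k1 k2 k3 a a1 a2 a3 :: real by (simp add: algebra_simps)
    ultimately show ?thesis unfolding w_def by simp
  qed
  define v where "v n = correction_1 * (1 / real n) + correction_2 * (1 / real n ^ 2) + correction_3 * (1 / real n ^ 3)" for n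
  have v: "v \<longlonglongrightarrow> correction_1 * 0 + correction_2 * 0 + correction_3 * 0"
    unfolding v_def by (intro tendsto_add tendsto_mult tendsto_const; real_asymp)
  \<comment> \<open>\<open>ln_hankel_minus\<close> is explicit only for ln D_n - n ln h_n, so the
    error is paired with n times its increment. That increment is already O(n^(-5)), hence the added
    term vanishes in the limit.\<close>
  have e: "hankel_0_err n - real n * (hankel_0_err (Suc n) - hankel_0_err n) = - ((\<Sum>j=1..n. real j * lr j) + (\<alpha>\<^sup>2 - 1/4) * ln (real n))
      + real n * w n - v n + (2 * ln (barnes_G (\<alpha> + 1)) - 2 * ln (barnes_G (1/2)) - (\<alpha> + 1/2) * ln pi
        + (2 * \<alpha>\<^sup>2 - \<alpha>) * ln 2)" for n
  proof -
    have "hankel_0_err n - real n * (hankel_0_err (Suc n) - hankel_0_err n)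
        = (ln (hankel_det \<alpha> n 0) - real n * ln (hh n)) - hankel_0_main n + real n * (hankel_0_main (Suc n) - hankel_0_main n)"
      unfolding hankel_0_err_def ln_hankel_Suc by (simp add: algebra_simps)
    then show ?thesis
      unfolding ln_hankel_minus hankel_0_main_def w_def v_def by (simp add: algebra_simps power2_eq_square)
  qed
  have "(\<lambda>n. real n * (hankel_0_err (Suc n) - hankel_0_err n)) \<in> O(\<lambda>n. real n * real n powr (-5))"
    by (intro landau_o.big.mult landau_o.big_refl D)
  also have "(\<lambda>n. real n * real n powr (-5)) \<in> o(\<lambda>n. 1)" by real_asymp
  finally have "(\<lambda>n. real n * (hankel_0_err (Suc n) - hankel_0_err n)) \<in> o(\<lambda>n. 1)" .
  from smalloD_tendsto[OF this] have z: "(\<lambda>n. real n * (hankel_0_err (Suc n) - hankel_0_err n)) \<longlonglongrightarrow> 0" by simp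
  have "(\<lambda>M. (- ((\<Sum>j=1..2 * M. real j * lr j) + (\<alpha>\<^sup>2 - 1/4) * ln (real (2 * M)))
      + real (2 * M) * w (2 * M) - v (2 * M) + (2 * ln (barnes_G (\<alpha> + 1)) - 2 * ln (barnes_G (1/2)) - (\<alpha> + 1/2) * ln pi
        + (2 * \<alpha>\<^sup>2 - \<alpha>) * ln 2)) + real (2 * M) * (hankel_0_err (Suc (2 * M)) - hankel_0_err (2 * M)))
    \<longlonglongrightarrow> (- (ln 2 + 2 * ln (barnes_G (1 + \<alpha>)) - 2 * ln (barnes_G (1/2)) - (\<alpha> + 1/2) * (ln 2 + ln pi)
      + (\<alpha>\<^sup>2 - 1/4) * (1 + 2 * ln 2)) + (\<alpha>\<^sup>2 - 1/4) - (correction_1 * 0 + correction_2 * 0 + correction_3 * 0)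
      + (2 * ln (barnes_G (\<alpha> + 1)) - 2 * ln (barnes_G (1/2)) - (\<alpha> + 1/2) * ln pi
        + (2 * \<alpha>\<^sup>2 - \<alpha>) * ln 2)) + 0"
    by (intro tendsto_add tendsto_diff tendsto_minus tendsto_const sum_weighted_log_rec_LIMSEQ
        filterlim_compose[OF nw filterlim_mult_2_nat] filterlim_compose[OF v filterlim_mult_2_nat]
        filterlim_compose[OF z filterlim_mult_2_nat])
  then have "(\<lambda>M. hankel_0_err (2 * M)) \<longlonglongrightarrow> (- (ln 2 + 2 * ln (barnes_G (1 + \<alpha>)) - 2 * ln (barnes_G (1/2)) - (\<alpha> + 1/2) * (ln 2 + ln pi)
      + (\<alpha>\<^sup>2 - 1/4) * (1 + 2 * ln 2)) + (\<alpha>\<^sup>2 - 1/4) - (correction_1 * 0 + correction_2 * 0 + correction_3 * 0)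
      + (2 * ln (barnes_G (\<alpha> + 1)) - 2 * ln (barnes_G (1/2)) - (\<alpha> + 1/2) * ln pi
        + (2 * \<alpha>\<^sup>2 - \<alpha>) * ln 2)) + 0"
    unfolding e[symmetric] by simp
  also have "(- (ln 2 + 2 * ln (barnes_G (1 + \<alpha>)) - 2 * ln (barnes_G (1/2)) - (\<alpha> + 1/2) * (ln 2 + ln pi)
      + (\<alpha>\<^sup>2 - 1/4) * (1 + 2 * ln 2)) + (\<alpha>\<^sup>2 - 1/4) - (correction_1 * 0 + correction_2 * 0 + correction_3 * 0)
      + (2 * ln (barnes_G (\<alpha> + 1)) - 2 * ln (barnes_G (1/2)) - (\<alpha> + 1/2) * ln pi
        + (2 * \<alpha>\<^sup>2 - \<alpha>) * ln 2)) + 0 = 0"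
    by (simp add: algebra_simps)
  finally have "(\<lambda>M. hankel_0_err (2 * M)) \<longlonglongrightarrow> 0" .
  with D show ?thesis using bigo_tail_subseq(2)[of hankel_0_err 4] by simp
qed

end

theorem theorem5p3:
  fixes \<alpha> t :: real
  assumes "\<alpha> > -1"
  shows
    "(\<exists>\<epsilon> :: nat \<Rightarrow> real. \<epsilon> \<in> O(\<lambda>n. 1 / real n ^ 4) \<and>
       (\<forall>\<^sub>F n in sequentially.
          hankel_det \<alpha> n t / hankel_det \<alpha> n 0 =
            exp (- (real n * t / 2) + t * (t + 8 * \<alpha>) / 16
                 + t * (1 - 4 * \<alpha>\<^sup>2) / (8 * real n)
                 + t * (1 - 4 * \<alpha>\<^sup>2) * (t - 4 * \<alpha>) / (32 * real n ^ 2)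
                 + t * (1 - 4 * \<alpha>\<^sup>2) * (t\<^sup>2 - 6 * \<alpha> * t + 12 * \<alpha>\<^sup>2 + 3) / (96 * real n ^ 3)
                 + \<epsilon> n)))
     \<and>
     (\<exists>\<epsilon> :: nat \<Rightarrow> real. \<epsilon> \<in> O(\<lambda>n. 1 / real n ^ 4) \<and>
       (\<forall>\<^sub>F n in sequentially.
          hankel_det \<alpha> n t =
            (pi powr (real n + \<alpha> + 1 / 2) * real n powr (\<alpha>\<^sup>2 - 1 / 4) * (barnes_G (1 / 2 :: real))\<^sup>2)
            / (2 powr (real n ^ 2 + (2 * \<alpha> - 1) * (real n + \<alpha>)) * (barnes_G (\<alpha> + 1))\<^sup>2)
            * exp (- (real n * t / 2) + t * (t + 8 * \<alpha>) / 16
                   + (1 - 4 * \<alpha>\<^sup>2) * (t - 2 * \<alpha>) / (8 * real n)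
                   + (1 - 4 * \<alpha>\<^sup>2) * (6 * t\<^sup>2 - 24 * \<alpha> * t + 28 * \<alpha>\<^sup>2 - 3) / (192 * real n ^ 2)
                   + (1 - 4 * \<alpha>\<^sup>2) * (t ^ 3 - 6 * \<alpha> * t\<^sup>2 + 3 * (1 + 4 * \<alpha>\<^sup>2) * t
                        + 3 * \<alpha> * (1 - 4 * \<alpha>\<^sup>2)) / (96 * real n ^ 3)
                   + \<epsilon> n)))"
proof -
  let ?T = "\<bar>t\<bar>"
  let ?D = "\<lambda>n t. hankel_det \<alpha> n t"
  define A where "A n = - (real n * t / 2) + t * (t + 8 * \<alpha>) / 16
                 + t * (1 - 4 * \<alpha>\<^sup>2) / (8 * real n)
                 + t * (1 - 4 * \<alpha>\<^sup>2) * (t - 4 * \<alpha>) / (32 * real n ^ 2)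
                 + t * (1 - 4 * \<alpha>\<^sup>2) * (t\<^sup>2 - 6 * \<alpha> * t + 12 * \<alpha>\<^sup>2 + 3) / (96 * real n ^ 3)" for n
  define \<epsilon> where "\<epsilon> n = ln (?D n t) - ln (?D n 0) - A n" for n
  have pos: "?D n s > 0" for n s by (rule hankel_det_pos[OF assms])
  have O4: "(\<lambda>n. real n powr (-4)) \<in> O(\<lambda>n. 1 / real n ^ 4)" by real_asymp
  have "\<epsilon> \<in> O(\<lambda>n. real n powr (-4))"
    unfolding \<epsilon>_def[abs_def] A_def
    by (rule unif_bigo_imp_bigo[OF ln_hankel_ratio_bigo[OF assms, of ?T]]) auto
  then have \<epsilon>: "\<epsilon> \<in> O(\<lambda>n. 1 / real n ^ 4)" using O4 by (rule landau_o.big_trans)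
  have ratio: "?D n t / ?D n 0 = exp (A n + \<epsilon> n)" for n
    using pos[of n t] pos[of n 0] by (simp add: \<epsilon>_def exp_diff)
  let ?e = "\<lambda>n. \<epsilon> n + hankel_0_err \<alpha> n"
  have e: "?e \<in> O(\<lambda>n. 1 / real n ^ 4)"
    using \<epsilon> landau_o.big_trans[OF hankel_0_err_bigo[OF assms] O4] by (rule sum_in_bigo)
  have G: "barnes_G (1/2 :: real) > 0" "barnes_G (\<alpha> + 1) > 0"
    using sum_ln_LIMSEQ_barnes_G(1)[of "-1/2"] sum_ln_LIMSEQ_barnes_G(1)[of \<alpha>] assms
    by (simp_all add: add.commute)
  define B where "B n = - (real n * t / 2) + t * (t + 8 * \<alpha>) / 16
                   + (1 - 4 * \<alpha>\<^sup>2) * (t - 2 * \<alpha>) / (8 * real n)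
                   + (1 - 4 * \<alpha>\<^sup>2) * (6 * t\<^sup>2 - 24 * \<alpha> * t + 28 * \<alpha>\<^sup>2 - 3) / (192 * real n ^ 2)
                   + (1 - 4 * \<alpha>\<^sup>2) * (t ^ 3 - 6 * \<alpha> * t\<^sup>2 + 3 * (1 + 4 * \<alpha>\<^sup>2) * t
                        + 3 * \<alpha> * (1 - 4 * \<alpha>\<^sup>2)) / (96 * real n ^ 3)" for n
  have asymp: "?D n t = (pi powr (real n + \<alpha> + 1 / 2) * real n powr (\<alpha>\<^sup>2 - 1 / 4) * (barnes_G (1 / 2 :: real))\<^sup>2)
            / (2 powr (real n ^ 2 + (2 * \<alpha> - 1) * (real n + \<alpha>)) * (barnes_G (\<alpha> + 1))\<^sup>2)
            * exp (B n + ?e n)" if n: "n \<ge> 1" for n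
  proof -
    define x where "x = 1 / real n"
    have x: "k / (8 * real n) = k / 8 * x" "k / (32 * real n ^ 2) = k / 32 * x ^ 2" "k / (192 * real n ^ 2) = k / 192 * x ^ 2"
      "k / (96 * real n ^ 3) = k / 96 * x ^ 3" "1 / real n = x" "1 / real n ^ 2 = x ^ 2" "1 / real n ^ 3 = x ^ 3" for k
      by (simp_all add: x_def power_divide)
    \<comment> \<open>The two exponents differ by a quantity independent of t, namely the value of
      \<open>B n\<close> at t = 0, where \<open>A n\<close> vanishes.\<close>
    have B: "B n = A n + correction_1 \<alpha> * (1 / real n) + correction_2 \<alpha> * (1 / real n ^ 2) + correction_3 \<alpha> * (1 / real n ^ 3)"
      unfolding A_def B_def correction_1_def[OF assms] correction_2_def[OF assms] correction_3_def[OF assms] x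
      by (simp add: field_simps power2_eq_square power3_eq_cube)
    have sq: "g\<^sup>2 = exp (2 * ln g)" if "g > 0" for g :: real
      using that by (simp add: exp_double)
    have "ln (?D n t) = \<epsilon> n + A n + (hankel_0_err \<alpha> n + hankel_0_main \<alpha> n)"
      by (simp add: \<epsilon>_def hankel_0_err_def[OF assms])
    also have "\<dots> = (real n + \<alpha> + 1/2) * ln pi + (\<alpha>\<^sup>2 - 1/4) * ln (real n) + 2 * ln (barnes_G (1/2))
        - ((real n ^ 2 + (2 * \<alpha> - 1) * (real n + \<alpha>)) * ln 2 + 2 * ln (barnes_G (\<alpha> + 1))) + (B n + ?e n)"
      unfolding B hankel_0_main_def[OF assms] by simp
    finally have "exp (ln (?D n t)) = exp ((real n + \<alpha> + 1/2) * ln pi) * exp ((\<alpha>\<^sup>2 - 1/4) * ln (real n))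
        * exp (2 * ln (barnes_G (1/2))) / (exp ((real n ^ 2 + (2 * \<alpha> - 1) * (real n + \<alpha>)) * ln 2)
        * exp (2 * ln (barnes_G (\<alpha> + 1)))) * exp (B n + ?e n)"
      by (simp only: exp_add exp_diff)
    then show ?thesis
      unfolding sq[OF G(1)] sq[OF G(2)] using pos[of n t] n by (simp add: powr_def)
  qed
  have "\<exists>\<epsilon> :: nat \<Rightarrow> real. \<epsilon> \<in> O(\<lambda>n. 1 / real n ^ 4) \<and> (\<forall>\<^sub>F n in sequentially. ?D n t / ?D n 0 = exp (A n + \<epsilon> n))"
    by (intro exI[of _ \<epsilon>] conjI \<epsilon> always_eventually allI ratio)
  moreover have "\<exists>\<epsilon> :: nat \<Rightarrow> real. \<epsilon> \<in> O(\<lambda>n. 1 / real n ^ 4) \<and> (\<forall>\<^sub>F n in sequentially. ?D n t =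
      (pi powr (real n + \<alpha> + 1 / 2) * real n powr (\<alpha>\<^sup>2 - 1 / 4) * (barnes_G (1 / 2 :: real))\<^sup>2)
            / (2 powr (real n ^ 2 + (2 * \<alpha> - 1) * (real n + \<alpha>)) * (barnes_G (\<alpha> + 1))\<^sup>2) * exp (B n + \<epsilon> n))"
    by (intro exI[of _ ?e] conjI e eventually_mono[OF eventually_ge_at_top[of 1] asymp])
  ultimately show ?thesis unfolding A_def B_def by (rule conjI)
qed

end
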